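(* Let $m\ge 1$, let $\alpha_1,\dots,\alpha_m$ be pairwise linearly independent linear forms on $\mathbb{C}^2$, and let $\beta=(\beta_1,\dots,\beta_m)\in\mathbb{C}^m$. Let $k$ be the number of indices $i$ with $\beta_i\in\mathbb{Z}$, and let $c(M_\alpha^\beta)$ be the number of decomposition factors of the $A_2$-module $M_\alpha^\beta$. Then: (i) If $k=m$, then $c(M_\alpha^\beta)=2m$. (ii) If $k<m$ and (a) $\sum_{i=1}^m\beta_i\in\mathbb{Z}$, then $c(M_\alpha^\beta)=m+k-1$; (b) $\sum_{i=1}^m\beta_i\in\mathbb{C}\setminus\mathbb{Z}$, then $c(M_\alpha^\beta)=k+1$.
   Context: $A_2=\mathbb{C}\langle x_1,x_2,\partial_1,\partial_2\rangle$ is the second Weyl algebra (over $\mathbb{C}$). Put $\alpha=\prod_{i=1}^m\alpha_i$ and let $\mathbb{C}[x]_\alpha$ be the localization of $\mathbb{C}[x]=\mathbb{C}[x_1,x_2]$ at $\alpha$. The module $M_\alpha^\beta$ is the free rank 1 $\mathbb{C}[x]_\alpha$-module on a generator written $\alpha^\beta$ (thought of as the multivalued function $\alpha_1^{\beta_1}\cdots\alpha_m^{\beta_m}$), made into a left $A_2$-module by $$\partial_j\alpha^\beta=\sum_{i=1}^m\frac{\beta_i\,\partial_j(\alpha_i)}{\alpha_i}\,\alpha^\beta,\qquad j=1,2,$$ extended to all of $M_\alpha^\beta$ by the Leibniz rule. For a module $M$ of finite length with composition series $0=M_0\subset M_1\subset\dots\subset M_r=M$, the decomposition factors are the simple quotients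 $M_i/M_{i-1}$ (counted with multiplicity) and $c(M)=r$ is their number. The module $M_\alpha^\beta$ is holonomic, hence of finite length. *)

theory Defs
  imports
    "HOL-Algebra.Module"
    "HOL-Algebra.QuotRing"
    "HOL-Library.Poly_Mapping"
    "HOL-Library.Extended_Nat"
    "HOL-Computational_Algebra.Polynomial"
    "HOL-Computational_Algebra.Fraction_Field"
begin

section \<open>Left modules and composition length\<close>

text \<open>HOL-Algebra's \<^locale>\<open>module\<close> requires a commutative ring of scalars; here the ring
  is arbitrary and acts from the left.\<close>

locale left_module = R?: ring R + M?: abelian_group M for R (structure) and M (structure) +
  assumes smult_closed:
      "\<lbrakk>a \<in> carrier R; x \<in> carrier M\<rbrakk> \<Longrightarrow> a \<odot>\<^bsub>M\<^esub> x \<in> carrier M"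
    and smult_l_distr:
      "\<lbrakk>a \<in> carrier R; b \<in> carrier R; x \<in> carrier M\<rbrakk> \<Longrightarrow>
      (a \<oplus>\<^bsub>R\<^esub> b) \<odot>\<^bsub>M\<^esub> x = (a \<odot>\<^bsub>M\<^esub> x) \<oplus>\<^bsub>M\<^esub> (b \<odot>\<^bsub>M\<^esub> x)"
    and smult_r_distr:
      "\<lbrakk>a \<in> carrier R; x \<in> carrier M; y \<in> carrier M\<rbrakk> \<Longrightarrow>
      a \<odot>\<^bsub>M\<^esub> (x \<oplus>\<^bsub>M\<^esub> y) = (a \<odot>\<^bsub>M\<^esub> x) \<oplus>\<^bsub>M\<^esub> (a \<odot>\<^bsub>M\<^esub> y)"
    and smult_assoc:
      "\<lbrakk>a \<in> carrier R; b \<in> carrier R; x \<in> carrier M\<rbrakk> \<Longrightarrow>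
      (a \<otimes>\<^bsub>R\<^esub> b) \<odot>\<^bsub>M\<^esub> x = a \<odot>\<^bsub>M\<^esub> (b \<odot>\<^bsub>M\<^esub> x)"
    and smult_one: "x \<in> carrier M \<Longrightarrow> \<one>\<^bsub>R\<^esub> \<odot>\<^bsub>M\<^esub> x = x"

text \<open>The library's \<^locale>\<open>submodule\<close> makes no commutativity assumption and is used as is. The
  ring part (\<^const>\<open>monoid.mult\<close>, \<^const>\<open>monoid.one\<close>) of a module record plays no role.\<close>

definition quotient_module :: "('r, 'a) module \<Rightarrow> 'a set \<Rightarrow> ('r, 'a set) module" where
  "quotient_module M H =
    \<lparr>carrier = a_rcosets\<^bsub>M\<^esub> H, monoid.mult = undefined, one = undefined, zero = H, add = set_add M,
     module.smult = (\<lambda>r C. \<Union>x\<in>C. H +>\<^bsub>M\<^esub> (r \<odot>\<^bsub>M\<^esub> x))\<rparr>"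

definition simple_module :: "('r, 's) ring_scheme \<Rightarrow> ('r, 'a) module \<Rightarrow> bool" where
  "simple_module R M \<longleftrightarrow> left_module R M \<and> carrier M \<noteq> {\<zero>\<^bsub>M\<^esub>} \<and>
    (\<forall>H. submodule H R M \<longrightarrow> H = {\<zero>\<^bsub>M\<^esub>} \<or> H = carrier M)"

definition composition_series ::
    "('r, 's) ring_scheme \<Rightarrow> ('r, 'a) module \<Rightarrow> nat \<Rightarrow> (nat \<Rightarrow> 'a set) \<Rightarrow> bool" where
  "composition_series R M r N \<longleftrightarrow>
    N 0 = {\<zero>\<^bsub>M\<^esub>} \<and> N r = carrier M \<and> (\<forall>i\<le>r. submodule (N i) R M) \<and>
    (\<forall>i<r. N i \<subset> N (Suc i) \<and>
      simple_module R (quotient_module (M\<lparr>carrier := N (Suc i)\<rparr>) (N i)))"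

text \<open>The number of decomposition factors. It is \<open>\<infinity>\<close> for a module without a composition
  series; for the others \<open>THE\<close> is justified by the Jordan-Hoelder theorem.\<close>

definition module_length :: "('r, 's) ring_scheme \<Rightarrow> ('r, 'a) module \<Rightarrow> enat" where
  "module_length R M =
    (if \<exists>r N. composition_series R M r N
     then enat (THE r. \<exists>N. composition_series R M r N) else \<infinity>)"


section \<open>The second Weyl algebra\<close>

datatype coord = C1 | C2

datatype weyl_gen = X coord | D coord

text \<open>The monoid of words in the four generators; its monoid algebra over the complex numbers is
  the free algebra.\<close>

datatype weyl_word = Word (letters: "weyl_gen list")

instantiation weyl_word :: monoid_add
begin
definition zero_weyl_word :: weyl_word where "0 = Word []"
definition plus_weyl_word :: "weyl_word \<Rightarrow> weyl_word \<Rightarrow> weyl_word" where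
  "v + w = Word (letters v @ letters w)"
instance
  by standard (simp_all add: zero_weyl_word_def plus_weyl_word_def)
end

type_synonym free_weyl = "weyl_word \<Rightarrow>\<^sub>0 complex"

definition free_algebra :: "free_weyl ring" where
  "free_algebra = \<lparr>carrier = UNIV, monoid.mult = (*), one = 1, zero = 0, add = (+)\<rparr>"

definition gen :: "weyl_gen \<Rightarrow> free_weyl" where
  "gen g = Poly_Mapping.single (Word [g]) 1"

definition weyl_relations :: "free_weyl set" where
  "weyl_relations =
    {gen (X i) * gen (X j) - gen (X j) * gen (X i) | i j. True} \<union>
    {gen (D i) * gen (D j) - gen (D j) * gen (D i) | i j. True} \<union>
    {gen (D i) * gen (X j) - gen (X j) * gen (D i) - (if i = j then 1 else 0) | i j. True}"

definition weyl_algebra :: "free_weyl set ring" where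
  "weyl_algebra = free_algebra Quot (Idl\<^bsub>free_algebra\<^esub> weyl_relations)"


section \<open>Polynomials and rational functions in two variables\<close>

text \<open>\<open>\<complex>[x\<^sub>1,x\<^sub>2]\<close> is represented as \<open>\<complex>[x\<^sub>1][x\<^sub>2]\<close>: the inner variable is \<open>x\<^sub>1\<close>, the outer one
  \<open>x\<^sub>2\<close>.\<close>

type_synonym poly2 = "complex poly poly"
type_synonym ratfun2 = "poly2 fract"

fun var :: "coord \<Rightarrow> poly2" where
  "var C1 = [:[:0, 1:]:]"
| "var C2 = [:0, 1:]"

definition const2 :: "complex \<Rightarrow> poly2" where
  "const2 c = [:[:c:]:]"

fun pd :: "coord \<Rightarrow> poly2 \<Rightarrow> poly2" where
  "pd C1 p = map_poly pderiv p"
| "pd C2 p = pderiv p"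

definition linear_form :: "poly2 \<Rightarrow> bool" where
  "linear_form p \<longleftrightarrow> (\<exists>a b. p = const2 a * var C1 + const2 b * var C2)"

definition lin_indep2 :: "poly2 \<Rightarrow> poly2 \<Rightarrow> bool" where
  "lin_indep2 p q \<longleftrightarrow> (\<forall>c d. const2 c * p + const2 d * q = 0 \<longrightarrow> c = 0 \<and> d = 0)"

lemma pd_0 [simp]: "pd i 0 = 0" and pd_1 [simp]: "pd i 1 = 0"
  by (cases i; simp add: map_poly_1)+

lemma pd_add: "pd i (p + q) = pd i p + pd i q"
proof (cases i)
  case C1
  then show ?thesis by (auto intro!: poly_eqI simp: coeff_map_poly pderiv_add)
qed (simp add: pderiv_add)

lemma pd_minus: "pd i (- p) = - pd i p"
  using pd_add[of i p "- p"] by (simp add: eq_neg_iff_add_eq_0 add.commute)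

lemma pd_diff: "pd i (p - q) = pd i p - pd i q"
  using pd_add[of i p "- q"] by (simp add: pd_minus)

lemma pd_mult: "pd i (p * q) = pd i p * q + p * pd i q"
proof (cases i)
  case C1
  have sm: "map_poly pderiv (smult a q) = smult (pderiv a) q + smult a (map_poly pderiv q)"
    for a :: "complex poly" and q
    by (intro poly_eqI) (simp add: coeff_map_poly pderiv_mult algebra_simps)
  have "map_poly pderiv (p * q) = map_poly pderiv p * q + p * map_poly pderiv q"
  proof (induction p)
    case (pCons a p)
    then show ?case
      using pd_add[of C1 "smult a q" "pCons 0 (p * q)"]
      by (simp add: sm map_poly_pCons algebra_simps)
  qed simp
  with C1 show ?thesis by simp
qed (simp add: pderiv_mult algebra_simps)

lemma pd_commute: "pd i (pd j p) = pd j (pd i p)"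
proof -
  have "map_poly pderiv (pderiv p) = pderiv (map_poly pderiv p)"
  proof (rule poly_eqI)
    fix n
    have "pderiv (of_nat k * q) = of_nat k * pderiv q" for k and q :: "complex poly"
      by (simp add: pderiv_mult pderiv_of_nat)
    from this[of "Suc n"] show "coeff (map_poly pderiv (pderiv p)) n = coeff (pderiv (map_poly pderiv p)) n"
      by (simp add: coeff_map_poly coeff_pderiv)
  qed
  then show ?thesis by (cases i; cases j) simp_all
qed

lemma pd_quotient_cong:
  assumes e: "a * d = c * b"
  shows "(pd i a * b - a * pd i b) * (d * d) = (pd i c * d - c * pd i d) * (b * b)"
proof -
  from e have "pd i (a * d) = pd i (c * b)" by simp
  then have e': "pd i a * d = pd i c * b + c * pd i b - a * pd i d"
    by (simp add: pd_mult algebra_simps del: pd.simps)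
  have "(pd i a * b - a * pd i b) * (d * d) = b * d * (pd i a * d) - pd i b * d * (a * d)"
    by (simp add: algebra_simps del: pd.simps)
  also have "\<dots> = b * d * (pd i c * b) - b * pd i d * (a * d)"
    unfolding e' by (simp add: e algebra_simps del: pd.simps)
  also have "\<dots> = (pd i c * d - c * pd i d) * (b * b)"
    by (simp add: e algebra_simps del: pd.simps)
  finally show ?thesis .
qed

lift_definition fpd :: "coord \<Rightarrow> ratfun2 \<Rightarrow> ratfun2" is
  "\<lambda>i (p, q). (pd i p * q - p * pd i q, q * q)"
  by (auto simp del: pd.simps intro: pd_quotient_cong)

lemma fpd_Fract: "q \<noteq> 0 \<Longrightarrow> fpd i (Fract p q) = Fract (pd i p * q - p * pd i q) (q * q)"
  by transfer simp


section \<open>The module \<open>M\<^sub>\<alpha>\<^sup>\<beta>\<close>\<close>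

text \<open>The localization \<open>\<complex>[x]\<^sub>a\<close>, as a subring of the field of rational functions (for \<open>a \<noteq> 0\<close>).\<close>

definition localization :: "poly2 \<Rightarrow> ratfun2 set" where
  "localization a = {Fract p (a ^ n) | p n. True}"

text \<open>A rational function \<open>f\<close> stands for \<open>f \<alpha>\<^sup>\<beta>\<close>. The Leibniz rule gives
  \<open>\<partial>\<^sub>j (f \<alpha>\<^sup>\<beta>) = (\<partial>\<^sub>j f + f (\<Sum>i. \<beta>\<^sub>i \<partial>\<^sub>j \<alpha>\<^sub>i / \<alpha>\<^sub>i)) \<alpha>\<^sup>\<beta>\<close>.\<close>

fun gen_act :: "nat \<Rightarrow> (nat \<Rightarrow> poly2) \<Rightarrow> (nat \<Rightarrow> complex) \<Rightarrow> weyl_gen \<Rightarrow> ratfun2 \<Rightarrow> ratfun2" where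
  "gen_act m \<alpha> \<beta> (X j) f = Fract (var j) 1 * f"
| "gen_act m \<alpha> \<beta> (D j) f =
     fpd j f + f * (\<Sum>i=1..m. Fract (const2 (\<beta> i) * pd j (\<alpha> i)) (\<alpha> i))"

definition free_act ::
    "nat \<Rightarrow> (nat \<Rightarrow> poly2) \<Rightarrow> (nat \<Rightarrow> complex) \<Rightarrow> free_weyl \<Rightarrow> ratfun2 \<Rightarrow> ratfun2" where
  "free_act m \<alpha> \<beta> p f =
    (\<Sum>w\<in>Poly_Mapping.keys p.
      Fract (const2 (Poly_Mapping.lookup p w)) 1 * foldr (gen_act m \<alpha> \<beta>) (letters w) f)"

text \<open>An element of the Weyl algebra is a coset; all its members act in the same way (see
  \<open>weyl_act_coset\<close> below).\<close>

definition weyl_act ::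
    "nat \<Rightarrow> (nat \<Rightarrow> poly2) \<Rightarrow> (nat \<Rightarrow> complex) \<Rightarrow> free_weyl set \<Rightarrow> ratfun2 \<Rightarrow> ratfun2" where
  "weyl_act m \<alpha> \<beta> P f = the_elem ((\<lambda>p. free_act m \<alpha> \<beta> p f) ` P)"

definition M_module ::
    "nat \<Rightarrow> (nat \<Rightarrow> poly2) \<Rightarrow> (nat \<Rightarrow> complex) \<Rightarrow> (free_weyl set, ratfun2) module" where
  "M_module m \<alpha> \<beta> =
    \<lparr>carrier = localization (\<Prod>i=1..m. \<alpha> i), monoid.mult = (*), one = 1, zero = 0, add = (+),
     module.smult = weyl_act m \<alpha> \<beta>\<rparr>"


section \<open>\<open>M\<^sub>\<alpha>\<^sup>\<beta>\<close> is a left module over the Weyl algebra\<close>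

lemma free_algebra_simps [simp]:
  "carrier free_algebra = UNIV" "p \<otimes>\<^bsub>free_algebra\<^esub> q = p * q"
  "p \<oplus>\<^bsub>free_algebra\<^esub> q = p + q" "\<one>\<^bsub>free_algebra\<^esub> = 1" "\<zero>\<^bsub>free_algebra\<^esub> = 0"
  by (simp_all add: free_algebra_def)

lemma free_algebra_ring: "ring free_algebra"
proof -
  have "\<exists>y. y + x = 0 \<and> x + y = 0" for x :: free_weyl
    by (rule exI[of _ "- x"]) simp
  then show ?thesis
    by (unfold_locales) (auto simp: free_algebra_def Units_def algebra_simps)
qed

lemma weyl_ideal: "ideal (Idl\<^bsub>free_algebra\<^esub> weyl_relations) free_algebra"
  by (rule ring.genideal_ideal[OF free_algebra_ring]) (simp add: free_algebra_def)

lemma weyl_algebra_ring: "ring weyl_algebra"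
  unfolding weyl_algebra_def by (rule ideal.quotient_is_ring[OF weyl_ideal])

lemma fpd_add: "fpd i (f + g) = fpd i f + fpd i g"
proof -
  obtain a b where f: "f = Fract a b" "b \<noteq> 0" by (cases f)
  obtain c d where g: "g = Fract c d" "d \<noteq> 0" by (cases g)
  show ?thesis using f g
    by (simp add: fpd_Fract eq_fract pd_mult pd_add algebra_simps del: pd.simps)
qed

lemma fpd_mult: "fpd i (f * g) = fpd i f * g + f * fpd i g"
proof -
  obtain a b where f: "f = Fract a b" "b \<noteq> 0" by (cases f)
  obtain c d where g: "g = Fract c d" "d \<noteq> 0" by (cases g)
  show ?thesis using f g
    by (simp add: fpd_Fract eq_fract pd_mult pd_add algebra_simps del: pd.simps)
qed

lemma fpd_commute: "fpd i (fpd j f) = fpd j (fpd i f)"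
proof -
  obtain a b where f: "f = Fract a b" "b \<noteq> 0" by (cases f)
  show ?thesis using f
    by (simp add: fpd_Fract eq_fract pd_mult pd_diff pd_commute[of i j] algebra_simps del: pd.simps)
qed

lemma fpd_0 [simp]: "fpd i 0 = 0"
  by (simp add: Zero_fract_def fpd_Fract eq_fract del: pd.simps)

lemma fpd_sum: "fpd i (sum f A) = (\<Sum>x\<in>A. fpd i (f x))"
  by (induction A rule: infinite_finite_induct) (auto simp: fpd_add)

lemma pd_const: "pd i (const2 c) = 0"
  by (cases i) (simp_all add: const2_def map_poly_pCons)

lemma pd_var: "pd i (var j) = (if i = j then 1 else 0)"
  by (cases i; cases j) (simp_all add: map_poly_pCons pderiv_pCons one_pCons)

lemma fpd_const: "fpd i (Fract (const2 c) 1) = 0"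
  by (simp add: fpd_Fract pd_const Zero_fract_def del: pd.simps)

lemma fpd_var: "fpd i (Fract (var j) 1) = (if i = j then 1 else 0)"
  by (simp add: fpd_Fract pd_var Zero_fract_def One_fract_def del: pd.simps)

context
  fixes m :: nat and \<alpha> :: "nat \<Rightarrow> poly2" and \<beta> :: "nat \<Rightarrow> complex"
begin

private abbreviation (input) "ga \<equiv> gen_act m \<alpha> \<beta>"
private abbreviation (input) "fa \<equiv> free_act m \<alpha> \<beta>"
private abbreviation (input) "cc c \<equiv> (Fract (const2 c) 1 :: ratfun2)"

lemma fpd_log_form:
  "fpd j (\<Sum>i=1..m. Fract (const2 (\<beta> i) * pd k (\<alpha> i)) (\<alpha> i)) =
   fpd k (\<Sum>i=1..m. Fract (const2 (\<beta> i) * pd j (\<alpha> i)) (\<alpha> i))"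
  unfolding fpd_sum
proof (rule sum.cong[OF refl])
  fix i
  show "fpd j (Fract (const2 (\<beta> i) * pd k (\<alpha> i)) (\<alpha> i)) =
        fpd k (Fract (const2 (\<beta> i) * pd j (\<alpha> i)) (\<alpha> i))"
  proof (cases "\<alpha> i = 0")
    case False
    then show ?thesis
      by (simp add: fpd_Fract pd_mult pd_const pd_commute[of j k] algebra_simps del: pd.simps)
  qed (simp add: eq_fract Zero_fract_def[symmetric] del: pd.simps)
qed

lemma gen_act_add: "ga g (f + h) = ga g f + ga g h"
  by (cases g) (simp_all add: fpd_add algebra_simps)

lemma gen_act_const: "ga g (cc c * f) = cc c * ga g f"
  by (cases g) (simp_all add: fpd_mult fpd_const algebra_simps del: mult_fract)

lemma gen_act_X_X: "ga (X i) (ga (X j) f) = ga (X j) (ga (X i) f)"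
  by (simp add: algebra_simps del: mult_fract)

lemma gen_act_D_X:
  "ga (D i) (ga (X j) f) = ga (X j) (ga (D i) f) + (if i = j then f else 0)"
  by (simp add: fpd_mult fpd_var algebra_simps del: mult_fract)

lemma gen_act_D_D: "ga (D i) (ga (D j) f) = ga (D j) (ga (D i) f)"
  by (simp add: fpd_mult fpd_add fpd_log_form[of i j] fpd_commute[of i j] algebra_simps
      del: mult_fract One_nat_def)

lemma foldr_gen_act_add: "foldr ga ws (f + h) = foldr ga ws f + foldr ga ws h"
  by (induction ws) (simp_all add: gen_act_add del: gen_act.simps)

lemma foldr_gen_act_const: "foldr ga ws (cc c * f) = cc c * foldr ga ws f"
  by (induction ws) (simp_all add: gen_act_const del: gen_act.simps)

lemma cc_0: "cc 0 = 0"
  by (simp add: const2_def Zero_fract_def)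

lemma cc_1: "cc 1 = 1"
  by (simp add: const2_def One_fract_def one_pCons)

lemma cc_add: "cc (a + b) = cc a + cc b"
  by (simp add: const2_def)

lemma cc_mult: "cc (a * b) = cc a * cc b"
  by (simp add: const2_def)

lemma free_act_superset:
  assumes "finite S" "Poly_Mapping.keys p \<subseteq> S"
  shows "fa p f = (\<Sum>w\<in>S. cc (Poly_Mapping.lookup p w) * foldr ga (letters w) f)"
  unfolding free_act_def
  by (rule sum.mono_neutral_left) (use assms in \<open>auto simp: in_keys_iff cc_0\<close>)

lemma free_act_plus: "fa (p + q) f = fa p f + fa q f"
proof -
  let ?S = "Poly_Mapping.keys p \<union> Poly_Mapping.keys q"
  have "finite ?S" "Poly_Mapping.keys (p + q) \<subseteq> ?S" by (auto simp: keys_add)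
  then show ?thesis
    by (simp add: free_act_superset[of ?S] lookup_add cc_add algebra_simps sum.distrib
        del: mult_fract add_fract)
qed

lemma free_act_0: "fa 0 f = 0"
  by (simp add: free_act_def)

lemma free_act_uminus: "fa (- p) f = - fa p f"
  using free_act_plus[of p "- p" f] by (simp add: free_act_0 eq_neg_iff_add_eq_0 add.commute)

lemma free_act_minus: "fa (p - q) f = fa p f - fa q f"
  using free_act_plus[of p "- q" f] by (simp add: free_act_uminus)

lemma free_act_single: "fa (Poly_Mapping.single w c) f = cc c * foldr ga (letters w) f"
  by (simp add: free_act_superset[of "{w}"])

lemma free_act_add_arg: "fa p (f + h) = fa p f + fa p h"
  by (simp add: free_act_def foldr_gen_act_add sum.distrib algebra_simps del: mult_fract)

lemma free_act_zero_arg: "fa p 0 = 0"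
  using free_act_add_arg[of p 0 0] by (metis add.right_neutral add_left_cancel)

lemma free_act_const_arg: "fa p (cc c * f) = cc c * fa p f"
  by (simp add: free_act_def foldr_gen_act_const sum_distrib_left mult.left_commute
      del: mult_fract)

lemma update_eq_add_single:
  "a \<notin> Poly_Mapping.keys p \<Longrightarrow> Poly_Mapping.update a b p = p + Poly_Mapping.single a b"
  by (rule poly_mapping_eqI)
    (auto simp: lookup_update lookup_add lookup_single when_def in_keys_iff)

lemma free_weyl_induct [case_names zero add]:
  fixes p :: free_weyl
  assumes "P 0" "\<And>p w c. P p \<Longrightarrow> P (p + Poly_Mapping.single w c)"
  shows "P p"
  by (induction p rule: update_induct) (simp_all add: assms update_eq_add_single)

lemma free_act_mult: "fa (p * q) f = fa p (fa q f)"
proof (induction p rule: free_weyl_induct)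
  case (add p w c)
  have "fa (Poly_Mapping.single w c * q) f = fa (Poly_Mapping.single w c) (fa q f)"
  proof (induction q rule: free_weyl_induct)
    case (add q v d)
    then show ?case
      by (simp add: distrib_left free_act_plus mult_single free_act_single plus_weyl_word_def
          free_act_add_arg foldr_gen_act_const foldr_gen_act_add cc_mult mult.assoc
          del: mult_fract)
  qed (simp add: free_act_0 free_act_zero_arg)
  with add show ?case by (simp add: distrib_right free_act_plus)
qed (simp add: free_act_0)

lemma free_act_gen: "fa (gen g) f = ga g f"
  by (simp add: gen_def free_act_single cc_1 del: gen_act.simps)

lemma free_act_one: "fa 1 f = f"
proof -
  have "fa (Poly_Mapping.single 0 1) f = f"
    by (simp only: free_act_single cc_1) (simp add: zero_weyl_word_def)
  then show ?thesis by simp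
qed

lemma free_act_relations: "p \<in> weyl_relations \<Longrightarrow> fa p f = 0"
  unfolding weyl_relations_def
  by (auto simp: free_act_minus free_act_mult free_act_gen gen_act_D_X free_act_one free_act_0
      intro: gen_act_X_X gen_act_D_D simp del: gen_act.simps)

lemma free_act_ideal: "p \<in> Idl\<^bsub>free_algebra\<^esub> weyl_relations \<Longrightarrow> fa p f = 0"
proof -
  interpret F: ring free_algebra by (rule free_algebra_ring)
  define K where "K = {p. \<forall>f. fa p f = 0}"
  have inv: "\<ominus>\<^bsub>free_algebra\<^esub> p = - p" for p
    by (rule F.minus_equality) (simp_all add: free_algebra_def)
  have "ideal K free_algebra"
  proof (rule idealI[OF free_algebra_ring])
    show "subgroup K (add_monoid free_algebra)"
      by (rule F.add.subgroupI)
        (auto simp: K_def free_act_plus free_act_uminus inv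
          intro!: exI[of _ "0 :: free_weyl"] free_act_0)
  qed (auto simp: K_def free_act_mult free_act_zero_arg)
  then have "Idl\<^bsub>free_algebra\<^esub> weyl_relations \<subseteq> K"
    by (rule F.genideal_minimal) (auto simp: K_def free_act_relations)
  then show "p \<in> Idl\<^bsub>free_algebra\<^esub> weyl_relations \<Longrightarrow> fa p f = 0"
    by (auto simp: K_def)
qed

lemma weyl_act_coset:
  "weyl_act m \<alpha> \<beta> (Idl\<^bsub>free_algebra\<^esub> weyl_relations +>\<^bsub>free_algebra\<^esub> p) f = fa p f"
proof -
  let ?I = "Idl\<^bsub>free_algebra\<^esub> weyl_relations"
  have "0 \<in> ?I"
    using additive_subgroup.zero_closed[OF ideal.axioms(1)[OF weyl_ideal]]
    by (simp add: free_algebra_def)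
  moreover have "?I +>\<^bsub>free_algebra\<^esub> p = (\<lambda>q. q + p) ` ?I"
    by (auto simp: a_r_coset_def r_coset_def free_algebra_def)
  ultimately have "(\<lambda>q. fa q f) ` (?I +>\<^bsub>free_algebra\<^esub> p) = {fa p f}"
    by (auto simp: free_act_plus free_act_ideal image_image)
  then show ?thesis by (simp add: weyl_act_def)
qed

end

lemma localization_closed:
  assumes "a \<noteq> 0" "f \<in> localization a"
  shows "g \<in> localization a \<Longrightarrow> f + g \<in> localization a"
    and "g \<in> localization a \<Longrightarrow> f * g \<in> localization a"
    and "fpd i f \<in> localization a"
proof -
  obtain p n where f: "f = Fract p (a ^ n)"
    using assms(2) by (auto simp: localization_def)
  have mem: "Fract q (a ^ l) \<in> localization a" for q l
    by (auto simp: localization_def)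
  show "fpd i f \<in> localization a"
    using assms(1) mem[of _ "n + n"] by (simp add: f fpd_Fract power_add del: pd.simps)
  assume "g \<in> localization a"
  then obtain q l where g: "g = Fract q (a ^ l)" by (auto simp: localization_def)
  show "f + g \<in> localization a" "f * g \<in> localization a"
    using assms(1) mem[of _ "n + l"] by (simp_all add: f g power_add)
qed

lemma localization_poly: "Fract p 1 \<in> localization a"
  unfolding localization_def by (rule CollectI, rule exI[of _ p], rule exI[of _ 0]) simp

lemma localization_factor:
  fixes m :: nat
  assumes "i \<in> {1..m}" "\<forall>i\<in>{1..m}. \<alpha> i \<noteq> 0"
  shows "Fract q (\<alpha> i) \<in> localization (\<Prod>i=1..m. \<alpha> i)"
proof -
  let ?P = "\<Prod>j\<in>{1..m} - {i}. \<alpha> j"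
  have "(\<Prod>i=1..m. \<alpha> i) = ?P * \<alpha> i"
    using assms(1) by (subst prod.remove[of _ i]) (auto simp: mult.commute)
  moreover have "?P \<noteq> 0" using assms(2) by auto
  ultimately have "Fract q (\<alpha> i) = Fract (?P * q) ((\<Prod>i=1..m. \<alpha> i) ^ 1)"
    by (simp add: mult_fract_cancel)
  then show ?thesis unfolding localization_def by blast
qed

lemma gen_act_closed:
  assumes "\<forall>i\<in>{1..m}. \<alpha> i \<noteq> 0" and f: "f \<in> localization (\<Prod>i=1..m. \<alpha> i)"
  shows "gen_act m \<alpha> \<beta> g f \<in> localization (\<Prod>i=1..m. \<alpha> i)"
proof -
  let ?L = "localization (\<Prod>i=1..m. \<alpha> i)"
  have nz: "(\<Prod>i=1..m. \<alpha> i) \<noteq> 0" using assms(1) by auto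
  have zero: "0 \<in> ?L" using localization_poly[of 0] by (simp add: Zero_fract_def)
  have "(\<Sum>i\<in>S. Fract (const2 (\<beta> i) * pd j (\<alpha> i)) (\<alpha> i)) \<in> ?L" if "S \<subseteq> {1..m}" for S j
    using that
  proof (induction S rule: infinite_finite_induct)
    case (insert i S)
    then have "Fract (const2 (\<beta> i) * pd j (\<alpha> i)) (\<alpha> i) \<in> ?L"
      using assms(1) by (intro localization_factor) auto
    with insert show ?case using localization_closed(1)[OF nz] by auto
  qed (simp_all add: zero del: One_nat_def)
  from this[OF subset_refl] show ?thesis
    using localization_closed[OF nz] localization_poly f by (cases g) auto
qed

lemma free_act_closed:
  assumes "\<forall>i\<in>{1..m}. \<alpha> i \<noteq> 0" and f: "f \<in> localization (\<Prod>i=1..m. \<alpha> i)"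
  shows "free_act m \<alpha> \<beta> p f \<in> localization (\<Prod>i=1..m. \<alpha> i)"
proof (induction p rule: free_weyl_induct)
  case zero
  then show ?case using localization_poly[of 0] by (simp add: free_act_0 Zero_fract_def)
next
  case (add p w c)
  have nz: "(\<Prod>i=1..m. \<alpha> i) \<noteq> 0" using assms(1) by auto
  have "foldr (gen_act m \<alpha> \<beta>) ws f \<in> localization (\<Prod>i=1..m. \<alpha> i)" for ws
    by (induction ws) (auto simp del: gen_act.simps One_nat_def intro: gen_act_closed[OF assms(1)] assms(2))
  with add show ?case
    by (simp add: free_act_plus free_act_single localization_closed[OF nz] localization_poly
        del: mult_fract One_nat_def)
qed

lemma M_module_left_module:
  assumes "\<forall>i\<in>{1..m}. \<alpha> i \<noteq> 0"
  shows "left_module weyl_algebra (M_module m \<alpha> \<beta>)"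
proof -
  let ?I = "Idl\<^bsub>free_algebra\<^esub> weyl_relations" and ?L = "localization (\<Prod>i=1..m. \<alpha> i)"
  have nz: "(\<Prod>i=1..m. \<alpha> i) \<noteq> 0" using assms by auto
  have zero: "0 \<in> ?L" using localization_poly[of 0] by (simp add: Zero_fract_def)
  have minus: "- f \<in> ?L" if "f \<in> ?L" for f
    using localization_closed(2)[OF nz that localization_poly[of "- 1"]]
    by (simp add: minus_fract[symmetric] One_fract_def[symmetric] del: minus_fract)
  have car: "\<exists>p. A = ?I +>\<^bsub>free_algebra\<^esub> p" if "A \<in> carrier weyl_algebra" for A
    using that by (auto simp: weyl_algebra_def FactRing_def A_RCOSETS_def')
  have add: "(?I +>\<^bsub>free_algebra\<^esub> p) \<oplus>\<^bsub>weyl_algebra\<^esub> (?I +>\<^bsub>free_algebra\<^esub> q) =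
      ?I +>\<^bsub>free_algebra\<^esub> (p + q)" for p q
    using abelian_subgroup.a_rcos_sum[OF abelian_subgroupI3[OF ideal.axioms(1)[OF weyl_ideal]
          ring.is_abelian_group[OF free_algebra_ring]], of p q]
    by (simp add: weyl_algebra_def FactRing_def)
  have mul: "(?I +>\<^bsub>free_algebra\<^esub> p) \<otimes>\<^bsub>weyl_algebra\<^esub> (?I +>\<^bsub>free_algebra\<^esub> q) =
      ?I +>\<^bsub>free_algebra\<^esub> (p * q)" for p q
    using ideal.rcoset_mult_add[OF weyl_ideal, of p q]
    by (simp add: weyl_algebra_def FactRing_def)
  have one: "\<one>\<^bsub>weyl_algebra\<^esub> = ?I +>\<^bsub>free_algebra\<^esub> 1"
    by (simp add: weyl_algebra_def FactRing_def)
  have ab: "abelian_group (M_module m \<alpha> \<beta>)"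
  proof (rule abelian_groupI)
    fix x assume "x \<in> carrier (M_module m \<alpha> \<beta>)"
    then show "\<exists>y\<in>carrier (M_module m \<alpha> \<beta>). y \<oplus>\<^bsub>M_module m \<alpha> \<beta>\<^esub> x = \<zero>\<^bsub>M_module m \<alpha> \<beta>\<^esub>"
      by (auto simp: M_module_def intro!: bexI[of _ "- x"] minus simp del: One_nat_def)
  qed (auto simp: M_module_def localization_closed[OF nz] zero algebra_simps simp del: One_nat_def)
  show ?thesis
  proof (intro left_module.intro weyl_algebra_ring ab left_module_axioms.intro)
  qed (auto dest!: car simp: add mul one, auto simp: M_module_def weyl_act_coset free_act_closed
      assms free_act_plus free_act_add_arg free_act_mult free_act_one simp del: One_nat_def)
qed

end

theory Submission
  imports Defs
begin

text \<open>A composition series is a maximal chain of subspaces stable under the four generators. Such a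
  subspace is graded by the eigenvalues of the Euler operator \<open>x\<^sub>1\<partial>\<^sub>1 + x\<^sub>2\<partial>\<^sub>2\<close>, and because
  \<open>\<partial>\<^sub>1x\<^sub>1 + \<partial>\<^sub>2x\<^sub>2\<close> acts on degree \<open>c\<close> as \<open>c + 2\<close>, quotients supported at the origin are governed by
  their part of degree \<open>-2\<close>. Shifting \<open>\<beta>\<close> by integers one may assume that the integral \<open>\<beta>\<^sub>i\<close> vanish,
  and that \<open>\<Sum>\<beta>\<^sub>i = 0\<close> if this sum is an integer. For a set \<open>S\<close> of lines let \<open>N\<^sub>S\<close> be the submodule of the
  localization at the forms of \<open>S\<close> obtained by removing all composition factors at the origin that
  can be split off as quotients. With \<open>S\<close> the lines of nonintegral exponent, \<open>N\<^sub>S\<close> is simple,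
  and each further line adds one factor supported on it, which gives \<open>k + 1\<close> factors. What remains are
  the factors supported at the origin; their number is the dimension of the degree \<open>-2\<close>
  part modulo the first derivatives of elements of degree \<open>-1\<close>. It is zero if \<open>\<Sum>\<beta>\<^sub>i\<close> is not an integer; otherwise reduction of pole
  orders represents it by the quotients \<open>p/\<alpha>\<close> with \<open>p\<close> homogeneous of degree \<open>m - 2\<close>, modulo the one
  relation coming from the logarithmic form \<open>\<Sum>\<beta>\<^sub>i d\<alpha>\<^sub>i/\<alpha>\<^sub>i\<close>, which is trivial iff \<open>\<beta> = 0\<close>.\<close>


section \<open>Composition length\<close>

text \<open>Call a degree good if it is not of the form -2 - n. The delta module at the origin has
  only the degrees -2, -3, ..., so a submodule generated by good degrees has no quotient supported
  there; \<open>cogen M (boundaries M)\<close> is this submodule, the \<open>N\<^sub>S\<close> of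
  the overview. The obstacle is to decide which elements of degree -2 are sums of first derivatives
  of elements of degree -1. Contracting the 2-form f dx1 dx2 with the Euler field turns the question
  into a first order one: f is such a sum iff some h of degree 0 satisfies dh = f (x2 dx1 - x1 dx2),
  provided that poles are allowed along at least one line. Pole orders of h and f can then be
  compared line by line: after normalizing, \<beta>_i + n is nonzero for every integer n other than
  0, so that differentiating across a line on which h has a pole raises its order by exactly one.
  Forms p of degree m - 2 make up a space of dimension m - 1. Hence the totals are 1 + k + (m - 1)
  if all exponents are integral, and 1 + k + (m - 2) if only their sum is.\<close>

context left_module
begin

lemma smult_zero_left: "x \<in> carrier M \<Longrightarrow> \<zero>\<^bsub>R\<^esub> \<odot>\<^bsub>M\<^esub> x = \<zero>\<^bsub>M\<^esub>"
  using smult_l_distr[of "\<zero>\<^bsub>R\<^esub>" "\<zero>\<^bsub>R\<^esub>" x] smult_closed[of "\<zero>\<^bsub>R\<^esub>" x] by simp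

lemma smult_minus_one: "x \<in> carrier M \<Longrightarrow> (\<ominus>\<^bsub>R\<^esub> \<one>\<^bsub>R\<^esub>) \<odot>\<^bsub>M\<^esub> x = \<ominus>\<^bsub>M\<^esub> x"
proof -
  assume x: "x \<in> carrier M"
  have "(\<ominus>\<^bsub>R\<^esub> \<one>\<^bsub>R\<^esub>) \<odot>\<^bsub>M\<^esub> x \<oplus>\<^bsub>M\<^esub> x = \<zero>\<^bsub>M\<^esub>"
    using smult_l_distr[of "\<ominus>\<^bsub>R\<^esub> \<one>\<^bsub>R\<^esub>" "\<one>\<^bsub>R\<^esub>" x] x
    by (simp add: smult_one smult_zero_left R.l_neg)
  then show ?thesis using x smult_closed[of "\<ominus>\<^bsub>R\<^esub> \<one>\<^bsub>R\<^esub>" x] by (simp add: M.minus_equality)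
qed

text \<open>Negatives come from the scalar -1, so closure under addition and scalars
  suffices.\<close>

lemma submodule_iff:
  "submodule H R M \<longleftrightarrow> H \<subseteq> carrier M \<and> \<zero>\<^bsub>M\<^esub> \<in> H \<and>
    (\<forall>x\<in>H. \<forall>y\<in>H. x \<oplus>\<^bsub>M\<^esub> y \<in> H) \<and> (\<forall>a\<in>carrier R. \<forall>x\<in>H. a \<odot>\<^bsub>M\<^esub> x \<in> H)"
proof
  assume "submodule H R M"
  then interpret submodule H R M .
  show "H \<subseteq> carrier M \<and> \<zero>\<^bsub>M\<^esub> \<in> H \<and>
    (\<forall>x\<in>H. \<forall>y\<in>H. x \<oplus>\<^bsub>M\<^esub> y \<in> H) \<and> (\<forall>a\<in>carrier R. \<forall>x\<in>H. a \<odot>\<^bsub>M\<^esub> x \<in> H)"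
    using subset one_closed m_closed by (auto simp del: M.add.m_comm)
next
  assume H: "H \<subseteq> carrier M \<and> \<zero>\<^bsub>M\<^esub> \<in> H \<and>
    (\<forall>x\<in>H. \<forall>y\<in>H. x \<oplus>\<^bsub>M\<^esub> y \<in> H) \<and> (\<forall>a\<in>carrier R. \<forall>x\<in>H. a \<odot>\<^bsub>M\<^esub> x \<in> H)"
  have "\<ominus>\<^bsub>M\<^esub> x \<in> H" if "x \<in> H" for x
    using H that smult_minus_one[of x] by (metis R.add.inv_closed R.one_closed subsetD)
  then show "submodule H R M"
    using H by (intro submodule.intro subgroup.intro submodule_axioms.intro)
      (auto simp: a_inv_def)
qed

lemma submodule_abelian_subgroup: "submodule H R M \<Longrightarrow> abelian_subgroup H M"
  by (intro abelian_subgroupI3 additive_subgroupI M.abelian_group_axioms submodule.axioms(1))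

lemma submodule_minus:
  "submodule H R M \<Longrightarrow> x \<in> H \<Longrightarrow> y \<in> H \<Longrightarrow> x \<ominus>\<^bsub>M\<^esub> y \<in> H"
  using abelian_subgroup.axioms(1)[OF submodule_abelian_subgroup]
  by (simp add: a_minus_def additive_subgroup.a_inv_closed additive_subgroup.a_closed)

lemma submodule_left_module:
  assumes "submodule H R M"
  shows "left_module R (M\<lparr>carrier := H\<rparr>)"
proof -
  have H: "H \<subseteq> carrier M" using assms by (simp add: submodule_iff)
  have "abelian_group (M\<lparr>carrier := H\<rparr>)"
    by (rule abelian_groupI)
      (use assms H submodule_minus[OF assms, of "\<zero>\<^bsub>M\<^esub>"]
        in \<open>auto simp: submodule_iff subset_eq M.a_assoc M.a_comm M.a_lcomm M.r_neg a_minus_def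
          intro!: bexI[of _ "\<ominus>\<^bsub>M\<^esub> _"]\<close>)
  then show ?thesis
    using assms H
    by (intro left_module.intro R.ring_axioms left_module_axioms.intro)
      (auto simp: submodule_iff subset_eq smult_l_distr smult_r_distr smult_assoc smult_one)
qed

lemma submodule_restrict:
  assumes "submodule N R M"
  shows "submodule H R (M\<lparr>carrier := N\<rparr>) \<longleftrightarrow> submodule H R M \<and> H \<subseteq> N"
  using assms left_module.submodule_iff[OF submodule_left_module[OF assms], of H]
  by (auto simp: submodule_iff)

end

text \<open>\<open>quotient_module\<close> exists for unextended module records only, so the record
  type of \<open>M\<close> is fixed here.\<close>

locale plain_left_module = left_module R M
  for R :: "('r, 's) ring_scheme" (structure) and M :: "('r, 'a) module" (structure)
begin

text \<open>Correspondence theorem: images and preimages under the projection \<open>?\<pi>\<close>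
  match the submodules of the quotient with those containing \<open>N\<close>.\<close>

lemma simple_quotient_iff_carrier:
  assumes N: "submodule N R M"
  shows "simple_module R (quotient_module M N) \<longleftrightarrow>
    N \<noteq> carrier M \<and> (\<forall>H. submodule H R M \<and> N \<subseteq> H \<longrightarrow> H = N \<or> H = carrier M)"
proof -
  interpret N: abelian_subgroup N M by (rule submodule_abelian_subgroup[OF N])
  let ?Q = "quotient_module M N"
  let ?\<pi> = "\<lambda>x. N +>\<^bsub>M\<^esub> x"
  have Nc: "N \<subseteq> carrier M" by (rule N.a_subset)
  have car: "carrier ?Q = ?\<pi> ` carrier M"
    by (auto simp: quotient_module_def A_RCOSETS_def')
  have zero: "\<zero>\<^bsub>?Q\<^esub> = ?\<pi> \<zero>\<^bsub>M\<^esub>" using Nc by (simp add: quotient_module_def)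
  have add: "?\<pi> x \<oplus>\<^bsub>?Q\<^esub> ?\<pi> y = ?\<pi> (x \<oplus>\<^bsub>M\<^esub> y)" if "x \<in> carrier M" "y \<in> carrier M" for x y
    using N.a_rcos_sum[OF that] by (simp add: quotient_module_def)
  have eq: "?\<pi> x = ?\<pi> y \<longleftrightarrow> x \<ominus>\<^bsub>M\<^esub> y \<in> N" if "x \<in> carrier M" "y \<in> carrier M" for x y
    using N.a_rcos_module[of y x] N.a_rcos_self[of x] N.a_repr_independence'[of x y] that
    by (auto simp: a_minus_def)
  have eq0: "?\<pi> x = ?\<pi> \<zero>\<^bsub>M\<^esub> \<longleftrightarrow> x \<in> N" if "x \<in> carrier M" for x
    using eq[of x "\<zero>\<^bsub>M\<^esub>"] that M.minus_equality[of "\<zero>\<^bsub>M\<^esub>" "\<zero>\<^bsub>M\<^esub>"]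
    by (simp add: a_minus_def)
  \<comment> \<open>The action on a coset is a union over its representatives; it collapses to one
    coset because the multiples of elements of \<open>N\<close> stay in \<open>N\<close>.\<close>
  have smult: "r \<odot>\<^bsub>?Q\<^esub> ?\<pi> x = ?\<pi> (r \<odot>\<^bsub>M\<^esub> x)" if r: "r \<in> carrier R" and x: "x \<in> carrier M" for r x
  proof -
    have "?\<pi> (r \<odot>\<^bsub>M\<^esub> y) = ?\<pi> (r \<odot>\<^bsub>M\<^esub> x)" if y: "y \<in> ?\<pi> x" for y
    proof -
      obtain n where n: "n \<in> N" "y = n \<oplus>\<^bsub>M\<^esub> x" using y by (auto simp: a_r_coset_def')
      have "r \<odot>\<^bsub>M\<^esub> n \<in> N" using N n r by (simp add: submodule_iff)
      moreover have "r \<odot>\<^bsub>M\<^esub> y \<ominus>\<^bsub>M\<^esub> r \<odot>\<^bsub>M\<^esub> x = r \<odot>\<^bsub>M\<^esub> n"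
      proof -
        have "n \<in> carrier M" using n Nc by auto
        then show ?thesis
          using r x by (simp add: n smult_r_distr smult_closed a_minus_def M.a_assoc M.r_neg)
      qed
      moreover have "y \<in> carrier M" using n x Nc by auto
      ultimately show ?thesis
        using r x smult_closed by (simp add: eq)
    qed
    moreover have "x \<in> ?\<pi> x" using N.a_rcos_self[OF x] .
    ultimately have "(\<Union>y\<in>?\<pi> x. ?\<pi> (r \<odot>\<^bsub>M\<^esub> y)) = ?\<pi> (r \<odot>\<^bsub>M\<^esub> x)" by blast
    then show ?thesis by (simp add: quotient_module_def)
  qed
  have lm: "left_module R ?Q"
  proof (intro left_module.intro R.ring_axioms left_module_axioms.intro abelian_groupI)
    fix x assume "x \<in> carrier ?Q"
    then obtain y where y: "y \<in> carrier M" "x = ?\<pi> y" by (auto simp: car)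
    then show "\<exists>y\<in>carrier ?Q. y \<oplus>\<^bsub>?Q\<^esub> x = \<zero>\<^bsub>?Q\<^esub>"
      by (intro bexI[of _ "?\<pi> (\<ominus>\<^bsub>M\<^esub> y)"]) (auto simp: add zero M.l_neg car)
  qed (auto simp: car zero add smult smult_closed smult_l_distr smult_r_distr smult_assoc smult_one
      M.a_assoc M.a_comm M.a_lcomm)
  interpret Q: left_module R ?Q by (rule lm)
  have triv: "carrier ?Q \<noteq> {\<zero>\<^bsub>?Q\<^esub>} \<longleftrightarrow> N \<noteq> carrier M"
  proof -
    have img: "f ` A = {f z} \<longleftrightarrow> (\<forall>x\<in>A. f x = f z)" if "z \<in> A" for f :: "'a \<Rightarrow> 'a set" and A z
      using that by auto
    have "carrier ?Q = {\<zero>\<^bsub>?Q\<^esub>} \<longleftrightarrow> (\<forall>x\<in>carrier M. x \<in> N)"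
      unfolding car zero by (subst img) (simp_all add: eq0)
    then show ?thesis using Nc by auto
  qed
  have "(\<forall>H. submodule H R ?Q \<longrightarrow> H = {\<zero>\<^bsub>?Q\<^esub>} \<or> H = carrier ?Q) \<longleftrightarrow>
    (\<forall>H. submodule H R M \<and> N \<subseteq> H \<longrightarrow> H = N \<or> H = carrier M)" (is "?L \<longleftrightarrow> ?R")
  proof
    assume L: ?L
    show ?R
    proof (intro allI impI)
      fix H assume H: "submodule H R M \<and> N \<subseteq> H"
      then have Hc: "H \<subseteq> carrier M" by (simp add: submodule_iff)
      have "\<zero>\<^bsub>?Q\<^esub> \<in> ?\<pi> ` H"
        unfolding zero using H by (intro imageI) (simp add: submodule_iff)
      then have "submodule (?\<pi> ` H) R ?Q"
        using H Hc
        by (auto simp: Q.submodule_iff submodule_iff car add smult subset_eq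
            del: image_eqI intro!: imageI)
      then consider "?\<pi> ` H = {\<zero>\<^bsub>?Q\<^esub>}" | "?\<pi> ` H = carrier ?Q" using L by blast
      then show "H = N \<or> H = carrier M"
      proof cases
        case 1
        have "x \<in> N" if "x \<in> H" for x
        proof -
          have "?\<pi> x = ?\<pi> \<zero>\<^bsub>M\<^esub>" using that 1 zero by blast
          then show ?thesis using eq0[of x] that Hc by blast
        qed
        then show ?thesis using H by auto
      next
        case 2
        have "x \<in> H" if x: "x \<in> carrier M" for x
        proof -
          have "?\<pi> x \<in> ?\<pi> ` H" using 2 x unfolding car by simp
          then obtain y where y: "y \<in> H" "?\<pi> x = ?\<pi> y" by blast
          then have "x \<ominus>\<^bsub>M\<^esub> y \<in> H" using eq[of x y] x Hc H by auto
          moreover have "x = (x \<ominus>\<^bsub>M\<^esub> y) \<oplus>\<^bsub>M\<^esub> y"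
            using x y Hc by (auto simp: a_minus_def M.a_assoc M.l_neg)
          ultimately show ?thesis using y(1) H by (metis submodule_iff)
        qed
        then show ?thesis using Hc by auto
      qed
    qed
  next
    assume R: ?R
    show ?L
    proof (intro allI impI)
      fix K assume K: "submodule K R ?Q"
      have Kc: "K \<subseteq> ?\<pi> ` carrier M" and K0: "?\<pi> \<zero>\<^bsub>M\<^esub> \<in> K"
        using K unfolding Q.submodule_iff car zero by blast+
      let ?H = "{x \<in> carrier M. ?\<pi> x \<in> K}"
      have "submodule ?H R M"
        using K by (auto simp: Q.submodule_iff submodule_iff zero smult_closed
            simp flip: add smult)
      moreover have "N \<subseteq> ?H"
      proof
        fix x assume x: "x \<in> N"
        then have "?\<pi> x = ?\<pi> \<zero>\<^bsub>M\<^esub>" using eq0[of x] Nc by blast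
        then show "x \<in> ?H" using K0 x Nc by (simp add: subset_eq)
      qed
      ultimately consider "?H = N" | "?H = carrier M" using R by blast
      then show "K = {\<zero>\<^bsub>?Q\<^esub>} \<or> K = carrier ?Q"
      proof cases
        case 1
        have "k = \<zero>\<^bsub>?Q\<^esub>" if k: "k \<in> K" for k
        proof -
          obtain x where x: "x \<in> carrier M" "k = ?\<pi> x"
            using k Kc by blast
          then have "x \<in> N" using 1 k by blast
          then show ?thesis using eq0[of x] x zero by simp
        qed
        moreover have "\<zero>\<^bsub>?Q\<^esub> \<in> K" using K0 zero by simp
        ultimately show ?thesis by blast
      next
        case 2
        then show ?thesis using Kc unfolding car by blast
      qed
    qed
  qed
  with triv lm show ?thesis by (simp add: simple_module_def)
qed

lemma simple_quotient_iff:
  assumes "submodule N R M" "submodule N' R M" "N \<subseteq> N'"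
  shows "simple_module R (quotient_module (M\<lparr>carrier := N'\<rparr>) N) \<longleftrightarrow>
    N \<noteq> N' \<and> (\<forall>H. submodule H R M \<and> N \<subseteq> H \<and> H \<subseteq> N' \<longrightarrow> H = N \<or> H = N')"
  using plain_left_module.simple_quotient_iff_carrier[OF plain_left_module.intro[OF submodule_left_module[OF assms(2)]], of N] assms
  by (auto simp: submodule_restrict)

lemma composition_series_iff:
  "composition_series R M r N \<longleftrightarrow>
    N 0 = {\<zero>\<^bsub>M\<^esub>} \<and> N r = carrier M \<and> (\<forall>i\<le>r. submodule (N i) R M) \<and>
    (\<forall>i<r. N i \<subset> N (Suc i) \<and>
      (\<forall>H. submodule H R M \<and> N i \<subseteq> H \<and> H \<subseteq> N (Suc i) \<longrightarrow> H = N i \<or> H = N (Suc i)))"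
proof -
  have "simple_module R (quotient_module (M\<lparr>carrier := N (Suc i)\<rparr>) (N i)) \<longleftrightarrow>
      (\<forall>H. submodule H R M \<and> N i \<subseteq> H \<and> H \<subseteq> N (Suc i) \<longrightarrow> H = N i \<or> H = N (Suc i))"
    if "\<forall>i\<le>r. submodule (N i) R M" "i < r" "N i \<subset> N (Suc i)" for i
    using simple_quotient_iff[of "N i" "N (Suc i)"] that by auto
  then show ?thesis
    unfolding composition_series_def
    by (intro conj_cong refl) (simp cong: conj_cong)
qed

text \<open>The part of Jordan-Hoelder that is used. A submodule is measured by the set
  \<open>A H\<close> of indices of the composition factors that it meets, and a strictly larger
  submodule meets strictly more of them.\<close>

lemma chain_length_le:
  assumes N: "composition_series R M r N"
    and P: "\<And>i. i \<le> s \<Longrightarrow> submodule (P i) R M" "\<And>i. i < s \<Longrightarrow> P i \<subset> P (Suc i)"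
  shows "s \<le> r"
proof -
  define A where "A H = {i. i < r \<and> \<not> H \<inter> N (Suc i) \<subseteq> N i}" for H
  have fin: "finite (A H)" for H by (auto simp: A_def)
  note Ns = N[unfolded composition_series_iff]
  have mono: "A H \<subset> A K" if sub: "submodule H R M" "submodule K R M" and HK: "H \<subset> K" for H K
  proof -
    have "A H \<subseteq> A K" using HK by (auto simp: A_def)
    moreover have "A H \<noteq> A K"
    proof
      assume eq: "A H = A K"
      have "K \<inter> N i \<subseteq> H" if "i \<le> r" for i
        using that
      proof (induction i)
        case 0
        then show ?case using Ns sub(1) by (auto simp: submodule_iff)
      next
        case (Suc i)
        show ?case
        proof (cases "i \<in> A K")
          case False
          then show ?thesis using Suc by (auto simp: A_def)
        next
          case True
          let ?N = "N i" and ?N' = "N (Suc i)"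
          have i: "i < r" using Suc by simp
          have sN: "submodule ?N R M" "submodule ?N' R M" "?N \<subset> ?N'" using Ns i by auto
          \<comment> \<open>Both \<open>H\<close> and \<open>K\<close> meet this factor. By
            simplicity \<open>H \<inter> ?N'\<close> and \<open>?N\<close> together span
            \<open>?N'\<close>, so an element of \<open>K \<inter> ?N'\<close> differs from one of
            \<open>H\<close> by an element of \<open>K \<inter> ?N\<close>, which lies in
            \<open>H\<close> by induction.\<close>
          let ?B = "{x \<oplus>\<^bsub>M\<^esub> y | x y. x \<in> H \<inter> ?N' \<and> y \<in> ?N}"
          have c: "H \<subseteq> carrier M" "?N \<subseteq> carrier M" "?N' \<subseteq> carrier M"
            using sub(1) sN by (auto simp: submodule_iff)
          have B: "submodule ?B R M"
            unfolding submodule_iff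
          proof (intro conjI ballI)
            show "?B \<subseteq> carrier M" using c by auto
            have "\<zero>\<^bsub>M\<^esub> \<in> H \<inter> ?N'" "\<zero>\<^bsub>M\<^esub> \<in> ?N" "\<zero>\<^bsub>M\<^esub> = \<zero>\<^bsub>M\<^esub> \<oplus>\<^bsub>M\<^esub> \<zero>\<^bsub>M\<^esub>"
              using sub(1) sN by (auto simp: submodule_iff)
            then show "\<zero>\<^bsub>M\<^esub> \<in> ?B" by blast
          next
            fix u v assume "u \<in> ?B" "v \<in> ?B"
            then obtain x y x' y' where *: "u = x \<oplus>\<^bsub>M\<^esub> y" "v = x' \<oplus>\<^bsub>M\<^esub> y'"
              "x \<in> H \<inter> ?N'" "y \<in> ?N" "x' \<in> H \<inter> ?N'" "y' \<in> ?N" by blast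
            moreover have "u \<oplus>\<^bsub>M\<^esub> v = (x \<oplus>\<^bsub>M\<^esub> x') \<oplus>\<^bsub>M\<^esub> (y \<oplus>\<^bsub>M\<^esub> y')"
              using * c by (auto simp: subset_eq M.a_ac)
            moreover have "x \<oplus>\<^bsub>M\<^esub> x' \<in> H \<inter> ?N'" "y \<oplus>\<^bsub>M\<^esub> y' \<in> ?N"
              using * sub(1) sN by (auto simp: submodule_iff)
            ultimately show "u \<oplus>\<^bsub>M\<^esub> v \<in> ?B" by blast
          next
            fix a u assume a: "a \<in> carrier R" "u \<in> ?B"
            then obtain x y where *: "u = x \<oplus>\<^bsub>M\<^esub> y" "x \<in> H \<inter> ?N'" "y \<in> ?N" by blast
            moreover have "a \<odot>\<^bsub>M\<^esub> u = (a \<odot>\<^bsub>M\<^esub> x) \<oplus>\<^bsub>M\<^esub> (a \<odot>\<^bsub>M\<^esub> y)"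
              using * c a by (auto simp: subset_eq smult_r_distr)
            moreover have "a \<odot>\<^bsub>M\<^esub> x \<in> H \<inter> ?N'" "a \<odot>\<^bsub>M\<^esub> y \<in> ?N"
              using * sub(1) sN a by (auto simp: submodule_iff)
            ultimately show "a \<odot>\<^bsub>M\<^esub> u \<in> ?B" by blast
          qed
          have zH: "\<zero>\<^bsub>M\<^esub> \<in> H \<inter> ?N'" "\<zero>\<^bsub>M\<^esub> \<in> ?N"
            using sub(1) sN by (auto simp: submodule_iff)
          have "?N \<subseteq> ?B"
          proof
            fix y assume "y \<in> ?N"
            then have "y = \<zero>\<^bsub>M\<^esub> \<oplus>\<^bsub>M\<^esub> y" using c by auto
            then show "y \<in> ?B" using zH \<open>y \<in> ?N\<close> by blast
          qed
          moreover have "?B \<subseteq> ?N'" using sN by (auto simp: submodule_iff)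
          moreover have "?B \<noteq> ?N"
          proof -
            obtain x where x: "x \<in> H \<inter> ?N'" "x \<notin> ?N" using True eq by (auto simp: A_def)
            then have "x = x \<oplus>\<^bsub>M\<^esub> \<zero>\<^bsub>M\<^esub>" using c by auto
            then have "x \<in> ?B" using x(1) zH by blast
            with x(2) show ?thesis by blast
          qed
          ultimately have B': "?B = ?N'" using Ns i B by blast
          show ?thesis
          proof
            fix k assume k: "k \<in> K \<inter> ?N'"
            then have "k \<in> ?B" unfolding B' by simp
            then obtain x y where xy: "k = x \<oplus>\<^bsub>M\<^esub> y" "x \<in> H \<inter> ?N'" "y \<in> ?N" by blast
            have xc: "x \<in> carrier M" "y \<in> carrier M" using xy c by auto
            have "y = k \<ominus>\<^bsub>M\<^esub> x"
              unfolding xy(1) using xc by (simp add: a_minus_def M.a_comm M.a_assoc M.r_neg1 M.r_neg2)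
            moreover have "k \<ominus>\<^bsub>M\<^esub> x \<in> K"
              using submodule_minus[OF sub(2)] k xy(2) HK by auto
            ultimately have "y \<in> K \<inter> ?N" using xy by simp
            then have "y \<in> H" using Suc by auto
            then show "k \<in> H" using xy sub(1) by (auto simp: submodule_iff)
          qed
        qed
      qed
      from this[of r] have "K \<subseteq> H" using Ns sub(2) by (auto simp: submodule_iff)
      then show False using HK by auto
    qed
    ultimately show ?thesis by blast
  qed
  have "i \<le> card (A (P i))" if "i \<le> s" for i
    using that
  proof (induction i)
    case (Suc i)
    have "card (A (P i)) < card (A (P (Suc i)))"
      using Suc P by (intro psubset_card_mono fin mono) auto
    with Suc show ?case by simp
  qed simp
  from this[of s] have "s \<le> card (A (P s))" by simp
  also have "\<dots> \<le> card {..<r}" by (rule card_mono) (auto simp: A_def)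
  finally show ?thesis by simp
qed

text \<open>The chain bound, used in both directions, gives two composition series the same length,
  so \<open>THE\<close> denotes it.\<close>

lemma module_length_eqI:
  assumes "composition_series R M r N"
  shows "module_length R M = enat r"
proof -
  have sub: "\<And>i. i \<le> s \<Longrightarrow> submodule (P i) R M" "\<And>i. i < s \<Longrightarrow> P i \<subset> P (Suc i)"
    if "composition_series R M s P" for s P
    using that unfolding composition_series_def by blast+
  have unique: "s = r" if P: "composition_series R M s P" for s P
  proof (rule antisym)
    show "s \<le> r" by (rule chain_length_le[OF assms, of s P]) (erule sub(1)[OF P], erule sub(2)[OF P])
    show "r \<le> s" by (rule chain_length_le[OF P, of r N]) (erule sub(1)[OF assms], erule sub(2)[OF assms])
  qed
  then have "(THE r. \<exists>N. composition_series R M r N) = r"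
    using assms unique by (intro the_equality exI) blast+
  moreover have "\<exists>r N. composition_series R M r N" using assms by blast
  ultimately show ?thesis unfolding module_length_def by simp
qed

end

section \<open>Graded modules over the Weyl algebra\<close>

text \<open>Four operators with the Weyl relations replace the cosets of the free algebra. This also
  lets two exponent vectors act on the same space of rational functions.\<close>

locale weyl_space = vector_space scale
  for scale :: "complex \<Rightarrow> 'v::ab_group_add \<Rightarrow> 'v" (infixr "*s" 75) +
  fixes X D :: "coord \<Rightarrow> 'v \<Rightarrow> 'v"
  assumes X_add: "X i (f + g) = X i f + X i g" and X_scale: "X i (c *s f) = c *s X i f"
    and D_add: "D i (f + g) = D i f + D i g" and D_scale: "D i (c *s f) = c *s D i f"
    and X_X: "X i (X j f) = X j (X i f)" and D_D: "D i (D j f) = D j (D i f)"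
    and D_X: "D i (X j f) = X j (D i f) + (if i = j then f else 0)"
begin

lemma X_0: "X i 0 = 0" using X_scale[of i 0 0] by simp
lemma D_0: "D i 0 = 0" using D_scale[of i 0 0] by simp
lemma X_minus: "X i (- f) = - X i f" using X_scale[of i "-1" f] by simp
lemma D_minus: "D i (- f) = - D i f" using D_scale[of i "-1" f] by simp
lemma X_diff: "X i (f - g) = X i f - X i g" using X_add[of i f "- g"] by (simp add: X_minus)
lemma D_diff: "D i (f - g) = D i f - D i g" using D_add[of i f "- g"] by (simp add: D_minus)

definition stable :: "'v set \<Rightarrow> bool" where
  "stable H \<longleftrightarrow> subspace H \<and> (\<forall>i. \<forall>f\<in>H. X i f \<in> H \<and> D i f \<in> H)"

text \<open>The covering relation in the lattice of stable subspaces; its relational power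
  \<open>cov ^^ r\<close> from \<open>{0}\<close> to the whole module encodes a composition series
  of length \<open>r\<close>.\<close>

definition cov :: "'v set \<Rightarrow> 'v set \<Rightarrow> bool" where
  "cov A B \<longleftrightarrow> stable A \<and> stable B \<and> A \<subset> B \<and>
    (\<forall>H. stable H \<and> A \<subseteq> H \<and> H \<subseteq> B \<longrightarrow> H = A \<or> H = B)"

lemma stable_subspace: "stable H \<Longrightarrow> subspace H"
  and stable_X: "stable H \<Longrightarrow> f \<in> H \<Longrightarrow> X i f \<in> H"
  and stable_D: "stable H \<Longrightarrow> f \<in> H \<Longrightarrow> D i f \<in> H"
  by (auto simp: stable_def)

lemma stable_zero: "stable {0}"
  by (auto simp: stable_def X_0 D_0)

lemma stable_span:
  assumes "\<And>i f. f \<in> S \<Longrightarrow> X i f \<in> span S" "\<And>i f. f \<in> S \<Longrightarrow> D i f \<in> span S"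
  shows "stable (span S)"
proof -
  have "X i f \<in> span S \<and> D i f \<in> span S" if "f \<in> span S" for i f
    using that
  proof (induction rule: span_induct_alt)
    case (step c x y)
    then show ?case
      using assms by (auto simp: X_add D_add X_scale D_scale intro!: span_add span_scale)
  qed (auto simp: X_0 D_0 span_zero)
  then show ?thesis by (auto simp: stable_def)
qed

section \<open>The grading by eigenvalues of the Euler operator\<close>

definition eul :: "'v \<Rightarrow> 'v" where
  "eul f = X C1 (D C1 f) + X C2 (D C2 f)"

definition eig :: "complex \<Rightarrow> 'v set" where
  "eig c = {f. eul f = c *s f}"

lemma eul_add: "eul (f + g) = eul f + eul g"
  by (simp add: eul_def X_add D_add algebra_simps)

lemma eul_scale: "eul (c *s f) = c *s eul f"
  by (simp add: eul_def X_scale D_scale scale_right_distrib)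

lemma eul_0: "eul 0 = 0"
  by (simp add: eul_def X_0 D_0)

lemma eul_sum: "eul (sum a F) = (\<Sum>c\<in>F. eul (a c))"
  by (induction F rule: infinite_finite_induct) (auto simp: eul_add eul_0)

lemma subspace_eig: "subspace (eig c)"
  by (auto simp: subspace_def eig_def eul_add eul_scale eul_0 scale_right_distrib
      mult.commute)

lemma eul_X: "eul (X i f) = X i (eul f) + X i f"
  by (cases i) (auto simp: eul_def D_X X_add X_X[of C2 C1])

lemma eul_D: "eul (D i f) = D i (eul f) - D i f"
  by (cases i) (auto simp: eul_def D_X D_add D_D[of C2 C1])

lemma D_X_sum: "D C1 (X C1 f) + D C2 (X C2 f) = eul f + 2 *s f"
proof -
  have "2 *s f = f + f" using scale_left_distrib[of 1 1 f] by simp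
  then show ?thesis by (simp add: eul_def D_X)
qed

lemma eig_X: "f \<in> eig c \<Longrightarrow> X i f \<in> eig (c + 1)"
  by (simp add: eig_def eul_X X_scale scale_left_distrib)

lemma eig_D: "f \<in> eig c \<Longrightarrow> D i f \<in> eig (c - 1)"
  by (simp add: eig_def eul_D D_scale scale_left_diff_distrib)

lemma stable_eul: "stable H \<Longrightarrow> f \<in> H \<Longrightarrow> eul f \<in> H"
  by (auto simp: eul_def intro!: subspace_add stable_subspace stable_X stable_D)

text \<open>The operator \<open>eul\<close> minus \<open>e\<close> kills the component of degree
  \<open>e\<close> and multiplies the others by the nonzero numbers \<open>c - e\<close>, which
  leaves one component fewer.\<close>

lemma eig_split:
  assumes "stable H" "finite F" "\<And>c. c \<in> F \<Longrightarrow> a c \<in> eig c" "(\<Sum>c\<in>F. a c) \<in> H" "c \<in> F"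
  shows "a c \<in> H"
  using assms(2-5)
proof (induction F arbitrary: a c)
  case (insert e F)
  note sub = stable_subspace[OF assms(1)]
  let ?f = "\<Sum>c\<in>insert e F. a c"
  have "eul ?f = (\<Sum>c\<in>insert e F. c *s a c)"
    unfolding eul_sum by (rule sum.cong) (use insert.prems(1) in \<open>auto simp: eig_def\<close>)
  then have "eul ?f - e *s ?f = (\<Sum>c\<in>insert e F. (c - e) *s a c)"
    by (simp only: scale_sum_right sum_subtractf[symmetric] scale_left_diff_distrib)
  then have "eul ?f - e *s ?f = (\<Sum>c\<in>F. (c - e) *s a c)"
    using insert.hyps by simp
  moreover have "eul ?f - e *s ?f \<in> H"
    by (intro subspace_diff subspace_scale sub stable_eul[OF assms(1)] insert.prems(2))
  ultimately have "(\<Sum>c\<in>F. (c - e) *s a c) \<in> H" by (simp only:)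
  moreover have "(c - e) *s a c \<in> eig c" if "c \<in> F" for c
    using insert.prems(1) that by (intro subspace_scale subspace_eig) auto
  ultimately have *: "(d - e) *s a d \<in> H" if "d \<in> F" for d
    using insert.IH[of "\<lambda>c. (c - e) *s a c" d] that by blast
  have F: "a d \<in> H" if "d \<in> F" for d
    using subspace_scale[OF sub *[OF that], of "1 / (d - e)"] that insert.hyps
    by (cases "d = e") auto
  then have "(\<Sum>c\<in>F. a c) \<in> H" by (intro subspace_sum sub)
  then have "a e \<in> H"
    using subspace_diff[OF sub insert.prems(2), of "sum a F"] insert.hyps by simp
  with F insert.prems show ?case by auto
qed simp

lemma span_family:
  assumes "\<And>c. subspace (A c)" "f \<in> span (\<Union>c. A c)"
  obtains F a where "finite F" "\<And>c. c \<in> F \<Longrightarrow> a c \<in> A c" "f = (\<Sum>c\<in>F. a c)"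
proof -
  have "\<exists>F a. finite F \<and> (\<forall>c. a c \<in> A c) \<and> f = (\<Sum>c\<in>F. a c)"
    using assms(2)
  proof (induction rule: span_induct_alt)
    case base
    show ?case using assms(1) by (intro exI[of _ "{}"] exI[of _ "\<lambda>_. 0"]) (auto simp: subspace_0)
  next
    case (step k x y)
    then obtain F a c where *: "finite F" "\<forall>c. a c \<in> A c" "y = (\<Sum>c\<in>F. a c)" "x \<in> A c" by auto
    let ?a = "\<lambda>d. (if d \<in> F then a d else 0) + (if d = c then k *s x else 0)"
    have s: "(\<Sum>d\<in>insert c F. ?a d) = k *s x + y"
    proof -
      have "(\<Sum>d\<in>insert c F. if d \<in> F then a d else 0) = sum a F"
        by (rule sum.mono_neutral_cong_right) (use *(1) in auto)
      moreover have "(\<Sum>d\<in>insert c F. if d = c then k *s x else 0) = k *s x"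
        using *(1) by (subst sum.delta) auto
      ultimately show ?thesis unfolding sum.distrib by (simp add: *(3))
    qed
    have t: "\<forall>d. ?a d \<in> A d"
      using * assms(1) by (auto intro!: subspace_add subspace_scale subspace_0)
    show ?case
      by (rule exI[of _ "insert c F"], rule exI[of _ ?a])
        (use s t *(1) in \<open>simp only: finite_insert simp_thms\<close>)
  qed
  then show ?thesis using that by blast
qed

text \<open>Uniqueness of the decomposition into degrees: the difference of two decompositions of
  \<open>f\<close> sums to 0, and \<open>eig_split\<close> for the stable space \<open>{0}\<close>
  makes each of its components vanish.\<close>

lemma span_family_eig:
  assumes "\<And>c. subspace (A c)" "\<And>c. A c \<subseteq> eig c" "f \<in> span (\<Union>c. A c)" "f \<in> eig d"
  shows "f \<in> A d"
proof -
  obtain F a where *: "finite F" "\<And>c. c \<in> F \<Longrightarrow> a c \<in> A c" "f = (\<Sum>c\<in>F. a c)"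
    using span_family[OF assms(1,3)] by metis
  let ?b = "\<lambda>c. (if c \<in> F then a c else 0) - (if c = d then f else 0)"
  have "(\<Sum>c\<in>insert d F. ?b c) = 0"
  proof -
    have "(\<Sum>c\<in>insert d F. if c \<in> F then a c else 0) = sum a F"
      by (rule sum.mono_neutral_cong_right) (use *(1) in auto)
    moreover have "(\<Sum>c\<in>insert d F. if c = d then f else 0) = f"
      using *(1) by (subst sum.delta) auto
    ultimately show ?thesis unfolding sum_subtractf by (simp add: *(3))
  qed
  moreover have "?b c \<in> eig c" for c
    using * assms(2,4) by (auto intro!: subspace_diff subspace_neg subspace_eig subspace_0)
  ultimately have "?b d \<in> {0}"
    using eig_split[OF stable_zero, of "insert d F" ?b d] *(1) by simp
  then have eq: "f = (if d \<in> F then a d else 0)" by simp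
  show ?thesis by (subst eq) (use *(2) assms(1) in \<open>simp add: subspace_0\<close>)
qed

definition graded :: "'v set \<Rightarrow> bool" where
  "graded A \<longleftrightarrow> A \<subseteq> span (\<Union>c. A \<inter> eig c)"

lemma graded_component:
  assumes "graded A" "subspace A" "stable H" "f \<in> H" "f \<in> A" "f \<notin> B" "subspace B"
  obtains c g where "g \<in> H" "g \<in> A" "g \<in> eig c" "g \<notin> B"
proof -
  obtain F a where *: "finite F" "\<And>c. c \<in> F \<Longrightarrow> a c \<in> A \<inter> eig c" "f = (\<Sum>c\<in>F. a c)"
    using span_family[of "\<lambda>c. A \<inter> eig c" f] assms(1,2,5)
    by (auto simp: graded_def subspace_inter subspace_eig)
  have H: "a c \<in> H" if "c \<in> F" for c
    using eig_split[OF assms(3) *(1), of a c] * that assms(4) by auto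
  obtain c where "c \<in> F" "a c \<notin> B"
    using *(3) assms(6) subspace_sum[OF assms(7), of F a] by blast
  then show ?thesis using that[of "a c" c] * H by auto
qed

section \<open>Monomials in the variables, and the degrees of modules at the origin\<close>

definition mon :: "nat \<Rightarrow> nat \<Rightarrow> 'v \<Rightarrow> 'v" where
  "mon a b f = (X C1 ^^ a) ((X C2 ^^ b) f)"

lemma X_pow: "X i ((X j ^^ n) f) = (X j ^^ n) (X i f)"
  by (induction n) (auto simp: X_X[of i j])

lemma mon_X1: "mon a b (X C1 f) = mon (Suc a) b f"
  and mon_X2: "mon a b (X C2 f) = mon a (Suc b) f"
  by (simp_all add: mon_def X_pow)

lemma pow_add: "(X i ^^ n) (f + g) = (X i ^^ n) f + (X i ^^ n) g"
  by (induction n) (auto simp: X_add)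

lemma pow_scale: "(X i ^^ n) (c *s f) = c *s (X i ^^ n) f"
  by (induction n) (auto simp: X_scale)

lemma mon_add: "mon a b (f + g) = mon a b f + mon a b g"
  by (simp add: mon_def pow_add)

lemma mon_scale: "mon a b (c *s f) = c *s mon a b f"
  by (simp add: mon_def pow_scale)

lemma mon_0: "mon a b 0 = 0"
  using mon_scale[of a b 0 0] by simp

lemma stable_mon: "stable H \<Longrightarrow> f \<in> H \<Longrightarrow> mon a b f \<in> H"
proof -
  assume H: "stable H" "f \<in> H"
  have "(X i ^^ n) g \<in> H" if "g \<in> H" for i n g
    using that by (induction n) (auto intro: stable_X[OF H(1)])
  then show ?thesis using H by (simp add: mon_def)
qed

lemma eig_mon: "f \<in> eig c \<Longrightarrow> mon a b f \<in> eig (c + of_nat a + of_nat b)"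
proof -
  have "(X i ^^ n) g \<in> eig (c + of_nat n)" if "g \<in> eig c" for i n g c
    using that
  proof (induction n)
    case (Suc n)
    then show ?case using eig_X[of "(X i ^^ n) g" "c + of_nat n" i] by (simp add: ac_simps)
  qed simp
  from this[of "(X C2 ^^ b) f" "c + of_nat b"] this[of f c] show "f \<in> eig c \<Longrightarrow> ?thesis"
    by (simp add: mon_def ac_simps)
qed

lemma D_pow_same: "D i ((X i ^^ n) f) = (X i ^^ n) (D i f) + of_nat n *s (X i ^^ (n - 1)) f"
proof (induction n)
  case (Suc n)
  have "of_nat n *s X i ((X i ^^ (n - 1)) f) = of_nat n *s (X i ^^ n) f"
    by (cases n) auto
  with Suc show ?case by (simp add: D_X X_add X_scale scale_left_distrib)
qed simp

lemma D_pow_other: "i \<noteq> j \<Longrightarrow> D i ((X j ^^ n) f) = (X j ^^ n) (D i f)"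
  by (induction n) (auto simp: D_X)

lemma mon_D1: "mon a b (D C1 f) = D C1 (mon a b f) - of_nat a *s mon (a - 1) b f"
  by (simp add: mon_def D_pow_same D_pow_other)

lemma mon_D2: "mon a b (D C2 f) = D C2 (mon a b f) - of_nat b *s mon a (b - 1) f"
  by (simp add: mon_def D_pow_same D_pow_other pow_add pow_scale)

text \<open>The Euler degrees of the module of delta functions at the origin: delta itself has
  degree -2, and each derivative lowers the degree by one.\<close>

definition bad :: "complex set" where
  "bad = {c. \<exists>n. c = - 2 - of_nat n}"

lemma minus_one_notin_bad: "- 1 \<notin> bad"
proof -
  have "of_nat n \<noteq> (- 1 :: complex)" for n
    by (metis (no_types) add.commute add_eq_0_iff of_nat_Suc of_nat_eq_0_iff nat.distinct(1))
  then show ?thesis by (auto simp: bad_def algebra_simps eq_diff_eq)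
qed

lemma bad_add: "c \<notin> bad \<Longrightarrow> c + of_nat n \<notin> bad"
proof
  assume c: "c \<notin> bad" and "c + of_nat n \<in> bad"
  then obtain k where "c + of_nat n = - 2 - of_nat k" by (auto simp: bad_def)
  then have "c = - 2 - of_nat (n + k)" by (simp add: algebra_simps)
  with c show False unfolding bad_def by blast
qed

text \<open>Since \<open>\<partial>\<^sub>1x\<^sub>1 + \<partial>\<^sub>2x\<^sub>2\<close> acts on degree \<open>c\<close> as the scalar \<open>c + 2\<close>, an element that the
  variables move into a submodule already lies in it unless its degree is \<open>-2\<close>.\<close>

lemma X_in_stable:
  assumes "stable H" "f \<in> eig c" "c \<noteq> - 2" "X C1 f \<in> H" "X C2 f \<in> H"
  shows "f \<in> H"
proof -
  have "D C1 (X C1 f) + D C2 (X C2 f) \<in> H"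
    using assms by (intro subspace_add stable_subspace stable_D)
  then have "(c + 2) *s f \<in> H"
    using assms(2) by (simp add: D_X_sum eig_def scale_left_distrib)
  then have "(1 / (c + 2)) *s (c + 2) *s f \<in> H"
    by (rule subspace_scale[OF stable_subspace[OF assms(1)]])
  moreover have "c + 2 \<noteq> 0" using assms(3) by (metis add_eq_0_iff minus_minus)
  ultimately show ?thesis by simp
qed

text \<open>None of the degrees \<open>c\<close>, \<open>c + 1\<close>, ... is -2 when
  \<open>c\<close> is not bad, so \<open>X_in_stable\<close> removes the variables one by
  one.\<close>

lemma mon_in_stable:
  assumes "stable H" "f \<in> eig c" "c \<notin> bad" "\<And>a b. a + b = n \<Longrightarrow> mon a b f \<in> H"
  shows "f \<in> H"
  using assms(2-)
proof (induction n arbitrary: f c)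
  case 0
  then show ?case using "0.prems"(3)[of 0 0] by (simp add: mon_def)
next
  case (Suc n)
  have "X i f \<in> H" for i
  proof (rule Suc.IH[of _ "c + 1"])
    show "X i f \<in> eig (c + 1)" using Suc.prems by (simp add: eig_X)
    show "c + 1 \<notin> bad" using bad_add[of c 1] Suc.prems by simp
    show "mon a b (X i f) \<in> H" if "a + b = n" for a b
      using Suc.prems(3)[of "Suc a" b] Suc.prems(3)[of a "Suc b"] that
      by (cases i) (auto simp: mon_X1 mon_X2)
  qed
  moreover have "c \<noteq> - 2" using Suc.prems(2) by (auto simp: bad_def intro: exI[of _ 0])
  ultimately show ?case using X_in_stable[OF assms(1)] Suc.prems by blast
qed

text \<open>\<open>cogen M W\<close> is the largest submodule of \<open>M\<close> whose part of degree \<open>-2\<close> is contained in \<open>W\<close>.\<close>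

definition cogen_part :: "'v set \<Rightarrow> 'v set \<Rightarrow> complex \<Rightarrow> 'v set" where
  "cogen_part M W c = {f \<in> M \<inter> eig c. \<forall>a b. c + of_nat a + of_nat b = - 2 \<longrightarrow> mon a b f \<in> W}"

definition cogen :: "'v set \<Rightarrow> 'v set \<Rightarrow> 'v set" where
  "cogen M W = span (\<Union>c. cogen_part M W c)"

lemma subspace_cogen_part: "subspace M \<Longrightarrow> subspace W \<Longrightarrow> subspace (cogen_part M W c)"
  using subspace_eig[of c] by (auto simp: cogen_part_def subspace_def mon_0 mon_add mon_scale)

lemma cogen_part_good: "c \<notin> bad \<Longrightarrow> cogen_part M W c = M \<inter> eig c"
proof -
  assume c: "c \<notin> bad"
  have "c + of_nat a + of_nat b \<noteq> - 2" for a b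
    using bad_add[OF c, of "a + b"] by (auto simp: bad_def add.assoc intro: exI[of _ 0])
  then show ?thesis by (auto simp: cogen_part_def)
qed

lemma cogen_part_minus2: "cogen_part M W (- 2) = M \<inter> eig (- 2) \<inter> W"
proof -
  have "- 2 + of_nat a + of_nat b = (- 2 :: complex) \<longleftrightarrow> a = 0 \<and> b = 0" for a b
    by (simp add: add.assoc flip: of_nat_add)
  then show ?thesis by (auto simp: cogen_part_def mon_def)
qed

lemma cogen_subset: "subspace M \<Longrightarrow> cogen M W \<subseteq> M"
  unfolding cogen_def by (rule span_minimal) (auto simp: cogen_part_def)

lemma cogen_mono: "M \<subseteq> M' \<Longrightarrow> W \<subseteq> W' \<Longrightarrow> cogen M W \<subseteq> cogen M' W'"
  unfolding cogen_def cogen_part_def by (intro span_mono UN_mono order.refl) blast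

lemma cogen_eig: "subspace M \<Longrightarrow> subspace W \<Longrightarrow> f \<in> eig c \<Longrightarrow> f \<in> cogen M W \<longleftrightarrow> f \<in> cogen_part M W c"
  using span_family_eig[of "cogen_part M W" f c] span_base[of f "\<Union>c. cogen_part M W c"]
  by (auto simp: cogen_def subspace_cogen_part) (auto simp: cogen_part_def)

text \<open>For a graded \<open>M\<close> the degree -2 part modulo this space is the top de Rham
  cohomology \<open>M / (D C1 M + D C2 M)\<close>: an element of another degree \<open>c\<close> is
  \<open>1 / (c + 2)\<close> times a sum of derivatives by \<open>D_X_sum\<close>.\<close>

definition boundaries :: "'v set \<Rightarrow> 'v set" where
  "boundaries M = {D C1 f + D C2 g | f g. f \<in> M \<inter> eig (- 1) \<and> g \<in> M \<inter> eig (- 1)}"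

lemma D_boundaries: "stable M \<Longrightarrow> f \<in> M \<Longrightarrow> f \<in> eig (- 1) \<Longrightarrow> D i f \<in> boundaries M"
proof -
  assume f: "stable M" "f \<in> M" "f \<in> eig (- 1)"
  then have "0 \<in> M \<inter> eig (- 1)" by (auto intro!: subspace_0 stable_subspace subspace_eig)
  with f show ?thesis
    unfolding boundaries_def by (cases i) (force simp: D_0)+
qed

lemma subspace_boundaries: "stable M \<Longrightarrow> subspace (boundaries M)"
proof -
  assume "stable M"
  then have s: "subspace (M \<inter> eig (- 1))" by (intro subspace_inter stable_subspace subspace_eig)
  show ?thesis
  proof (rule subspaceI)
    show "0 \<in> boundaries M" using subspace_0[OF s] by (force simp: boundaries_def D_0)
    fix u v assume "u \<in> boundaries M" "v \<in> boundaries M"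
    then obtain f g f' g' where *: "f \<in> M \<inter> eig (- 1)" "g \<in> M \<inter> eig (- 1)" "f' \<in> M \<inter> eig (- 1)"
      "g' \<in> M \<inter> eig (- 1)" "u = D C1 f + D C2 g" "v = D C1 f' + D C2 g'" by (auto simp: boundaries_def)
    have "u + v = D C1 (f + f') + D C2 (g + g')" by (simp add: * D_add algebra_simps)
    then show "u + v \<in> boundaries M"
      using subspace_add[OF s *(1,3)] subspace_add[OF s *(2,4)] unfolding boundaries_def by blast
  next
    fix c u assume "u \<in> boundaries M"
    then obtain f g where *: "f \<in> M \<inter> eig (- 1)" "g \<in> M \<inter> eig (- 1)" "u = D C1 f + D C2 g"
      by (auto simp: boundaries_def)
    have "c *s u = D C1 (c *s f) + D C2 (c *s g)" by (simp add: * D_scale scale_right_distrib)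
    then show "c *s u \<in> boundaries M"
      using subspace_scale[OF s *(1)] subspace_scale[OF s *(2)] unfolding boundaries_def by blast
  qed
qed

lemma boundaries_subset: "stable M \<Longrightarrow> boundaries M \<subseteq> M \<inter> eig (- 2)"
proof -
  assume M: "stable M"
  have "D i f \<in> M \<inter> eig (- 2)" if "f \<in> M \<inter> eig (- 1)" for i f
    using that eig_D[of f "- 1" i] stable_D[OF M] by auto
  then have "D C1 f + D C2 g \<in> M \<inter> eig (- 2)" if "f \<in> M \<inter> eig (- 1)" "g \<in> M \<inter> eig (- 1)" for f g
    using that subspace_add[OF subspace_inter[OF stable_subspace[OF M] subspace_eig[of "- 2"]]] by blast
  then show ?thesis unfolding boundaries_def by blast
qed

lemma boundaries_mono: "M \<subseteq> M' \<Longrightarrow> boundaries M \<subseteq> boundaries M'"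
  unfolding boundaries_def by blast

text \<open>Commuting a monomial past \<open>D i\<close> produces the derivative of an element of
  degree -1, which is a boundary, and multiples of \<open>f\<close> by monomials of one degree less,
  which have degree -2 and lie in \<open>W\<close> by the choice of \<open>f\<close>.\<close>

lemma stable_cogen:
  assumes M: "stable M" and W: "subspace W" "boundaries M \<subseteq> W"
  shows "stable (cogen M W)"
  unfolding cogen_def
proof (rule stable_span)
  fix i f assume "f \<in> (\<Union>c. cogen_part M W c)"
  then obtain c where f: "f \<in> M" "f \<in> eig c"
    "\<And>a b. c + of_nat a + of_nat b = - 2 \<Longrightarrow> mon a b f \<in> W" by (auto simp: cogen_part_def)
  have "X i f \<in> cogen_part M W (c + 1)"
    using f(1,2) f(3)[of "Suc _" _] f(3)[of _ "Suc _"] stable_X[OF M] eig_X[of f c]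
    by (cases i) (auto simp: cogen_part_def mon_X1 mon_X2 ac_simps)
  then show "X i f \<in> span (\<Union>c. cogen_part M W c)" by (intro span_base) blast
  have "mon a b (D i f) \<in> W" if ab: "c - 1 + of_nat a + of_nat b = - 2" for a b
  proof -
    have c: "c + of_nat a + of_nat b = - 1" using ab by (simp add: algebra_simps)
    have "D i (mon a b f) \<in> W"
      using D_boundaries[OF M stable_mon[OF M f(1)], of a b i] eig_mon[OF f(2), of a b] W(2)
      by (auto simp: c)
    moreover have "of_nat a *s mon (a - 1) b f \<in> W"
    proof (cases a)
      case (Suc n)
      have "c + of_nat n + of_nat b = (c + of_nat a + of_nat b) - 1" by (simp add: Suc)
      then have "mon n b f \<in> W" unfolding c by (intro f(3)) simp
      with Suc W(1) show ?thesis by (simp add: subspace_scale del: of_nat_Suc)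
    qed (simp add: subspace_0 W(1))
    moreover have "of_nat b *s mon a (b - 1) f \<in> W"
    proof (cases b)
      case (Suc n)
      have "c + of_nat a + of_nat n = (c + of_nat a + of_nat b) - 1" by (simp add: Suc)
      then have "mon a n f \<in> W" unfolding c by (intro f(3)) simp
      with Suc W(1) show ?thesis by (simp add: subspace_scale del: of_nat_Suc)
    qed (simp add: subspace_0 W(1))
    ultimately show ?thesis
      using W(1) by (cases i) (auto simp: mon_D1 mon_D2 intro!: subspace_diff)
  qed
  then have "D i f \<in> cogen_part M W (c - 1)"
    using f(1,2) stable_D[OF M] eig_D[of f c] by (auto simp: cogen_part_def)
  then show "D i f \<in> span (\<Union>c. cogen_part M W c)" by (intro span_base) blast
qed

text \<open>Induction on \<open>n\<close> in the degree -2 - n: the variables lead from degree -2 -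
  (n + 1) to -2 - n, and \<open>X_in_stable\<close> leads back because the lower degree is not
  -2.\<close>

lemma cogen_least:
  assumes M: "stable M" and H: "stable H" "\<And>c. c \<notin> bad \<Longrightarrow> M \<inter> eig c \<subseteq> H" "W \<subseteq> H"
  shows "cogen M W \<subseteq> H"
  unfolding cogen_def
proof (rule span_minimal)
  have low: "f \<in> H" if "f \<in> cogen_part M W (- 2 - of_nat n)" for n f
    using that
  proof (induction n arbitrary: f)
    case 0
    then show ?case using assms(4) by (auto simp: cogen_part_minus2)
  next
    case (Suc n)
    have "X i f \<in> H" for i
    proof (rule Suc.IH)
      have "X i f \<in> eig (- 2 - of_nat n)"
        using eig_X[of f "- 2 - of_nat (Suc n)" i] Suc.prems by (simp add: cogen_part_def)
      moreover have "mon a b (X i f) \<in> W"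
        if "- 2 - of_nat n + of_nat a + of_nat b = (- 2 :: complex)" for a b
      proof -
        have "- 2 - of_nat (Suc n) + of_nat (Suc a) + of_nat b = (- 2 :: complex)"
          "- 2 - of_nat (Suc n) + of_nat a + of_nat (Suc b) = (- 2 :: complex)"
          using that by (simp_all add: algebra_simps)
        then show ?thesis
          using Suc.prems unfolding cogen_part_def by (cases i) (auto simp: mon_X1 mon_X2)
      qed
      ultimately show "X i f \<in> cogen_part M W (- 2 - of_nat n)"
        using Suc.prems stable_X[OF M, of f i] by (simp add: cogen_part_def)
    qed
    moreover have "- 2 - of_nat (Suc n) \<noteq> (- 2 :: complex)" by (simp del: of_nat_Suc)
    ultimately show ?case
      using X_in_stable[OF H(1), of f "- 2 - of_nat (Suc n)"] Suc.prems by (auto simp: cogen_part_def)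
  qed
  show "(\<Union>c. cogen_part M W c) \<subseteq> H"
  proof
    fix f assume "f \<in> (\<Union>c. cogen_part M W c)"
    then obtain c where "f \<in> cogen_part M W c" by blast
    then show "f \<in> H"
      using H(2) low by (cases "c \<in> bad") (auto simp: bad_def cogen_part_good)
  qed
qed (rule stable_subspace[OF H(1)])

text \<open>Degree -1 is good, so \<open>H\<close> contains the boundaries automatically. With
  \<open>cogen_part_good\<close> this identifies \<open>cogen M (boundaries M)\<close> as the
  submodule generated by the good degrees of \<open>M\<close>.\<close>

lemma cogen_boundaries_least:
  assumes M: "stable M" and H: "stable H" "\<And>c. c \<notin> bad \<Longrightarrow> M \<inter> eig c \<subseteq> H"
  shows "cogen M (boundaries M) \<subseteq> H"
proof (rule cogen_least[OF assms])
  show "boundaries M \<subseteq> H"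
    using H minus_one_notin_bad stable_D[OF H(1)] stable_subspace[OF H(1)]
    by (auto simp: boundaries_def intro!: subspace_add)
qed

lemma cogen_top: "stable M \<Longrightarrow> graded M \<Longrightarrow> cogen M (M \<inter> eig (- 2)) = M"
proof
  assume M: "stable M" "graded M"
  have "mon a b f \<in> M \<inter> eig (- 2)" if "f \<in> M \<inter> eig c" "c + of_nat a + of_nat b = - 2" for a b c f
    using that stable_mon[OF M(1), of f a b] eig_mon[of f c a b] by auto
  then have "(\<Union>c. M \<inter> eig c) \<subseteq> (\<Union>c. cogen_part M (M \<inter> eig (- 2)) c)"
    by (auto simp: cogen_part_def)
  then show "M \<subseteq> cogen M (M \<inter> eig (- 2))"
    using M(2) span_mono unfolding graded_def cogen_def by blast
qed (simp add: cogen_subset stable_subspace)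

text \<open>A homogeneous element outside \<open>cogen M W\<close> is moved by some monomial into
  degree -2 without falling into \<open>W\<close>. Since \<open>W\<close> has codimension one in
  \<open>span (insert g W)\<close>, an intermediate submodule containing such an element contains
  \<open>g\<close>.\<close>

lemma cov_cogen_insert:
  assumes M: "stable M" "graded M" and W: "subspace W" "boundaries M \<subseteq> W" "W \<subseteq> M \<inter> eig (- 2)"
    and g: "g \<in> M \<inter> eig (- 2)" "g \<notin> W"
  shows "cov (cogen M W) (cogen M (span (insert g W)))"
proof -
  let ?W = "span (insert g W)"
  have W': "W \<subseteq> ?W" using span_superset[of "insert g W"] by blast
  have W2: "?W \<subseteq> M \<inter> eig (- 2)"
    using W(3) g(1) by (intro span_minimal subspace_inter stable_subspace M subspace_eig) auto
  have minus2: "f \<in> V" if "f \<in> cogen M V" "f \<in> eig (- 2)" "subspace V" for f V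
    using cogen_eig[of M V f "- 2"] that stable_subspace[OF M(1)] by (auto simp: cogen_part_minus2)
  have st: "stable (cogen M W)" "stable (cogen M ?W)"
    using W W' by (auto intro!: stable_cogen M)
  have sub: "cogen M W \<subseteq> cogen M ?W" using W' by (intro cogen_mono) auto
  have "g \<in> cogen M ?W"
    using g(1) span_base[of g "insert g W"] cogen_eig[of M ?W g "- 2"] stable_subspace[OF M(1)]
    by (auto simp: cogen_part_minus2)
  moreover have "g \<notin> cogen M W" using minus2[of g W] g W(1) by blast
  ultimately have strict: "cogen M W \<subset> cogen M ?W" using sub by blast
  have "H = cogen M ?W" if H: "stable H" "cogen M W \<subseteq> H" "H \<subseteq> cogen M ?W" "H \<noteq> cogen M W" for H
  proof
    obtain f where f: "f \<in> H" "f \<notin> cogen M W" using H by blast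
    have HM: "H \<subseteq> M" using H(3) cogen_subset[OF stable_subspace[OF M(1)]] by blast
    obtain c h where h: "h \<in> H" "h \<in> M" "h \<in> eig c" "h \<notin> cogen M W"
      using graded_component[OF M(2) stable_subspace[OF M(1)] H(1) f(1) _ f(2)] f(1) HM
        stable_subspace[OF st(1)] by blast
    then have "h \<notin> cogen_part M W c"
      using cogen_eig[of M W h c] stable_subspace[OF M(1)] W(1) by blast
    then obtain a b where ab: "c + of_nat a + of_nat b = - 2" "mon a b h \<notin> W"
      using h by (auto simp: cogen_part_def)
    let ?h = "mon a b h"
    have "?h \<in> eig (- 2)" using eig_mon[OF h(3), of a b] ab(1) by simp
    then have "?h \<in> H" "?h \<in> ?W"
      using minus2[of ?h ?W] stable_mon[OF H(1) h(1)] H(3) by auto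
    then obtain k where k: "?h - k *s g \<in> W"
      using span_eq_iff[THEN iffD2, OF W(1)] by (auto simp: span_breakdown_eq)
    have "k \<noteq> 0" using k ab(2) by auto
    have WH: "W \<subseteq> H"
    proof
      fix w assume w: "w \<in> W"
      then have "w \<in> cogen M W"
        using cogen_eig[of M W w "- 2"] stable_subspace[OF M(1)] W by (auto simp: cogen_part_minus2)
      then show "w \<in> H" using H(2) by blast
    qed
    then have "k *s g \<in> H"
      using k \<open>?h \<in> H\<close> subspace_diff[OF stable_subspace[OF H(1)], of ?h "?h - k *s g"] by auto
    then have "(1 / k) *s k *s g \<in> H" by (rule subspace_scale[OF stable_subspace[OF H(1)]])
    then have "g \<in> H" using \<open>k \<noteq> 0\<close> by simp
    then have "?W \<subseteq> H"
      using WH by (intro span_minimal stable_subspace[OF H(1)]) auto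
    moreover have "M \<inter> eig c \<subseteq> H" if "c \<notin> bad" for c
      using H(2) cogen_eig[of M W _ c] stable_subspace[OF M(1)] W(1) cogen_part_good[OF that] by blast
    ultimately show "cogen M ?W \<subseteq> H" by (intro cogen_least M H)
  qed (use H in blast)
  then show ?thesis using st strict by (auto simp: cov_def)
qed

lemma cov_chain_cogen:
  assumes M: "stable M" "graded M" and W: "subspace W" "boundaries M \<subseteq> W" "W \<subseteq> M \<inter> eig (- 2)"
    and "finite G" "G \<subseteq> M \<inter> eig (- 2)" "\<And>g. g \<in> G \<Longrightarrow> g \<notin> span (W \<union> (G - {g}))"
  shows "(cov ^^ card G) (cogen M W) (cogen M (span (W \<union> G)))"
  using assms(6-)
proof (induction G)
  case empty
  show ?case by (simp add: span_eq_iff[THEN iffD2, OF W(1)])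
next
  case (insert g G)
  let ?V = "span (W \<union> G)"
  have "h \<notin> span (W \<union> (G - {h}))" if "h \<in> G" for h
    using insert.prems(2)[of h] that span_mono[of "W \<union> (G - {h})" "W \<union> (insert g G - {h})"] by auto
  then have "(cov ^^ card G) (cogen M W) (cogen M ?V)"
    using insert.IH insert.prems by auto
  moreover have "cov (cogen M ?V) (cogen M (span (insert g ?V)))"
  proof (rule cov_cogen_insert[OF M])
    show "boundaries M \<subseteq> ?V" using W(2) span_superset[of "W \<union> G"] by blast
    show "?V \<subseteq> M \<inter> eig (- 2)"
      using W(3) insert.prems by (intro span_minimal subspace_inter stable_subspace M subspace_eig) auto
    show "g \<notin> ?V" using insert.prems(2)[of g] insert.hyps by simp
  qed (use insert.prems in auto)
  moreover have "span (insert g ?V) = span (W \<union> insert g G)"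
    by (metis Un_insert_right eq_span_insert_eq span_span span_insert)
  ultimately show ?case using insert.hyps by auto
qed

text \<open>A basis \<open>F\<close> of the intersection is extended to a basis \<open>B\<close> of
  \<open>span E\<close>; the vectors in \<open>B - F\<close> are independent modulo
  \<open>W\<close>.\<close>

lemma basis_modulo:
  assumes W: "subspace W" and E: "independent E" "finite E"
    and F: "independent F" "W \<inter> span E = span F"
  obtains G where "finite G" "card G = card E - card F" "G \<subseteq> span E"
    "\<And>g. g \<in> G \<Longrightarrow> g \<notin> span (W \<union> (G - {g}))" "span E \<subseteq> span (W \<union> G)"
proof -
  have FE: "F \<subseteq> span E" and FW: "F \<subseteq> W" using F(2) span_superset[of F] by auto
  obtain B where B: "F \<subseteq> B" "B \<subseteq> span E" "independent B" "span E \<subseteq> span B"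
    using maximal_independent_subset_extend[OF FE F(1)] by metis
  have fin: "finite B" using independent_span_bound[OF E(2) B(3,2)] by simp
  have "card B = card E"
    using basis_card_eq_dim[OF B(2,4,3)] dim_span_eq_card_independent[OF E(1)] by simp
  moreover have "card (B - F) = card B - card F"
    using B(1) fin by (intro card_Diff_subset) (auto intro: finite_subset)
  moreover have "g \<notin> span (W \<union> (B - F - {g}))" if g: "g \<in> B - F" for g
  proof
    assume "g \<in> span (W \<union> (B - F - {g}))"
    then obtain w y where wy: "g = w + y" "w \<in> W" "y \<in> span (B - F - {g})"
      unfolding span_Un span_eq_iff[THEN iffD2, OF W] by blast
    have "y \<in> span E"
      using wy(3) span_mono[of "B - F - {g}" "span E"] B(2) by (auto simp: span_span)
    then have "w \<in> span E"
      using wy(1) g B(2) span_diff[of g E y] by auto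
    then have "w \<in> span F" using wy(2) F(2) by blast
    then have "w \<in> span (B - {g})" using span_mono[of F "B - {g}"] B(1) g by blast
    moreover have "y \<in> span (B - {g})" using wy(3) span_mono[of "B - F - {g}" "B - {g}"] by blast
    ultimately have "g \<in> span (B - {g})" using wy(1) span_add by blast
    then show False using B(3) g by (auto simp: dependent_def)
  qed
  moreover have "span E \<subseteq> span (W \<union> (B - F))"
    using B(4) FW span_mono[of B "W \<union> (B - F)"] by blast
  ultimately show ?thesis using that[of "B - F"] fin B(2) by auto
qed

end

section \<open>Homogeneous polynomials in two variables\<close>

declare var.simps [simp del] pd.simps [simp del]

definition ev :: "complex \<times> complex \<Rightarrow> poly2 \<Rightarrow> complex" where
  "ev z p = poly (poly p [:snd z:]) (fst z)"

lemma ev_simps [simp]: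
  "ev z 0 = 0" "ev z 1 = 1" "ev z (p + q) = ev z p + ev z q" "ev z (p - q) = ev z p - ev z q"
  "ev z (p * q) = ev z p * ev z q" "ev z (p ^ n) = ev z p ^ n" "ev z (const2 c) = c"
  "ev z (var C1) = fst z" "ev z (var C2) = snd z"
  by (simp_all add: ev_def const2_def var.simps)

lemma ev_sum: "ev z (sum f A) = (\<Sum>i\<in>A. ev z (f i))"
  and ev_prod: "ev z (prod f A) = (\<Prod>i\<in>A. ev z (f i))"
  by (induction A rule: infinite_finite_induct) auto

lemma const2_simps [simp]:
  "const2 0 = 0" "const2 1 = 1"
  by (simp_all add: const2_def one_pCons)

lemma const2_eq_0_iff [simp]: "const2 c = 0 \<longleftrightarrow> c = 0"
  by (simp add: const2_def)

lemma const2_add: "const2 (a + b) = const2 a + const2 b"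
  and const2_diff: "const2 (a - b) = const2 a - const2 b"
  and const2_minus: "const2 (- a) = - const2 a"
  and const2_mult: "const2 (a * b) = const2 a * const2 b"
  by (simp_all add: const2_def)

lemma const2_of_nat: "const2 (of_nat n) = of_nat n"
  by (induction n) (auto simp: const2_add)

lemma coeff_pd_C1: "coeff (coeff (pd C1 p) j) i = of_nat (Suc i) * coeff (coeff p j) (Suc i)"
  by (simp add: coeff_map_poly coeff_pderiv pd.simps)

lemma coeff_of_nat_mult: "coeff (of_nat n * p) i = of_nat n * coeff p i"
  by (induction n) (auto simp: algebra_simps)

lemma coeff_pd_C2: "coeff (coeff (pd C2 p) j) i = of_nat (Suc j) * coeff (coeff p (Suc j)) i"
  by (simp add: coeff_pderiv coeff_of_nat_mult pd.simps del: of_nat_Suc)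

lemma coeff_var_C1_mult: "coeff (coeff (var C1 * p) j) i = (case i of 0 \<Rightarrow> 0 | Suc i' \<Rightarrow> coeff (coeff p j) i')"
  by (simp add: coeff_pCons var.simps)

lemma coeff_var_C2_mult: "coeff (coeff (var C2 * p) j) i = (case j of 0 \<Rightarrow> 0 | Suc j' \<Rightarrow> coeff (coeff p j') i)"
  by (auto simp: coeff_pCons var.simps split: nat.splits)

lemma coeff_const2_mult: "coeff (coeff (const2 c * p) j) i = c * coeff (coeff p j) i"
  by (simp add: const2_def)

text \<open>Euler's identity serves as definition, with a complex degree, so that it can be compared
  directly with eigenvalues of \<open>eul\<close>. The space is zero unless the degree is a natural
  number.\<close>

definition hom :: "complex \<Rightarrow> poly2 set" where
  "hom c = {p. var C1 * pd C1 p + var C2 * pd C2 p = const2 c * p}"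

lemma hom_iff: "p \<in> hom c \<longleftrightarrow> (\<forall>i j. coeff (coeff p j) i \<noteq> 0 \<longrightarrow> of_nat (i + j) = c)"
proof -
  have "coeff (coeff (var C1 * pd C1 p + var C2 * pd C2 p) j) i = of_nat (i + j) * coeff (coeff p j) i" for i j
    unfolding coeff_add coeff_var_C1_mult coeff_var_C2_mult
    by (cases i; cases j) (auto simp: coeff_pd_C1 coeff_pd_C2 algebra_simps)
  then show ?thesis
    unfolding hom_def poly_eq_iff[where 'a = complex] poly_eq_iff[where 'a = "complex poly"]
    by (auto simp: coeff_const2_mult)
qed

lemma hom_mult: "p \<in> hom c \<Longrightarrow> q \<in> hom d \<Longrightarrow> p * q \<in> hom (c + d)"
proof -
  assume "p \<in> hom c" "q \<in> hom d"
  then have "(var C1 * pd C1 p + var C2 * pd C2 p) * q + p * (var C1 * pd C1 q + var C2 * pd C2 q)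
      = const2 c * p * q + p * (const2 d * q)" by (simp add: hom_def)
  then show ?thesis
    by (simp add: hom_def pd_mult const2_add algebra_simps)
qed

lemma hom_var: "var i \<in> hom 1"
  by (cases i) (simp_all add: hom_def pd_var)

lemma hom_const: "const2 c \<in> hom 0"
  by (simp add: hom_def pd_const)

lemma hom_one: "1 \<in> hom 0"
  using hom_const[of 1] by simp

lemma hom_add: "p \<in> hom c \<Longrightarrow> q \<in> hom c \<Longrightarrow> p + q \<in> hom c"
  by (simp add: hom_def pd_add algebra_simps)

lemma hom_power: "p \<in> hom c \<Longrightarrow> p ^ n \<in> hom (of_nat n * c)"
  by (induction n) (auto simp: hom_one hom_mult algebra_simps dest: hom_mult)

lemma hom_prod: "(\<And>i. i \<in> A \<Longrightarrow> f i \<in> hom (d i)) \<Longrightarrow> prod f A \<in> hom (sum d A)"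
  by (induction A rule: infinite_finite_induct) (auto simp: hom_one intro: hom_mult)

lemma hom_linear_form: "linear_form p \<Longrightarrow> p \<in> hom 1"
  unfolding linear_form_def
  using hom_mult[OF hom_const hom_var] by (auto intro!: hom_add)

lemma hom_nonzero: "p \<in> hom c \<Longrightarrow> p \<noteq> 0 \<Longrightarrow> \<exists>e. c = of_nat e"
  unfolding hom_iff by (metis leading_coeff_0_iff)

lemma hom_0_const: "p \<in> hom 0 \<Longrightarrow> \<exists>c. p = const2 c"
proof
  assume p: "p \<in> hom 0"
  show "p = const2 (coeff (coeff p 0) 0)"
  proof (intro poly_eqI)
    fix i j
    show "coeff (coeff p j) i = coeff (coeff (const2 (coeff (coeff p 0) 0)) j) i"
    proof (cases "i + j = 0")
      case False
      then have "coeff (coeff p j) i = 0" using p unfolding hom_iff by (metis of_nat_eq_0_iff)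
      with False show ?thesis by (cases i; cases j) (simp_all add: const2_def)
    qed (simp add: const2_def)
  qed
qed

lemma hom_Suc_split:
  assumes "p \<in> hom (of_nat (Suc e))"
  obtains p1 p2 where "p1 \<in> hom (of_nat e)" "p2 \<in> hom (of_nat e)" "p = var C1 * p1 + var C2 * p2"
proof -
  have h: "i + j = Suc e" if "coeff (coeff p j) i \<noteq> 0" for i j
    using assms that unfolding hom_iff by (metis of_nat_eq_iff)
  obtain a q where p: "p = pCons a q" by (cases p)
  obtain b r where a: "a = pCons b r" by (cases a)
  have "b = 0" using h[of 0 0] by (auto simp: p a)
  then have eq: "p = var C1 * [:r:] + var C2 * q" by (simp add: p a var.simps)
  have "[:r:] \<in> hom (of_nat e)"
    using h[of 0 "Suc _"] by (auto simp: hom_iff p a coeff_pCons split: nat.splits)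
  moreover have "q \<in> hom (of_nat e)"
    using h[of "Suc _" _] by (auto simp: hom_iff p)
  ultimately show ?thesis using that eq by blast
qed

text \<open>\<open>irr_pow n\<close> is the \<open>n\<close>-th power of the irrelevant ideal \<open>(x\<^sub>1, x\<^sub>2)\<close>.\<close>

primrec irr_pow :: "nat \<Rightarrow> poly2 set" where
  "irr_pow 0 = UNIV"
| "irr_pow (Suc n) = {var C1 * p + var C2 * q | p q. p \<in> irr_pow n \<and> q \<in> irr_pow n}"

lemma irr_pow_add: "p \<in> irr_pow n \<Longrightarrow> q \<in> irr_pow n \<Longrightarrow> p + q \<in> irr_pow n"
proof (induction n arbitrary: p q)
  case (Suc n)
  then obtain a b c d where "p = var C1 * a + var C2 * b" "q = var C1 * c + var C2 * d"
    "a \<in> irr_pow n" "b \<in> irr_pow n" "c \<in> irr_pow n" "d \<in> irr_pow n" by auto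
  moreover from this have "p + q = var C1 * (a + c) + var C2 * (b + d)"
    by (simp add: algebra_simps)
  ultimately show ?case using Suc.IH by auto
qed simp

lemma irr_pow_mult: "p \<in> irr_pow n \<Longrightarrow> r * p \<in> irr_pow n"
proof (induction n arbitrary: p)
  case (Suc n)
  then obtain a b where "p = var C1 * a + var C2 * b" "a \<in> irr_pow n" "b \<in> irr_pow n" by auto
  moreover from this have "r * p = var C1 * (r * a) + var C2 * (r * b)"
    by (simp add: algebra_simps)
  ultimately show ?case using Suc.IH by auto
qed simp

lemma irr_pow_0: "0 \<in> irr_pow n"
  using irr_pow_mult[of _ n 0] by (induction n) force+

lemma irr_pow_var: "p \<in> irr_pow n \<Longrightarrow> var i * p \<in> irr_pow (Suc n)"
proof (cases i)
  case C1
  assume "p \<in> irr_pow n"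
  moreover have "var C1 * p = var C1 * p + var C2 * 0" by simp
  ultimately show ?thesis using irr_pow_0 unfolding C1 irr_pow.simps by blast
next
  case C2
  assume "p \<in> irr_pow n"
  moreover have "var C2 * p = var C1 * 0 + var C2 * p" by simp
  ultimately show ?thesis using irr_pow_0 unfolding C2 irr_pow.simps by blast
qed

lemma irr_pow_Suc_subset: "irr_pow (Suc n) \<subseteq> irr_pow n"
  using irr_pow_mult irr_pow_add by (auto)

lemma irr_pow_antimono: "m \<le> n \<Longrightarrow> irr_pow n \<subseteq> irr_pow m"
  by (induction n rule: dec_induct) (use irr_pow_Suc_subset in blast)+

lemma irr_pow_monom: "var C1 ^ a * var C2 ^ b \<in> irr_pow (a + b)"
proof (induction a)
  case 0
  show ?case by (induction b) (auto intro: irr_pow_var simp del: irr_pow.simps(2))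
next
  case (Suc a)
  then show ?case using irr_pow_var[of _ _ C1] by (simp add: mult.assoc del: irr_pow.simps(2))
qed

lemma irr_pow_pd: "p \<in> irr_pow (Suc n) \<Longrightarrow> pd i p \<in> irr_pow n"
proof (induction n arbitrary: p)
  case (Suc n)
  then obtain a b where p: "p = var C1 * a + var C2 * b" "a \<in> irr_pow (Suc n)" "b \<in> irr_pow (Suc n)"
    unfolding irr_pow.simps(2)[of "Suc n"] by blast
  have "pd i p = (if i = C1 then a else 0) + (if i = C2 then b else 0) + var C1 * pd i a + var C2 * pd i b"
    unfolding p(1) pd_add pd_mult pd_var by (cases i) (simp_all)
  moreover have "(if i = C1 then a else 0) \<in> irr_pow (Suc n)" "(if i = C2 then b else 0) \<in> irr_pow (Suc n)"
    using p irr_pow_0[of "Suc n"] by presburger+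
  ultimately show ?case
    using Suc.IH p(2,3) by (simp only:) (intro irr_pow_add irr_pow_var; assumption | blast)
qed simp

lemma hom_irr_pow: "p \<in> hom (of_nat e) \<Longrightarrow> p \<in> irr_pow e"
proof (induction e arbitrary: p)
  case (Suc e)
  then show ?case by (metis hom_Suc_split irr_pow_add irr_pow_var)
qed simp

lemma irr_pow_var_pred: "p \<in> irr_pow (n - 1) \<Longrightarrow> var i * p \<in> irr_pow n"
  using irr_pow_var[of p "n - 1" i] by (cases n) auto

text \<open>The hypotheses express both coordinates through \<open>u\<close> and \<open>v\<close>,
  so only the power of \<open>v\<close> survives modulo \<open>u\<close>. The bound on
  \<open>r\<close> records its order of vanishing at the origin.\<close>

lemma hom_mod_linear:
  assumes x: "var C1 = const2 a * v + u * q1" and y: "var C2 = const2 b * v + u * q2"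
    and v: "v \<in> hom 1" and "p \<in> hom (of_nat e)"
  shows "\<exists>c r. r \<in> irr_pow (e - 1) \<and> p = const2 c * v ^ e + u * r"
  using assms(4)
proof (induction e arbitrary: p)
  case 0
  then obtain c where "p = const2 c" using hom_0_const[of p] by auto
  then have "p = const2 c * v ^ 0 + u * 0" by simp
  then show ?case by fastforce
next
  case (Suc e)
  obtain p1 p2 where p: "p1 \<in> hom (of_nat e)" "p2 \<in> hom (of_nat e)" "p = var C1 * p1 + var C2 * p2"
    using hom_Suc_split[OF Suc.prems] .
  obtain c r d s where rs: "p1 = const2 c * v ^ e + u * r" "p2 = const2 d * v ^ e + u * s"
    "r \<in> irr_pow (e - 1)" "s \<in> irr_pow (e - 1)"
    using Suc.IH p by meson
  let ?t = "(q1 * const2 c + q2 * const2 d) * v ^ e + var C1 * r + var C2 * s"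
  have "p = const2 (a * c + b * d) * v ^ Suc e + u * ?t"
    unfolding p(3) rs by (simp add: x y const2_add const2_mult algebra_simps)
  moreover have "v ^ e \<in> irr_pow e"
    using hom_irr_pow[of "v ^ e" e] hom_power[OF v, of e] by simp
  then have "?t \<in> irr_pow e"
    using rs by (intro irr_pow_add irr_pow_mult[of "v ^ e"] irr_pow_var_pred)
  ultimately show ?case by (metis diff_Suc_1)
qed

lemma irr_pow_mod:
  assumes x: "var C1 = const2 a * v + u * q1" and y: "var C2 = const2 b * v + u * q2"
    and v: "v \<in> hom 1" and "q \<in> irr_pow n"
  shows "\<exists>r s. s \<in> irr_pow (n - 1) \<and> q = r * v ^ n + u * s"
  using assms(4)
proof (induction n arbitrary: q)
  case 0
  have "q = q * v ^ 0 + u * 0" by simp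
  then show ?case by fastforce
next
  case (Suc n)
  then obtain p1 p2 where p: "p1 \<in> irr_pow n" "p2 \<in> irr_pow n" "q = var C1 * p1 + var C2 * p2"
    by auto
  obtain c r d s where rs: "p1 = c * v ^ n + u * r" "p2 = d * v ^ n + u * s"
    "r \<in> irr_pow (n - 1)" "s \<in> irr_pow (n - 1)"
    using Suc.IH p by meson
  let ?t = "(q1 * c + q2 * d) * v ^ n + var C1 * r + var C2 * s"
  have "q = (const2 a * c + const2 b * d) * v ^ Suc n + u * ?t"
    unfolding p(3) rs by (simp add: x y algebra_simps)
  moreover have "v ^ n \<in> irr_pow n"
    using hom_irr_pow[of "v ^ n" n] hom_power[OF v, of n] by simp
  then have "?t \<in> irr_pow n"
    using rs by (intro irr_pow_add irr_pow_mult[of "v ^ n"] irr_pow_var_pred)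
  ultimately show ?case by (metis diff_Suc_1)
qed

text \<open>In two variables the zero set of \<open>u\<close> is spanned by one point
  \<open>z\<close>, so a homogeneous polynomial is tested for divisibility by \<open>u\<close> at
  \<open>z\<close> alone. The last clause holds because, on this line, the n-th power of the
  irrelevant ideal is generated by any form of degree \<open>n\<close> that does not vanish at
  \<open>z\<close>.\<close>

lemma linear_form_point:
  assumes "linear_form u" "u \<noteq> 0"
  obtains z v j k where "ev z u = 0" "linear_form v" "ev z v \<noteq> 0" "pd j u = const2 k" "k \<noteq> 0"
    "\<And>c p. p \<in> hom c \<Longrightarrow> ev z p = 0 \<Longrightarrow> u dvd p"
    "\<And>w. linear_form w \<Longrightarrow> lin_indep2 u w \<Longrightarrow> ev z w \<noteq> 0"
    "\<And>n p q. p \<in> hom (of_nat n) \<Longrightarrow> ev z p \<noteq> 0 \<Longrightarrow> q \<in> irr_pow n \<Longrightarrow>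
      \<exists>r s. s \<in> irr_pow (n - 1) \<and> q = r * p + u * s"
proof -
  obtain a b where u: "u = const2 a * var C1 + const2 b * var C2"
    using assms(1) by (auto simp: linear_form_def)
  have ab: "a \<noteq> 0 \<or> b \<noteq> 0" using assms(2) u by auto
  have lin: "linear_form (var i)" for i
  proof (cases i)
    case C1
    then show ?thesis
      unfolding linear_form_def by (intro exI[of _ 1] exI[of _ 0]) (simp)
  next
    case C2
    then show ?thesis
      unfolding linear_form_def by (intro exI[of _ 0] exI[of _ 1]) (simp)
  qed
  have pdl: "pd i (const2 c * var C1 + const2 d * var C2) = const2 (if i = C1 then c else d)" for i c d
    by (cases i) (simp_all add: pd_add pd_mult pd_const pd_var)
  define z where "z = (b, - a)"
  define i where "i = (if a \<noteq> 0 then C2 else C1)"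
  define j where "j = (if a \<noteq> 0 then C1 else C2)"
  define k where "k = (if a \<noteq> 0 then a else b)"
  have zu: "ev z u = 0" by (simp add: u z_def algebra_simps)
  have zv: "ev z (var i) \<noteq> 0"
    using ab by (auto simp: i_def z_def)
  have k: "k \<noteq> 0" "pd j u = const2 k" using ab by (auto simp: k_def j_def u pdl)
  have "const2 (inverse k) * const2 k = 1" using k(1) by (simp flip: const2_mult)
  then have kv: "const2 (inverse k) * (const2 k * p) = p" for p by (simp flip: mult.assoc)
  have "\<exists>c1 q1 c2 q2. var C1 = const2 c1 * var i + u * q1 \<and> var C2 = const2 c2 * var i + u * q2"
  proof (cases "a = 0")
    case False
    have "var C1 = const2 (- (inverse a * b)) * var C2 + u * const2 (inverse a)"
      using kv[of "var C1"] False
      by (simp add: u k_def const2_mult const2_minus algebra_simps)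
    moreover have "var C2 = const2 1 * var C2 + u * 0" by simp
    moreover have "i = C2" using False by (simp add: i_def)
    ultimately show ?thesis by blast
  next
    case True
    have "var C2 = const2 0 * var C1 + u * const2 (inverse b)"
      using kv[of "var C2"] True by (simp add: u k_def algebra_simps)
    moreover have "var C1 = const2 1 * var C1 + u * 0" by simp
    moreover have "i = C1" using True by (simp add: i_def)
    ultimately show ?thesis by blast
  qed
  then obtain c1 q1 c2 q2 where xy: "var C1 = const2 c1 * var i + u * q1"
    "var C2 = const2 c2 * var i + u * q2" by blast
  have dvd: "u dvd p" if p: "p \<in> hom c" "ev z p = 0" for c p
  proof (cases "p = 0")
    case False
    then obtain e where "c = of_nat e" using hom_nonzero p by blast
    then obtain d r where "p = const2 d * var i ^ e + u * r"
      using hom_mod_linear[OF xy hom_var] p by blast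
    moreover from this have "d = 0" using p zu zv by simp
    ultimately show ?thesis by simp
  qed simp
  have indep: "ev z w \<noteq> 0" if wl: "linear_form w" "lin_indep2 u w" for w
  proof
    assume ev: "ev z w = 0"
    obtain c d where w: "w = const2 c * var C1 + const2 d * var C2"
      using wl(1) by (auto simp: linear_form_def)
    have "b * c = a * d" using ev by (simp add: w z_def algebra_simps)
    then have eq: "const2 b * const2 c = const2 a * const2 d" by (simp flip: const2_mult)
    have "const2 c * u + const2 (- a) * w = 0" "const2 d * u + const2 (- b) * w = 0"
      using eq by (auto simp: u w const2_minus algebra_simps)
    then show False using wl(2) ab unfolding lin_indep2_def by fastforce
  qed
  have mod: "\<exists>r s. s \<in> irr_pow (n - 1) \<and> q = r * p + u * s"
    if p: "p \<in> hom (of_nat n)" "ev z p \<noteq> 0" and q: "q \<in> irr_pow n" for n p q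
  proof -
    obtain d t where t: "t \<in> irr_pow (n - 1)" "p = const2 d * var i ^ n + u * t"
      using hom_mod_linear[OF xy hom_var p(1)] by blast
    have "d \<noteq> 0" using t p(2) zu by auto
    then have "const2 (inverse d) * const2 d = 1" by (simp flip: const2_mult)
    then have "var i ^ n = const2 (inverse d) * (const2 d * var i ^ n)" by (simp flip: mult.assoc)
    also have "\<dots> = const2 (inverse d) * (p - u * t)" by (simp add: t)
    finally have vn: "var i ^ n = const2 (inverse d) * (p - u * t)" .
    obtain r s where rs: "s \<in> irr_pow (n - 1)" "q = r * var i ^ n + u * s"
      using irr_pow_mod[OF xy hom_var q] by blast
    have "q = (r * const2 (inverse d)) * p + u * (s + (- r * const2 (inverse d)) * t)"
      unfolding rs(2) vn by (simp add: algebra_simps)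
    moreover have "s + (- r * const2 (inverse d)) * t \<in> irr_pow (n - 1)"
      using rs(1) t(1) by (intro irr_pow_add irr_pow_mult)
    ultimately show ?thesis by blast
  qed
  show ?thesis
    by (rule that[OF zu lin zv k(2,1)]) (rule dvd indep mod; assumption)+
qed

section \<open>The twisted action on rational functions\<close>

definition is_line_pt :: "poly2 \<Rightarrow> complex \<times> complex \<Rightarrow> bool" where
  "is_line_pt u z \<longleftrightarrow> ev z u = 0 \<and> (\<forall>c p. p \<in> hom c \<and> ev z p = 0 \<longrightarrow> u dvd p) \<and>
    (\<forall>w. linear_form w \<and> lin_indep2 u w \<longrightarrow> ev z w \<noteq> 0) \<and>
    (\<forall>n p q. p \<in> hom (of_nat n) \<and> ev z p \<noteq> 0 \<and> q \<in> irr_pow n \<longrightarrow>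
      (\<exists>r s. s \<in> irr_pow (n - 1) \<and> q = r * p + u * s)) \<and>
    (\<exists>v. linear_form v \<and> ev z v \<noteq> 0)"

definition line_pt :: "poly2 \<Rightarrow> complex \<times> complex" where
  "line_pt u = (SOME z. is_line_pt u z)"

lemma line_pt:
  assumes "linear_form u" "u \<noteq> 0"
  shows "ev (line_pt u) u = 0"
    and "p \<in> hom c \<Longrightarrow> ev (line_pt u) p = 0 \<Longrightarrow> u dvd p"
    and "linear_form w \<Longrightarrow> lin_indep2 u w \<Longrightarrow> ev (line_pt u) w \<noteq> 0"
    and "p \<in> hom (of_nat n) \<Longrightarrow> ev (line_pt u) p \<noteq> 0 \<Longrightarrow> q \<in> irr_pow n \<Longrightarrow>
      \<exists>r s. s \<in> irr_pow (n - 1) \<and> q = r * p + u * s"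
    and "\<exists>v. linear_form v \<and> ev (line_pt u) v \<noteq> 0"
proof -
  obtain z v j k where "ev z u = 0" "linear_form v" "ev z v \<noteq> 0" "pd j u = const2 k" "k \<noteq> 0"
    "\<And>c p. p \<in> hom c \<Longrightarrow> ev z p = 0 \<Longrightarrow> u dvd p"
    "\<And>w. linear_form w \<Longrightarrow> lin_indep2 u w \<Longrightarrow> ev z w \<noteq> 0"
    "\<And>n p q. p \<in> hom (of_nat n) \<Longrightarrow> ev z p \<noteq> 0 \<Longrightarrow> q \<in> irr_pow n \<Longrightarrow>
      \<exists>r s. s \<in> irr_pow (n - 1) \<and> q = r * p + u * s"
    using linear_form_point[OF assms] by metis
  then have "is_line_pt u z" unfolding is_line_pt_def by (intro conjI) blast+
  then have "is_line_pt u (line_pt u)" unfolding line_pt_def by (rule someI)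
  note * = this[unfolded is_line_pt_def]
  show "ev (line_pt u) u = 0" using * by blast
  show "p \<in> hom c \<Longrightarrow> ev (line_pt u) p = 0 \<Longrightarrow> u dvd p" using * by blast
  show "linear_form w \<Longrightarrow> lin_indep2 u w \<Longrightarrow> ev (line_pt u) w \<noteq> 0" using * by blast
  show "p \<in> hom (of_nat n) \<Longrightarrow> ev (line_pt u) p \<noteq> 0 \<Longrightarrow> q \<in> irr_pow n \<Longrightarrow>
      \<exists>r s. s \<in> irr_pow (n - 1) \<and> q = r * p + u * s" using * by blast
  show "\<exists>v. linear_form v \<and> ev (line_pt u) v \<noteq> 0" using * by blast
qed

lemma linear_form_transversal:
  assumes "linear_form u" "u \<noteq> 0"
  obtains j k where "pd j u = const2 k" "k \<noteq> 0"
  using linear_form_point[OF assms] by metis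

section \<open>Polynomials inside the rational functions; logarithmic derivatives\<close>

definition emb :: "poly2 \<Rightarrow> ratfun2" where
  "emb p = Fract p 1"

lemma emb_simps [simp]:
  "emb 0 = 0" "emb 1 = 1" "emb (p + q) = emb p + emb q" "emb (p - q) = emb p - emb q"
  "emb (- p) = - emb p" "emb (p * q) = emb p * emb q" "emb p = emb q \<longleftrightarrow> p = q"
  by (simp_all add: emb_def Zero_fract_def One_fract_def eq_fract)

lemma emb_eq_0_iff [simp]: "emb p = 0 \<longleftrightarrow> p = 0"
  using emb_simps(7)[of p 0] by simp

lemma emb_power [simp]: "emb (p ^ n) = emb p ^ n"
  by (induction n) auto

lemma emb_prod: "emb (prod f A) = (\<Prod>i\<in>A. emb (f i))"
  and emb_sum: "emb (sum f A) = (\<Sum>i\<in>A. emb (f i))"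
  by (induction A rule: infinite_finite_induct) auto

lemma Fract_emb: "Fract p q = emb p / emb q"
  by (simp add: emb_def)

lemma emb_of_nat: "emb (of_nat n) = of_nat n"
  by (induction n) auto

lemma emb_const2_of_int: "emb (const2 (of_int n)) = of_int n"
  by (cases n) (auto simp: const2_of_nat emb_of_nat const2_minus simp del: of_nat_Suc)

lemma fpd_emb: "fpd i (emb p) = emb (pd i p)"
  by (simp add: emb_def fpd_Fract)

lemma fpd_1 [simp]: "fpd i 1 = 0"
  using fpd_emb[of i 1] by simp

lemma fpd_inverse: "f \<noteq> 0 \<Longrightarrow> fpd i (inverse f) = - inverse f * (fpd i f / f)"
proof -
  assume f: "f \<noteq> 0"
  have "fpd i (f * inverse f) = 0" using f by simp
  then have "f * fpd i (inverse f) = - (fpd i f * inverse f)"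
    unfolding fpd_mult by (simp add: add_eq_0_iff)
  then have "(inverse f * f) * fpd i (inverse f) = inverse f * (- (fpd i f * inverse f))"
    by (simp only: mult.assoc)
  then show ?thesis using f by (simp add: divide_inverse)
qed

lemma fpd_power: "f \<noteq> 0 \<Longrightarrow> fpd i (f ^ n) = of_nat n * f ^ n * (fpd i f / f)"
  by (induction n) (auto simp: fpd_mult field_simps)

lemma fpd_powi: "f \<noteq> 0 \<Longrightarrow> fpd i (f powi n) = of_int n * f powi n * (fpd i f / f)"
proof (cases "n \<ge> 0")
  case True
  assume "f \<noteq> 0"
  with True show ?thesis using fpd_power[of f i "nat n"] by (simp add: power_int_def)
next
  case False
  assume f: "f \<noteq> 0"
  have "fpd i (inverse (f ^ nat (- n))) = of_int n * inverse (f ^ nat (- n)) * (fpd i f / f)"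
    using f False by (simp add: fpd_inverse fpd_power)
  with False show ?thesis by (simp add: power_int_def power_inverse)
qed

lemma fpd_prod:
  "finite A \<Longrightarrow> (\<And>l. l \<in> A \<Longrightarrow> f l \<noteq> 0) \<Longrightarrow>
    fpd i (prod f A) = prod f A * (\<Sum>l\<in>A. fpd i (f l) / f l)"
  by (induction A rule: finite_induct) (auto simp: fpd_mult algebra_simps)

lemma const2_sum: "const2 (sum f B) = (\<Sum>i\<in>B. const2 (f i))"
  by (induction B rule: infinite_finite_induct) (auto simp: const2_add)

definition cscale :: "complex \<Rightarrow> ratfun2 \<Rightarrow> ratfun2" where
  "cscale c f = emb (const2 c) * f"

section \<open>The action on polynomials times integral powers of the linear forms\<close>

locale line_arrangement =
  fixes m :: nat and \<alpha> :: "nat \<Rightarrow> poly2" and \<beta> :: "nat \<Rightarrow> complex"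
  assumes forms: "\<And>i. i \<in> {1..m} \<Longrightarrow> linear_form (\<alpha> i)" "\<And>i. i \<in> {1..m} \<Longrightarrow> \<alpha> i \<noteq> 0"
    and indep: "pairwise (\<lambda>i j. lin_indep2 (\<alpha> i) (\<alpha> j)) {1..m}"
begin

definition idx :: "nat set" where "idx = {1..m}"

definition dX :: "coord \<Rightarrow> ratfun2 \<Rightarrow> ratfun2" where "dX i = gen_act m \<alpha> \<beta> (X i)"
definition dD :: "coord \<Rightarrow> ratfun2 \<Rightarrow> ratfun2" where "dD i = gen_act m \<alpha> \<beta> (D i)"

sublocale weyl_space cscale dX dD
proof unfold_locales
  show "dX i (f + g) = dX i f + dX i g" "dD i (f + g) = dD i f + dD i g" for i f g
    unfolding dX_def dD_def by (rule gen_act_add)+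
  show "dX i (cscale c f) = cscale c (dX i f)" "dD i (cscale c f) = cscale c (dD i f)" for i c f
    unfolding dX_def dD_def cscale_def emb_def by (rule gen_act_const)+
  show "dX i (dX j f) = dX j (dX i f)" "dD i (dD j f) = dD j (dD i f)" for i j f
    unfolding dX_def dD_def by (rule gen_act_X_X gen_act_D_D)+
  show "dD i (dX j f) = dX j (dD i f) + (if i = j then f else 0)" for i j f
    unfolding dX_def dD_def by (rule gen_act_D_X)
qed (simp_all add: cscale_def const2_add const2_mult algebra_simps)

lemma finite_idx: "finite idx" by (simp add: idx_def)

lemma form: "i \<in> idx \<Longrightarrow> linear_form (\<alpha> i)" "i \<in> idx \<Longrightarrow> \<alpha> i \<noteq> 0"
  using forms by (auto simp: idx_def)

lemma dX_eq: "dX i f = emb (var i) * f"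
  by (simp add: dX_def emb_def)

lemma dD_eq: "dD j f = fpd j f + f * (\<Sum>i\<in>idx. emb (const2 (\<beta> i)) * emb (pd j (\<alpha> i)) / emb (\<alpha> i))"
  by (simp add: dD_def idx_def Fract_emb del: One_nat_def)

definition pt :: "nat \<Rightarrow> complex \<times> complex" where "pt i = line_pt (\<alpha> i)"

lemma ev_pt: "i \<in> idx \<Longrightarrow> ev (pt i) (\<alpha> i) = 0"
  and pt_dvd: "i \<in> idx \<Longrightarrow> p \<in> hom c \<Longrightarrow> ev (pt i) p = 0 \<Longrightarrow> \<alpha> i dvd p"
  and pt_mod: "i \<in> idx \<Longrightarrow> p \<in> hom (of_nat n) \<Longrightarrow> ev (pt i) p \<noteq> 0 \<Longrightarrow> q \<in> irr_pow n \<Longrightarrow>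
      \<exists>r s. s \<in> irr_pow (n - 1) \<and> q = r * p + \<alpha> i * s"
  and pt_form: "i \<in> idx \<Longrightarrow> \<exists>v. linear_form v \<and> ev (pt i) v \<noteq> 0"
  using line_pt[OF form] by (auto simp: pt_def)

lemma ev_pt_other: "i \<in> idx \<Longrightarrow> l \<in> idx \<Longrightarrow> l \<noteq> i \<Longrightarrow> ev (pt i) (\<alpha> l) \<noteq> 0"
  using line_pt(3)[OF form, of i "\<alpha> l"] form indep by (auto simp: pt_def idx_def pairwise_def)

text \<open>As a rational function f stands for f \<alpha>^\<beta>, the total exponent of
  \<open>\<alpha> l\<close> in \<open>emb p * A n\<close> is
  \<open>\<beta> l + of_int (n l)\<close>.\<close>

definition A :: "(nat \<Rightarrow> int) \<Rightarrow> ratfun2" where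
  "A n = (\<Prod>l\<in>idx. emb (\<alpha> l) powi n l)"

definition P :: "(nat \<Rightarrow> int) \<Rightarrow> poly2" where
  "P n = (\<Prod>l\<in>idx. \<alpha> l ^ nat (n l))"

lemma A_nonzero [simp]: "A n \<noteq> 0"
  using form finite_idx by (auto simp: A_def)

lemma P_nonzero: "P n \<noteq> 0"
  using form finite_idx by (auto simp: P_def)

lemma A_add: "A (\<lambda>l. n l + k l) = A n * A k"
  using form by (simp add: A_def power_int_add prod.distrib)

lemma A_0: "A (\<lambda>l. 0) = 1"
  by (simp add: A_def)

lemma A_cong: "(\<And>l. l \<in> idx \<Longrightarrow> n l = k l) \<Longrightarrow> A n = A k"
  by (simp add: A_def)

lemma A_P: "(\<And>l. l \<in> idx \<Longrightarrow> 0 \<le> n l) \<Longrightarrow> A n = emb (P n)"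
  by (simp add: A_def P_def emb_prod power_int_def cong: prod.cong)

lemma A_lower: "(\<And>l. l \<in> idx \<Longrightarrow> k l \<le> n l) \<Longrightarrow> A n = emb (P (\<lambda>l. n l - k l)) * A k"
  using A_P[of "\<lambda>l. n l - k l"] A_add[of "\<lambda>l. n l - k l" k] by simp

lemma fpd_A: "fpd j (A n) = A n * (\<Sum>l\<in>idx. of_int (n l) * emb (pd j (\<alpha> l)) / emb (\<alpha> l))"
proof -
  have "fpd j (A n) = A n * (\<Sum>l\<in>idx. fpd j (emb (\<alpha> l) powi n l) / (emb (\<alpha> l) powi n l))"
    unfolding A_def by (rule fpd_prod[OF finite_idx]) (use form in auto)
  also have "(\<Sum>l\<in>idx. fpd j (emb (\<alpha> l) powi n l) / (emb (\<alpha> l) powi n l)) =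
      (\<Sum>l\<in>idx. of_int (n l) * emb (pd j (\<alpha> l)) / emb (\<alpha> l))"
    by (rule sum.cong) (use form in \<open>auto simp: fpd_powi fpd_emb\<close>)
  finally show ?thesis .
qed

lemma log_form_shift:
  "(\<Sum>l\<in>idx. emb (const2 (\<beta> l + of_int (n l))) * emb (pd j (\<alpha> l)) / emb (\<alpha> l)) =
    (\<Sum>l\<in>idx. of_int (n l) * emb (pd j (\<alpha> l)) / emb (\<alpha> l)) +
    (\<Sum>l\<in>idx. emb (const2 (\<beta> l)) * emb (pd j (\<alpha> l)) / emb (\<alpha> l))"
  unfolding sum.distrib[symmetric]
  by (rule sum.cong) (simp_all add: const2_add emb_const2_of_int distrib_right add_divide_distrib)

lemma dD_A: "dD j (emb q * A n) = A n * (emb (pd j q) +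
    emb q * (\<Sum>l\<in>idx. emb (const2 (\<beta> l + of_int (n l))) * emb (pd j (\<alpha> l)) / emb (\<alpha> l)))"
proof -
  have eq: "p' * a + p * (a * s) + p * a * t = a * (p' + p * (s + t))" for p p' a s t :: ratfun2
    by (simp add: algebra_simps)
  show ?thesis
    unfolding log_form_shift dD_eq fpd_mult fpd_emb fpd_A by (rule eq)
qed

text \<open>The numerator of the derivative of q \<alpha>^n over the common denominator of the lines
  in \<open>S\<close>. Lines outside \<open>S\<close> do not enter; \<open>dD_num\<close> therefore
  requires their total exponent to be 0.\<close>

definition num :: "nat set \<Rightarrow> coord \<Rightarrow> (nat \<Rightarrow> int) \<Rightarrow> poly2 \<Rightarrow> poly2" where
  "num S j n q = prod \<alpha> S * pd j q +
    q * (\<Sum>l\<in>S. const2 (\<beta> l + of_int (n l)) * pd j (\<alpha> l) * prod \<alpha> (S - {l}))"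

definition dec :: "nat set \<Rightarrow> (nat \<Rightarrow> int) \<Rightarrow> nat \<Rightarrow> int" where
  "dec S n = (\<lambda>l. if l \<in> S then n l - 1 else n l)"

lemma A_dec: "S \<subseteq> idx \<Longrightarrow> A n = A (dec S n) * emb (prod \<alpha> S)"
proof -
  assume S: "S \<subseteq> idx"
  have "A (\<lambda>l. if l \<in> S then 1 else 0) = emb (prod \<alpha> S)"
    using S finite_idx unfolding A_def emb_prod
    by (intro prod.mono_neutral_cong_right) auto
  then show ?thesis
    using A_add[of "dec S n" "\<lambda>l. if l \<in> S then 1 else 0"]
      A_cong[of n "\<lambda>l. dec S n l + (if l \<in> S then 1 else 0)"]
    by (simp add: dec_def)
qed

lemma dD_num:
  assumes "S \<subseteq> idx" "\<And>l. l \<in> idx \<Longrightarrow> l \<notin> S \<Longrightarrow> \<beta> l + of_int (n l) = 0"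
  shows "dD j (emb q * A n) = emb (num S j n q) * A (dec S n)"
proof -
  let ?t = "\<lambda>l. emb (const2 (\<beta> l + of_int (n l))) * emb (pd j (\<alpha> l)) / emb (\<alpha> l)"
  have fin: "finite S" using assms(1) finite_idx finite_subset by blast
  have "sum ?t idx = sum ?t S"
    by (rule sum.mono_neutral_right) (use assms finite_idx in auto)
  moreover have "emb (prod \<alpha> S) * sum ?t S =
      emb (\<Sum>l\<in>S. const2 (\<beta> l + of_int (n l)) * pd j (\<alpha> l) * prod \<alpha> (S - {l}))"
    unfolding emb_sum sum_distrib_left
  proof (rule sum.cong)
    fix l assume l: "l \<in> S"
    then have "prod \<alpha> S = \<alpha> l * prod \<alpha> (S - {l})" using fin by (simp add: prod.remove)
    moreover have "emb (\<alpha> l) \<noteq> 0" using l assms(1) form by auto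
    ultimately show "emb (prod \<alpha> S) * ?t l =
        emb (const2 (\<beta> l + of_int (n l)) * pd j (\<alpha> l) * prod \<alpha> (S - {l}))"
      by simp
  qed simp
  ultimately have "emb (prod \<alpha> S) * (emb (pd j q) + emb q * sum ?t idx) = emb (num S j n q)"
    by (simp add: num_def algebra_simps)
  moreover have "dD j (emb q * A n) = A n * (emb (pd j q) + emb q * sum ?t idx)" by (rule dD_A)
  moreover have "\<dots> = A (dec S n) * (emb (prod \<alpha> S) * (emb (pd j q) + emb q * sum ?t idx))"
    by (subst A_dec[OF assms(1), of n]) (simp only: mult.assoc)
  ultimately show ?thesis by (simp only: mult.commute)
qed

text \<open>Every term except the one for \<open>l = i\<close> contains the factor
  \<open>\<alpha> i\<close>. If the total exponent is nonzero, \<open>q\<close> does not vanish at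
  \<open>pt i\<close> and \<open>j\<close> is transversal to the line, the value is nonzero, so
  differentiation lowers the exponent of \<open>\<alpha> i\<close> without cancellation.\<close>

lemma ev_num: "i \<in> S \<Longrightarrow> S \<subseteq> idx \<Longrightarrow> ev (pt i) (num S j n q) =
    ev (pt i) q * (\<beta> i + of_int (n i)) * ev (pt i) (pd j (\<alpha> i)) * ev (pt i) (prod \<alpha> (S - {i}))"
proof -
  assume i: "i \<in> S" "S \<subseteq> idx"
  then have fin: "finite S" using finite_idx finite_subset by blast
  have 0: "ev (pt i) (prod \<alpha> B) = 0" if "i \<in> B" "finite B" for B
    using that ev_pt[of i] i by (auto simp: ev_prod)
  have "ev (pt i) (\<Sum>l\<in>S. const2 (\<beta> l + of_int (n l)) * pd j (\<alpha> l) * prod \<alpha> (S - {l})) =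
    (\<Sum>l\<in>{i}. ev (pt i) (const2 (\<beta> l + of_int (n l)) * pd j (\<alpha> l) * prod \<alpha> (S - {l})))"
    unfolding ev_sum by (rule sum.mono_neutral_right) (use i fin 0 in auto)
  then show ?thesis using 0[of S] i fin by (simp add: num_def)
qed

lemma ev_prod_other: "i \<in> idx \<Longrightarrow> S \<subseteq> idx \<Longrightarrow> i \<notin> S \<Longrightarrow> ev (pt i) (prod \<alpha> S) \<noteq> 0"
  using ev_pt_other[of i] finite_subset[OF _ finite_idx] by (auto simp: ev_prod)

text \<open>A linear form equals its own Euler derivative, so contracting the logarithmic form with
  the Euler field gives the sum of the total exponents.\<close>

lemma eig_A: "emb p * A n \<in> eig c \<longleftrightarrow> p \<in> hom (c - sum \<beta> idx - of_int (sum n idx))"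
proof -
  have l: "var C1 * pd C1 (\<alpha> l) + var C2 * pd C2 (\<alpha> l) = \<alpha> l" if "l \<in> idx" for l
    using hom_linear_form[OF form(1)[OF that]] by (simp add: hom_def)
  let ?t = "\<lambda>j l. emb (const2 (\<beta> l + of_int (n l))) * emb (pd j (\<alpha> l)) / emb (\<alpha> l)"
  have "emb (var C1) * sum (?t C1) idx + emb (var C2) * sum (?t C2) idx =
      (\<Sum>l\<in>idx. emb (const2 (\<beta> l + of_int (n l))))"
    unfolding sum_distrib_left sum.distrib[symmetric]
  proof (rule sum.cong)
    fix i assume i: "i \<in> idx"
    have "emb (var C1) * ?t C1 i + emb (var C2) * ?t C2 i = emb (const2 (\<beta> i + of_int (n i))) *
       emb (var C1 * pd C1 (\<alpha> i) + var C2 * pd C2 (\<alpha> i)) / emb (\<alpha> i)"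
      by (simp add: algebra_simps add_divide_distrib)
    also have "\<dots> = emb (const2 (\<beta> i + of_int (n i)))" using i form by (simp only: l) simp
    finally show "emb (var C1) * ?t C1 i + emb (var C2) * ?t C2 i = emb (const2 (\<beta> i + of_int (n i)))" .
  qed simp
  also have "\<dots> = emb (const2 (sum \<beta> idx + of_int (sum n idx)))"
    by (simp add: const2_add const2_sum emb_sum sum.distrib)
  finally have sums: "emb (var C1) * sum (?t C1) idx + emb (var C2) * sum (?t C2) idx =
      emb (const2 (sum \<beta> idx + of_int (sum n idx)))" .
  have eq: "x * (a * (p1 + q * s)) + y * (a * (p2 + q * t)) = a * (x * p1 + y * p2 + k * q)"
    if "x * s + y * t = k" for x y a p1 p2 q s t k :: ratfun2
    unfolding that[symmetric] by (simp add: algebra_simps)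
  have "eul (emb p * A n) = A n * emb (var C1 * pd C1 p + var C2 * pd C2 p +
      const2 (sum \<beta> idx + of_int (sum n idx)) * p)"
    unfolding eul_def dX_eq dD_A emb_simps by (rule eq[OF sums])
  then have "emb p * A n \<in> eig c \<longleftrightarrow> A n * emb (var C1 * pd C1 p + var C2 * pd C2 p +
      const2 (sum \<beta> idx + of_int (sum n idx)) * p) = A n * emb (const2 c * p)"
    by (simp add: eig_def cscale_def mult.commute mult.left_commute)
  also have "\<dots> \<longleftrightarrow> var C1 * pd C1 p + var C2 * pd C2 p +
      const2 (sum \<beta> idx + of_int (sum n idx)) * p = const2 c * p"
    by (simp del: emb_simps(1-6))
  also have "\<dots> \<longleftrightarrow> p \<in> hom (c - sum \<beta> idx - of_int (sum n idx))"
    by (auto simp: hom_def const2_add const2_diff algebra_simps)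
  finally show ?thesis .
qed

section \<open>Localizations at the forms of a subset of the lines\<close>

definition Mloc :: "nat set \<Rightarrow> ratfun2 set" where
  "Mloc S = {emb p * A n | p n. \<forall>l\<in>idx. l \<notin> S \<longrightarrow> 0 \<le> n l}"

definition flat :: "nat set \<Rightarrow> int \<Rightarrow> nat \<Rightarrow> int" where
  "flat S k = (\<lambda>l. if l \<in> S then k else 0)"

lemma MlocI: "(\<And>l. l \<in> idx \<Longrightarrow> l \<notin> S \<Longrightarrow> 0 \<le> n l) \<Longrightarrow> emb p * A n \<in> Mloc S"
  by (auto simp: Mloc_def)

lemma Mloc_mono: "S \<subseteq> T \<Longrightarrow> Mloc S \<subseteq> Mloc T"
  by (auto simp: Mloc_def)

text \<open>All large \<open>k\<close> are allowed, so that two elements can be brought to a common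
  denominator.\<close>

lemma Mloc_flat:
  assumes "f \<in> Mloc S"
  obtains N where "\<And>k. k \<ge> N \<Longrightarrow> \<exists>p. f = emb p * A (flat S (- int k))"
proof -
  obtain p n where f: "f = emb p * A n" "\<forall>l\<in>idx. l \<notin> S \<longrightarrow> 0 \<le> n l" using assms by (auto simp: Mloc_def)
  define N where "N = (\<Sum>l\<in>idx. nat \<bar>n l\<bar>)"
  have "\<exists>p. f = emb p * A (flat S (- int k))" if "k \<ge> N" for k
  proof -
    have "flat S (- int k) l \<le> n l" if l: "l \<in> idx" for l
    proof -
      have "nat \<bar>n l\<bar> \<le> k" using \<open>k \<ge> N\<close> member_le_sum[OF l, of "\<lambda>l. nat \<bar>n l\<bar>"] finite_idx
        unfolding N_def by simp
      then show ?thesis using f(2) l by (auto simp: flat_def)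
    qed
    then have "f = emb (p * P (\<lambda>l. n l - flat S (- int k) l)) * A (flat S (- int k))"
      using A_lower[of "flat S (- int k)" n] f(1) by simp
    then show ?thesis by blast
  qed
  then show ?thesis using that by blast
qed

lemma subspace_Mloc: "subspace (Mloc S)"
proof (rule subspaceI)
  have "emb 0 * A (\<lambda>l. 0) \<in> Mloc S" by (rule MlocI) simp
  then show "0 \<in> Mloc S" by simp
next
  fix f g assume fg: "f \<in> Mloc S" "g \<in> Mloc S"
  obtain N where N: "\<And>k. k \<ge> N \<Longrightarrow> \<exists>p. f = emb p * A (flat S (- int k))" using Mloc_flat[OF fg(1)] by blast
  obtain N' where N': "\<And>k. k \<ge> N' \<Longrightarrow> \<exists>p. g = emb p * A (flat S (- int k))" using Mloc_flat[OF fg(2)] by blast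
  obtain p q where "f = emb p * A (flat S (- int (max N N')))" "g = emb q * A (flat S (- int (max N N')))"
    using N[of "max N N'"] N'[of "max N N'"] by auto
  then have "f + g = emb (p + q) * A (flat S (- int (max N N')))" by (simp add: algebra_simps)
  then show "f + g \<in> Mloc S" using MlocI[of S "flat S (- int (max N N'))" "p + q"] by (simp add: flat_def)
next
  fix c f assume "f \<in> Mloc S"
  then obtain p n where "f = emb p * A n" "\<forall>l\<in>idx. l \<notin> S \<longrightarrow> 0 \<le> n l" by (auto simp: Mloc_def)
  then show "cscale c f \<in> Mloc S"
    using MlocI[of S n "const2 c * p"] by (simp add: cscale_def mult.assoc)
qed

text \<open>A line of nonzero exponent outside \<open>S\<close> would acquire a pole on
  differentiating \<alpha>^\<beta>; the second hypothesis excludes this.\<close>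

lemma stable_Mloc:
  assumes "S \<subseteq> idx" "\<And>l. l \<in> idx \<Longrightarrow> l \<notin> S \<Longrightarrow> \<beta> l = 0"
  shows "stable (Mloc S)"
  unfolding stable_def
proof (intro conjI allI ballI subspace_Mloc)
  fix i f assume "f \<in> Mloc S"
  then obtain N where "\<And>k. k \<ge> N \<Longrightarrow> \<exists>p. f = emb p * A (flat S (- int k))" using Mloc_flat by blast
  then obtain p where f: "f = emb p * A (flat S (- int N))" by blast
  have "emb (var i * p) * A (flat S (- int N)) \<in> Mloc S" by (rule MlocI) (simp add: flat_def)
  then show "dX i f \<in> Mloc S" by (simp add: f dX_eq mult.assoc)
  have "dD i f = emb (num S i (flat S (- int N)) p) * A (dec S (flat S (- int N)))"
    unfolding f by (rule dD_num) (use assms in \<open>auto simp: flat_def\<close>)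
  moreover have "emb (num S i (flat S (- int N)) p) * A (dec S (flat S (- int N))) \<in> Mloc S"
    by (rule MlocI) (simp add: flat_def dec_def)
  ultimately show "dD i f \<in> Mloc S" by simp
qed

lemma poly2_induct [case_names const add var]:
  fixes Q :: "poly2 \<Rightarrow> bool"
  assumes "\<And>c. Q (const2 c)" "\<And>p q. Q p \<Longrightarrow> Q q \<Longrightarrow> Q (p + q)" "\<And>i p. Q p \<Longrightarrow> Q (var i * p)"
  shows "Q p"
proof (induction p)
  case 0
  then show ?case using assms(1)[of 0] by simp
next
  case (pCons a p)
  have "Q [:a:]"
  proof (induction a)
    case 0
    then show ?case using assms(1)[of 0] by simp
  next
    case (pCons c b)
    have "[:pCons c b:] = const2 c + var C1 * [:b:]" by (simp add: const2_def var.simps)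
    moreover have "Q (const2 c + var C1 * [:b:])" by (intro assms pCons)
    ultimately show ?case by (simp only:)
  qed
  moreover have "pCons a p = [:a:] + var C2 * p" by (simp add: var.simps)
  moreover have "Q ([:a:] + var C2 * p)" by (intro assms pCons calculation)
  ultimately show ?case by (simp only:)
qed

text \<open>Elements with constant numerator are homogeneous, and multiplication by variables
  preserves the span of homogeneous elements.\<close>

lemma graded_Mloc: "graded (Mloc S)"
  unfolding graded_def
proof
  fix f assume "f \<in> Mloc S"
  then obtain p n where f: "f = emb p * A n" "\<forall>l\<in>idx. l \<notin> S \<longrightarrow> 0 \<le> n l" by (auto simp: Mloc_def)
  let ?V = "span (\<Union>c. Mloc S \<inter> eig c)"
  have V: "dX i g \<in> ?V" if "g \<in> ?V" for i g
    using that
  proof (induction rule: span_induct_alt)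
    case base
    then show ?case by (simp add: X_0 span_zero)
  next
    case (step c x y)
    then obtain d q k where x: "x \<in> eig d" "x = emb q * A k" "\<forall>l\<in>idx. l \<notin> S \<longrightarrow> 0 \<le> k l"
      by (auto simp: Mloc_def)
    have "dX i x \<in> Mloc S"
      using MlocI[of S k "var i * q"] x by (simp add: dX_eq mult.assoc)
    then have "dX i x \<in> ?V" using eig_X[OF x(1)] by (intro span_base) blast
    then show ?case using step by (simp add: X_add X_scale span_add span_scale)
  qed
  have "emb p * A n \<in> ?V"
  proof (induction p rule: poly2_induct)
    case (const c)
    have "emb (const2 c) * A n \<in> Mloc S \<inter> eig (sum \<beta> idx + of_int (sum n idx))"
      using f(2) hom_const by (simp add: eig_A MlocI)
    then show ?case by (intro span_base) blast
  next
    case (add p q)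
    then show ?case using span_add by (simp add: algebra_simps)
  next
    case (var i p)
    have eq: "emb (var i * p) * A n = dX i (emb p * A n)" by (simp add: dX_eq mult.assoc)
    show ?case unfolding eq by (rule V[OF var])
  qed
  with f show "f \<in> ?V" by simp
qed

text \<open>While the numerator vanishes at the point of the line, homogeneity permits cancelling a
  factor \<open>\<alpha> i\<close>. This ends before the exponent reaches 0, since \<open>f\<close>
  is not regular along the line.\<close>

lemma Mloc_pole:
  assumes "i \<in> idx" "i \<in> S" "f \<in> Mloc S" "f \<in> eig c" "f \<notin> Mloc (S - {i})"
  obtains p n where "f = emb p * A n" "\<And>l. l \<in> idx \<Longrightarrow> l \<notin> S \<Longrightarrow> 0 \<le> n l" "n i < 0" "ev (pt i) p \<noteq> 0"
proof -
  have "\<exists>p n. f = emb p * A n \<and> (\<forall>l\<in>idx. l \<notin> S \<longrightarrow> 0 \<le> n l) \<and> n i < 0 \<and> ev (pt i) p \<noteq> 0"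
    if f: "f = emb p * A n" "\<forall>l\<in>idx. l \<notin> S \<longrightarrow> 0 \<le> n l" for p n
    using f
  proof (induction "nat (- n i)" arbitrary: p n)
    case 0
    then have "f \<in> Mloc (S - {i})" by (auto simp: Mloc_def)
    with assms show ?case by blast
  next
    case (Suc k)
    show ?case
    proof (cases "ev (pt i) p = 0")
      case False
      then show ?thesis using Suc by (intro exI[of _ p] exI[of _ n]) auto
    next
      case True
      then have "\<alpha> i dvd p" using pt_dvd[OF assms(1) _ True] assms(4) Suc.prems(1) eig_A by blast
      then obtain q where q: "p = \<alpha> i * q" by (auto elim: dvdE)
      let ?n = "n(i := n i + 1)"
      have "n = dec {i} ?n" by (auto simp: dec_def)
      then have "f = emb q * A ?n"
        using A_dec[of "{i}" ?n] assms(1) Suc.prems(1) by (simp add: q mult.left_commute mult.commute)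
      moreover have "\<forall>l\<in>idx. l \<notin> S \<longrightarrow> 0 \<le> ?n l" using Suc.prems assms(2) by auto
      moreover have "k = nat (- ?n i)" using Suc.hyps(2) by simp
      ultimately show ?thesis using Suc.hyps(1) by blast
    qed
  qed
  moreover obtain p n where "f = emb p * A n" "\<forall>l\<in>idx. l \<notin> S \<longrightarrow> 0 \<le> n l"
    using assms(3) by (auto simp: Mloc_def)
  ultimately show ?thesis using that by blast
qed

lemma Mloc_localization: "Mloc idx = localization (\<Prod>i=1..m. \<alpha> i)"
proof -
  let ?a = "prod \<alpha> idx"
  have a: "A (flat idx (- int k)) = 1 / emb ?a ^ k" for k
    by (simp add: A_def flat_def emb_prod power_int_minus prod_inversef prod_power_distrib
        inverse_eq_divide prod_dividef cong: prod.cong)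
  have "f \<in> Mloc idx \<longleftrightarrow> (\<exists>p k. f = emb p / emb ?a ^ k)" for f
  proof
    assume "f \<in> Mloc idx"
    then obtain N where "\<And>k. k \<ge> N \<Longrightarrow> \<exists>p. f = emb p * A (flat idx (- int k))" using Mloc_flat by blast
    then show "\<exists>p k. f = emb p / emb ?a ^ k" unfolding a by force
  next
    assume "\<exists>p k. f = emb p / emb ?a ^ k"
    then obtain p k where "f = emb p * A (flat idx (- int k))" unfolding a by auto
    then show "f \<in> Mloc idx" using MlocI[of idx "flat idx (- int k)" p] by simp
  qed
  then show ?thesis unfolding localization_def idx_def Fract_emb by auto
qed

end

section \<open>Potentials of degree 0 for boundaries\<close>

context weyl_space
begin

text \<open>Cartan's formula: f dx1 dx2 is the differential of a dx2 - b dx1, which has degree 0.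
  The contraction of this 1-form with the Euler field is h = x2 a - x1 b, so dh is minus the
  contraction of f dx1 dx2.\<close>

lemma boundary_potential:
  assumes M: "stable M" and f: "f \<in> boundaries M"
  obtains h where "h \<in> M" "h \<in> eig 0" "D C1 h = X C2 f" "D C2 h = - X C1 f"
proof -
  obtain a b where ab: "a \<in> M" "a \<in> eig (- 1)" "b \<in> M" "b \<in> eig (- 1)" "f = D C1 a + D C2 b"
    using f by (auto simp: boundaries_def)
  let ?h = "X C2 a - X C1 b"
  have a: "X C1 (D C1 a) = - a - X C2 (D C2 a)" and b: "X C2 (D C2 b) = - b - X C1 (D C1 b)"
    using ab(2,4) by (simp_all add: eig_def eul_def eq_diff_eq add.commute)
  have "?h \<in> eig 0"
    using eig_X[OF ab(2), of C2] eig_X[OF ab(4), of C1] subspace_diff[OF subspace_eig] by simp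
  moreover have "?h \<in> M" using ab M by (intro subspace_diff stable_subspace stable_X)
  moreover have "D C1 ?h = X C2 f" by (simp add: ab(5) D_diff D_X X_add b)
  moreover have "D C2 ?h = - X C1 f" by (simp add: ab(5) D_diff D_X X_add a)
  ultimately show ?thesis using that by blast
qed

text \<open>The way back from a potential of the shape (a x1 + b x2) g to a boundary; the Euler
  relation for \<open>g\<close> in degree -1 eliminates x1 \<open>D C1 g\<close>.\<close>

lemma X2_boundary:
  assumes "g \<in> eig (- 1)"
  shows "X C2 (D C1 (b *s g) - D C2 (a *s g)) = D C1 (a *s X C1 g + b *s X C2 g)"
proof -
  have g: "X C1 (D C1 g) = - g - X C2 (D C2 g)"
    using assms by (simp add: eig_def eul_def eq_diff_eq)
  show ?thesis
    by (simp add: D_add D_scale D_X X_diff X_scale g scale_right_distrib scale_right_diff_distrib)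
qed

lemma bad_shift: "\<exists>n. c + of_nat n \<notin> bad"
proof (cases "c \<in> bad")
  case True
  then obtain n where n: "c = - 2 - of_nat n" by (auto simp: bad_def)
  then have "c + of_nat (Suc n) = - 1" by simp
  then have "c + of_nat (Suc n) \<notin> bad" using minus_one_notin_bad by (simp only: not_False_eq_True)
  then show ?thesis by blast
next
  case False
  then show ?thesis by (intro exI[of _ 0]) simp
qed

end

lemma hom_pd: "p \<in> hom c \<Longrightarrow> pd j p \<in> hom (c - 1)"
proof -
  assume p: "p \<in> hom c"
  then have "pd j (var C1 * pd C1 p + var C2 * pd C2 p) = const2 c * pd j p"
    by (simp add: hom_def pd_mult pd_const)
  moreover have "pd j (var C1 * pd C1 p + var C2 * pd C2 p) =
      pd j p + (var C1 * pd C1 (pd j p) + var C2 * pd C2 (pd j p))"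
    by (cases j) (simp_all add: pd_add pd_mult pd_var pd_commute[of C2 C1] algebra_simps)
  ultimately show ?thesis by (simp add: hom_def const2_diff algebra_simps)
qed

section \<open>Ideals that carry an element into a submodule\<close>

definition poly_ideal :: "poly2 set \<Rightarrow> bool" where
  "poly_ideal J \<longleftrightarrow> (\<forall>p\<in>J. \<forall>q\<in>J. p + q \<in> J) \<and> (\<forall>p\<in>J. \<forall>r. r * p \<in> J)"

text \<open>The colon ideal of \<open>J\<close> by a variable satisfies the hypothesis with
  \<open>n\<close> lowered by one.\<close>

lemma irr_pow_subset_ideal:
  assumes J: "poly_ideal J" and mon: "\<And>a b. a + b = n \<Longrightarrow> var C1 ^ a * var C2 ^ b \<in> J"
  shows "irr_pow n \<subseteq> J"
  using assms
proof (induction n arbitrary: J)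
  case 0
  have "1 \<in> J" using "0.prems"(2)[of 0 0] by simp
  then show ?case using "0.prems"(1) unfolding poly_ideal_def by (metis mult.right_neutral subsetI)
next
  case (Suc n)
  let ?J = "\<lambda>i. {p. var i * p \<in> J}"
  have "irr_pow n \<subseteq> ?J i" for i
  proof (rule Suc.IH)
    show "poly_ideal (?J i)"
      using Suc.prems(1) by (auto simp: poly_ideal_def distrib_left mult.left_commute)
    show "var C1 ^ a * var C2 ^ b \<in> ?J i" if "a + b = n" for a b
      using Suc.prems(2)[of "Suc a" b] Suc.prems(2)[of a "Suc b"] that
      by (cases i) (auto simp: mult.assoc mult.left_commute)
  qed
  then have "var i * p \<in> J" if "p \<in> irr_pow n" for i p using that by blast
  then show ?case using Suc.prems(1) by (auto simp: poly_ideal_def)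
qed

context line_arrangement
begin

lemma mon_eq: "mon a b f = emb (var C1 ^ a * var C2 ^ b) * f"
proof -
  have "(dX i ^^ n) g = emb (var i) ^ n * g" for i n g
    by (induction n) (auto simp: dX_eq mult.assoc)
  then show ?thesis by (simp add: mon_def mult.assoc)
qed

lemma stable_emb: "stable H \<Longrightarrow> f \<in> H \<Longrightarrow> emb p * f \<in> H"
proof (induction p rule: poly2_induct)
  case (const c)
  then have "cscale c f \<in> H" by (intro subspace_scale stable_subspace)
  then show ?case by (simp only: cscale_def)
next
  case (add p q)
  then show ?case using subspace_add[OF stable_subspace] by (simp add: distrib_right)
next
  case (var i p)
  then have "dX i (emb p * f) \<in> H" by (intro stable_X)
  then show ?case by (simp only: dX_eq emb_simps mult.assoc)
qed

lemma ideal_stable: "stable H \<Longrightarrow> poly_ideal {p. emb p * f \<in> H}"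
  using stable_emb subspace_add[OF stable_subspace]
  by (auto simp: poly_ideal_def distrib_right mult.assoc)

text \<open>Otherwise \<open>f\<close> would give a nonzero element of good degree in a quotient
  supported at the origin.\<close>

lemma in_stable_of_irr_pow:
  assumes "stable H" "f \<in> eig c" "c \<notin> bad" "\<And>q. q \<in> irr_pow n \<Longrightarrow> emb q * f \<in> H"
  shows "f \<in> H"
  using assms(4) irr_pow_monom by (intro mon_in_stable[OF assms(1-3), of n]) (auto simp: mon_eq simp del: emb_power emb_simps)

lemma irr_pow_in_stable:
  assumes "stable M" "stable H" "\<And>c. c \<notin> bad \<Longrightarrow> M \<inter> eig c \<subseteq> H" "f \<in> M" "f \<in> eig c"
  obtains n where "\<And>q. q \<in> irr_pow n \<Longrightarrow> emb q * f \<in> H"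
proof -
  obtain n where n: "c + of_nat n \<notin> bad" using bad_shift by blast
  have "irr_pow n \<subseteq> {p. emb p * f \<in> H}"
  proof (rule irr_pow_subset_ideal[OF ideal_stable[OF assms(2)]])
    fix a b assume "a + b = n"
    then have "mon a b f \<in> eig (c + of_nat n)" using eig_mon[OF assms(5), of a b] by (auto simp: add.assoc)
    then have "mon a b f \<in> H" using assms(3)[OF n] stable_mon[OF assms(1,4)] by blast
    then show "var C1 ^ a * var C2 ^ b \<in> {p. emb p * f \<in> H}" by (simp add: mon_eq)
  qed
  then show ?thesis using that by blast
qed

lemma num_split:
  assumes i: "i \<in> S" "S \<subseteq> idx"
  obtains s where "\<And>q. num S j n q = \<alpha> i * (prod \<alpha> (S - {i}) * pd j q + q * s) +
    const2 (\<beta> i + of_int (n i)) * pd j (\<alpha> i) * q * prod \<alpha> (S - {i})"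
proof -
  have fin: "finite S" using i finite_idx finite_subset by blast
  let ?t = "\<lambda>l. const2 (\<beta> l + of_int (n l)) * pd j (\<alpha> l)"
  let ?s = "\<Sum>l\<in>S - {i}. ?t l * prod \<alpha> (S - {i} - {l})"
  have "(\<Sum>l\<in>S - {i}. ?t l * prod \<alpha> (S - {l})) = \<alpha> i * ?s"
    unfolding sum_distrib_left
  proof (rule sum.cong)
    fix l assume "l \<in> S - {i}"
    then have "prod \<alpha> (S - {l}) = \<alpha> i * prod \<alpha> (S - {i} - {l})"
      using fin i by (subst prod.remove[of _ i]) (auto simp: Diff_insert2[symmetric] insert_commute)
    then show "?t l * prod \<alpha> (S - {l}) = \<alpha> i * (?t l * prod \<alpha> (S - {i} - {l}))"
      by (simp add: mult.left_commute)
  qed simp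
  moreover have "(\<Sum>l\<in>S. ?t l * prod \<alpha> (S - {l})) =
      ?t i * prod \<alpha> (S - {i}) + (\<Sum>l\<in>S - {i}. ?t l * prod \<alpha> (S - {l}))"
    by (rule sum.remove[OF fin i(1)])
  moreover have "prod \<alpha> S = \<alpha> i * prod \<alpha> (S - {i})" by (rule prod.remove[OF fin i(1)])
  ultimately have "num S j n q = \<alpha> i * (prod \<alpha> (S - {i}) * pd j q + q * ?s) +
    const2 (\<beta> i + of_int (n i)) * pd j (\<alpha> i) * q * prod \<alpha> (S - {i})" for q
    unfolding num_def by (simp add: algebra_simps)
  then show ?thesis using that by blast
qed

lemma A_shift: "B \<subseteq> idx \<Longrightarrow> (\<And>l. l \<in> idx \<Longrightarrow> n l = (if l \<in> B then k l + 1 else k l)) \<Longrightarrow>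
  emb (prod \<alpha> B) * A k = A n"
  using A_dec[of B n] A_cong[of "dec B n" k] by (simp add: dec_def mult.commute)

lemma A_shift1: "i \<in> idx \<Longrightarrow> (\<And>l. l \<in> idx \<Longrightarrow> n l = (if l = i then k l + 1 else k l)) \<Longrightarrow>
  emb (\<alpha> i) * A k = A n"
  using A_shift[of "{i}" n k] by simp

lemma stable_smult_cancel:
  assumes "stable H" "c \<noteq> 0" "emb (const2 c) * f \<in> H"
  shows "f \<in> H"
  using subspace_scale[OF stable_subspace[OF assms(1)] assms(3), of "inverse c"] assms(2)
  by (simp add: cscale_def flip: mult.assoc emb_simps(6) const2_mult)

subsection \<open>The bottom of the filtration\<close>

text \<open>After clearing the denominators of a homogeneous element, its numerator is
  differentiated down to a constant. Multiplication by the product of the forms absorbs the poles so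
  created, which raises \<open>k\<close> by one each time.\<close>

lemma power_of_product_in_stable:
  assumes S: "S \<subseteq> idx" "\<And>l. l \<in> idx \<Longrightarrow> l \<notin> S \<Longrightarrow> \<beta> l = 0"
    and H: "stable H" "H \<subseteq> Mloc S" "H \<noteq> {0}"
  obtains k where "A (flat S (int k)) \<in> H"
proof -
  obtain f where f: "f \<in> H" "f \<noteq> 0" using H(3) subspace_0[OF stable_subspace[OF H(1)]] by blast
  obtain c g where g: "g \<in> H" "g \<in> Mloc S" "g \<in> eig c" "g \<noteq> 0"
    using graded_component[OF graded_Mloc subspace_Mloc H(1) f(1) subsetD[OF H(2) f(1)] _
        subspace_single_0] f(2) by (metis singleton_iff)
  obtain N where "\<And>k. k \<ge> N \<Longrightarrow> \<exists>p. g = emb p * A (flat S (- int k))" using Mloc_flat[OF g(2)] by blast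
  then obtain p where p: "g = emb p * A (flat S (- int N))" by blast
  have "emb (P (flat S (int N))) * A (flat S (- int N)) = A (\<lambda>l. 0)"
    using A_P[of "flat S (int N)"] A_add[of "flat S (int N)" "flat S (- int N)"]
      A_cong[of "\<lambda>l. flat S (int N) l + flat S (- int N) l" "\<lambda>l. 0"] by (simp add: flat_def)
  then have "emb (P (flat S (int N))) * g = emb p * A (flat S (int 0))"
    unfolding p using A_cong[of "flat S (int 0)" "\<lambda>l. 0"] by (simp add: mult.left_commute flat_def)
  then have p0: "emb p * A (flat S (int 0)) \<in> H"
    using stable_emb[OF H(1) g(1), of "P (flat S (int N))"] by simp
  have "p \<noteq> 0" using g(4) p by auto
  moreover obtain e where "p \<in> hom (of_nat e)"
    using g(3) \<open>p \<noteq> 0\<close> hom_nonzero unfolding p eig_A by metis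
  moreover have "\<exists>k. A (flat S (int k)) \<in> H"
    if "p \<noteq> 0" "p \<in> hom (of_nat e)" "emb p * A (flat S (int k)) \<in> H" for p e k
    using that
  proof (induction e arbitrary: p k)
    case 0
    then obtain d where "p = const2 d" "d \<noteq> 0" using hom_0_const[of p] by auto
    then show ?case using 0 stable_smult_cancel[OF H(1)] by blast
  next
    case (Suc e)
    have "const2 (of_nat (Suc e)) * p \<noteq> 0" using Suc.prems(1) by (simp del: of_nat_Suc)
    \<comment> \<open>Euler's identity: a nonzero form of positive degree has a nonzero partial
      derivative.\<close>
    then have "var C1 * pd C1 p + var C2 * pd C2 p \<noteq> 0" using Suc.prems(2) by (simp add: hom_def)
    then obtain j where j: "pd j p \<noteq> 0" by fastforce
    let ?n = "flat S (int k)"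
    let ?r = "\<Sum>l\<in>S. const2 (\<beta> l + of_int (?n l)) * pd j (\<alpha> l) * prod \<alpha> (S - {l})"
    have "dD j (emb p * A ?n) = emb (num S j ?n p) * A (dec S ?n)"
      by (rule dD_num[OF S(1)]) (use S(2) in \<open>simp add: flat_def\<close>)
    then have "emb (prod \<alpha> S) * (emb (num S j ?n p) * A (dec S ?n)) \<in> H"
      using stable_emb[OF H(1) stable_D[OF H(1) Suc.prems(3)], of "prod \<alpha> S" j] by simp
    then have "emb (num S j ?n p) * (emb (prod \<alpha> S) * A (dec S ?n)) \<in> H"
      by (subst mult.left_commute)
    moreover have "emb (prod \<alpha> S) * A (dec S ?n) = A ?n" using A_dec[OF S(1), of ?n] by simp
    ultimately have "emb (num S j ?n p) * A ?n \<in> H" by (simp only:)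
    then have diff: "emb (num S j ?n p) * A ?n - emb ?r * (emb p * A ?n) \<in> H"
      by (rule subspace_diff[OF stable_subspace[OF H(1)] _ stable_emb[OF H(1) Suc.prems(3)]])
    have ring: "(c * d + q * r) * a = d * (c * a) + r * (q * a)" for a c d q r :: ratfun2
      by (simp add: algebra_simps)
    have sum: "emb (num S j ?n p) * A ?n =
        emb (pd j p) * (emb (prod \<alpha> S) * A ?n) + emb ?r * (emb p * A ?n)"
      unfolding num_def emb_simps by (rule ring)
    have "emb (pd j p) * (emb (prod \<alpha> S) * A ?n) \<in> H"
      using diff unfolding sum by (simp only: add_diff_cancel_right')
    moreover have "emb (prod \<alpha> S) * A ?n = A (flat S (int (Suc k)))"
      by (rule A_shift[OF S(1)]) (simp add: flat_def)
    ultimately have "emb (pd j p) * A (flat S (int (Suc k))) \<in> H" by simp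
    moreover have "pd j p \<in> hom (of_nat e)" using hom_pd[OF Suc.prems(2), of j] by simp
    ultimately show ?case using Suc.IH j by blast
  qed
  ultimately show ?thesis using that p0 by blast
qed

definition flat2 :: "nat \<Rightarrow> nat set \<Rightarrow> int \<Rightarrow> int \<Rightarrow> nat \<Rightarrow> int" where
  "flat2 i S a b = (\<lambda>l. if l = i then a else if l \<in> S then b else 0)"

text \<open>Differentiating across the line \<open>i\<close> lowers the exponent of \<open>\<alpha>\<^sub>i\<close>, at the cost of raising those of
  the other forms; no step is lost because \<open>\<beta>\<^sub>i\<close> is not an integer.\<close>

lemma lower_exponent:
  assumes S: "S \<subseteq> idx" "\<And>l. l \<in> idx \<Longrightarrow> l \<notin> S \<Longrightarrow> \<beta> l = 0" and i: "i \<in> S" "\<beta> i \<notin> \<int>"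
    and H: "stable H" "A (flat S (int k)) \<in> H"
  shows "\<exists>b. \<forall>p. emb p * A (flat2 i S (int k - int n) (int b)) \<in> H"
proof (induction n)
  case 0
  have "flat2 i S (int k - int 0) (int k) = flat S (int k)" using i by (auto simp: flat2_def flat_def)
  then show ?case using stable_emb[OF H] by metis
next
  case (Suc n)
  then obtain b where b: "\<And>p. emb p * A (flat2 i S (int k - int n) (int b)) \<in> H" by blast
  obtain j c where jc: "pd j (\<alpha> i) = const2 c" "c \<noteq> 0"
    using linear_form_transversal[OF form, of i] i S(1) by blast
  let ?n = "flat2 i S (int k - int n) (int b)"
  let ?G = "prod \<alpha> (S - {i})"
  let ?d = "(\<beta> i + of_int (?n i)) * c"
  have iS: "i \<in> idx" using i S by auto
  obtain s where s: "\<And>q. num S j ?n q = \<alpha> i * (?G * pd j q + q * s) +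
    const2 (\<beta> i + of_int (?n i)) * pd j (\<alpha> i) * q * ?G" using num_split[OF i(1) S(1)] by metis
  have "emb p * A (flat2 i S (int k - int (Suc n)) (int (Suc b))) \<in> H" for p
  proof -
    \<comment> \<open>The numerator carries the extra factor \<open>?G\<close> so that the unwanted
      term of the derivative becomes a multiple of \<open>A ?n\<close>, which the induction
      hypothesis puts into \<open>H\<close> for every numerator.\<close>
    let ?r = "pd j (p * ?G) + p * s"
    have d1: "dD j (emb (p * ?G) * A ?n) = emb (num S j ?n (p * ?G)) * A (dec S ?n)"
      by (rule dD_num[OF S(1)]) (use S(2) i in \<open>auto simp: flat2_def\<close>)
    have d2: "num S j ?n (p * ?G) = \<alpha> i * ?G * ?r + const2 ?d * (p * ?G * ?G)"
      unfolding s jc const2_mult by (simp add: algebra_simps)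
    have d3: "emb (\<alpha> i * ?G) * A (dec S ?n) = A ?n"
      using A_dec[OF S(1), of ?n] i S finite_subset[OF _ finite_idx]
      by (subst (asm) prod.remove[of _ i]) (auto simp: mult.commute)
    have d4: "emb (?G * ?G) * A (dec S ?n) = A (flat2 i S (int k - int (Suc n)) (int (Suc b)))"
    proof -
      have "emb ?G * A (dec S ?n) = A (flat2 i S (int k - int (Suc n)) (int b))"
        by (rule A_shift) (use S i in \<open>auto simp: flat2_def dec_def\<close>)
      moreover have "emb ?G * A (flat2 i S (int k - int (Suc n)) (int b)) =
          A (flat2 i S (int k - int (Suc n)) (int (Suc b)))"
        by (rule A_shift) (use S i in \<open>auto simp: flat2_def\<close>)
      ultimately show ?thesis by (simp add: mult.assoc)
    qed
    have "dD j (emb (p * ?G) * A ?n) = emb (\<alpha> i * ?G * ?r + const2 ?d * (p * ?G * ?G)) * A (dec S ?n)"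
      unfolding d1 d2 ..
    also have "\<dots> = emb ?r * (emb (\<alpha> i * ?G) * A (dec S ?n)) +
        emb (const2 ?d) * (emb p * (emb (?G * ?G) * A (dec S ?n)))"
      by (simp add: algebra_simps)
    finally have "dD j (emb (p * ?G) * A ?n) = emb ?r * A ?n +
        emb (const2 ?d) * (emb p * A (flat2 i S (int k - int (Suc n)) (int (Suc b))))"
      unfolding d3 d4 .
    then have "emb (const2 ?d) * (emb p * A (flat2 i S (int k - int (Suc n)) (int (Suc b)))) \<in> H"
      using subspace_diff[OF stable_subspace[OF H(1)] stable_D[OF H(1) b[of "p * ?G"], of j] b[of ?r]]
      by simp
    moreover have "?d \<noteq> 0"
      using i(2) jc(2) by (auto simp: add_eq_0_iff2)
    ultimately show ?thesis using stable_smult_cancel[OF H(1)] by blast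
  qed
  then show ?case by blast
qed

text \<open>One factor \<open>\<alpha> i\<close> is split off at a time. Powers of a form not
  vanishing on the line pad \<open>g\<close> to the degree that \<open>pt_mod\<close>
  expects.\<close>

lemma mod_power:
  assumes i: "i \<in> idx" and g: "g \<in> hom (of_nat d)" "ev (pt i) g \<noteq> 0"
    and q: "q \<in> irr_pow (d + k + e)"
  shows "\<exists>r s. s \<in> irr_pow e \<and> q = r * g + \<alpha> i ^ k * s"
  using q
proof (induction k arbitrary: q)
  case 0
  have "q = 0 * g + \<alpha> i ^ 0 * q" by simp
  moreover have "q \<in> irr_pow e" using 0 irr_pow_antimono[of e "d + 0 + e"] by auto
  ultimately show ?case by blast
next
  case (Suc k)
  obtain v where v: "linear_form v" "ev (pt i) v \<noteq> 0" using pt_form[OF i] by blast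
  let ?n = "d + Suc k + e"
  have "g * v ^ (Suc k + e) \<in> hom (of_nat ?n)"
    using hom_mult[OF g(1) hom_power[OF hom_linear_form[OF v(1)], of "Suc k + e"]]
    by (simp add: ac_simps)
  then obtain r s where rs: "s \<in> irr_pow (?n - 1)" "q = r * (g * v ^ (Suc k + e)) + \<alpha> i * s"
    using pt_mod[OF i, of "g * v ^ (Suc k + e)" ?n q] g(2) v(2) Suc.prems by auto
  then obtain r' s' where rs': "s' \<in> irr_pow e" "s = r' * g + \<alpha> i ^ k * s'"
    using Suc.IH[of s] by auto
  have "q = (r * v ^ (Suc k + e) + \<alpha> i * r') * g + \<alpha> i ^ Suc k * s'"
    unfolding rs(2) rs'(2) by (simp add: algebra_simps)
  then show ?case using rs'(1) by blast
qed

lemma hom_prod_alpha: "S \<subseteq> idx \<Longrightarrow> prod \<alpha> S \<in> hom (of_nat (card S))"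
  using hom_prod[of S \<alpha> "\<lambda>_. 1"] hom_linear_form[OF form(1)] by auto

text \<open>The products omitting one line each have no common zero outside the origin, as two
  different lines meet only there. The Nullstellensatz is made explicit by enlarging
  \<open>B\<close>: a power of the product over \<open>S - B\<close>, times any \<open>q\<close> of
  high order, lies in \<open>J\<close>; for \<open>B = S\<close> that product is 1.\<close>

lemma irr_pow_subset_of_products:
  assumes J: "poly_ideal J" and S: "S \<subseteq> idx" "S \<noteq> {}"
    and prods: "\<And>i. i \<in> S \<Longrightarrow> \<exists>n. prod \<alpha> (S - {i}) ^ n \<in> J"
  obtains n where "irr_pow n \<subseteq> J"
proof -
  have mult: "r * p \<in> J" if "p \<in> J" for r p using J that by (simp add: poly_ideal_def)
  have add: "p + q \<in> J" if "p \<in> J" "q \<in> J" for p q using J that by (simp add: poly_ideal_def)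
  have fin: "finite S" using S finite_idx finite_subset by blast
  have "\<exists>n e. \<forall>q\<in>irr_pow e. prod \<alpha> (S - B) ^ n * q \<in> J" if "finite B" "B \<noteq> {}" "B \<subseteq> S" for B
    using that
  proof (induction B rule: finite_ne_induct)
    case (singleton i)
    then obtain n where "prod \<alpha> (S - {i}) ^ n \<in> J" using prods by auto
    then show ?case using mult by (metis mult.commute)
  next
    case (insert i B)
    then obtain n e where n: "\<And>q. q \<in> irr_pow e \<Longrightarrow> prod \<alpha> (S - B) ^ n * q \<in> J" by auto
    obtain n' where n': "prod \<alpha> (S - {i}) ^ n' \<in> J" using prods insert.prems by auto
    let ?k = "max n n'" and ?C = "prod \<alpha> (S - insert i B)" and ?g = "prod \<alpha> B ^ max n n'"
    have i: "i \<in> idx" "B \<subseteq> idx" using insert.prems S by auto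
    have g: "?g \<in> hom (of_nat (?k * card B))"
      using hom_power[OF hom_prod_alpha[OF i(2)], of ?k] by simp
    have "ev (pt i) ?g \<noteq> 0" using ev_prod_other[OF i insert.hyps(3)] by simp
    note dec = mod_power[OF i(1) g this]
    have e1: "S - B = insert i (S - insert i B)" and e2: "S - {i} = B \<union> (S - insert i B)"
      using insert.prems insert.hyps(3) by blast+
    have p1: "prod \<alpha> (S - B) = \<alpha> i * ?C"
      unfolding e1 by (rule prod.insert) (use fin in auto)
    have p2: "prod \<alpha> (S - {i}) = prod \<alpha> B * ?C"
      unfolding e2 by (rule prod.union_disjoint) (use fin insert.hyps(1) in auto)
    have "?C ^ ?k * q \<in> J" if q: "q \<in> irr_pow (?k * card B + ?k + e)" for q
    proof -
      \<comment> \<open>The first summand supplies the forms of \<open>B\<close>, so that the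
        product omitting \<open>i\<close> appears; the second supplies a power of
        \<open>\<alpha> i\<close>, so that the induction hypothesis for \<open>B\<close>
        applies.\<close>
      obtain r s where rs: "s \<in> irr_pow e" "q = r * ?g + \<alpha> i ^ ?k * s" using dec[OF q] by blast
      have "prod \<alpha> (S - {i}) ^ ?k = prod \<alpha> (S - {i}) ^ (?k - n') * prod \<alpha> (S - {i}) ^ n'"
        by (simp flip: power_add)
      then have "r * prod \<alpha> (S - {i}) ^ ?k \<in> J" using n' mult by metis
      moreover have "prod \<alpha> (S - B) ^ ?k * s = prod \<alpha> (S - B) ^ (?k - n) * (prod \<alpha> (S - B) ^ n * s)"
        by (simp flip: power_add mult.assoc)
      then have "prod \<alpha> (S - B) ^ ?k * s \<in> J" using n[OF rs(1)] mult by metis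
      moreover have "?C ^ ?k * q = r * prod \<alpha> (S - {i}) ^ ?k + prod \<alpha> (S - B) ^ ?k * s"
        unfolding rs(2) p1 p2 by (simp add: power_mult_distrib algebra_simps)
      ultimately show ?thesis using add by metis
    qed
    then show ?case by blast
  qed
  from this[of S] have "\<exists>n. irr_pow n \<subseteq> J" using fin S by auto
  then show ?thesis using that by blast
qed

text \<open>For \<open>f\<close> of good degree, the ideal carrying \<open>f\<close> into
  \<open>H\<close> contains for each line a power of the product of the other forms: the exponent of
  that line can be lowered arbitrarily inside \<open>H\<close>, and the power compensates the
  others. Hence it contains a power of the irrelevant ideal.\<close>

lemma cogen_subset_nonzero:
  assumes S: "S \<subseteq> idx" "\<And>l. l \<in> idx \<Longrightarrow> l \<notin> S \<Longrightarrow> \<beta> l = 0" "\<And>l. l \<in> S \<Longrightarrow> \<beta> l \<notin> \<int>"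
    and H: "stable H" "H \<subseteq> Mloc S" "H \<noteq> {0}"
  shows "cogen (Mloc S) (boundaries (Mloc S)) \<subseteq> H"
proof (rule cogen_boundaries_least[OF stable_Mloc[OF S(1,2)] H(1)])
  obtain k where k: "A (flat S (int k)) \<in> H"
    using power_of_product_in_stable[OF S(1,2) H] by blast
  fix c assume c: "c \<notin> bad"
  show "Mloc S \<inter> eig c \<subseteq> H"
  proof
    fix f assume f: "f \<in> Mloc S \<inter> eig c"
    then obtain N where "\<And>k. k \<ge> N \<Longrightarrow> \<exists>p. f = emb p * A (flat S (- int k))" using Mloc_flat by blast
    then obtain p where p: "f = emb p * A (flat S (- int N))" by blast
    have "\<exists>n. irr_pow n \<subseteq> {q. emb q * f \<in> H}"
    proof (cases "S = {}")
      case True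
      then have "A (flat S (int k)) = A (flat S (- int N))" by (simp add: flat_def)
      then have "f \<in> H" using p k stable_emb[OF H(1)] by simp
      then have "irr_pow 0 \<subseteq> {q. emb q * f \<in> H}" using stable_emb[OF H(1)] by auto
      then show ?thesis by blast
    next
      case False
      have "\<exists>n. prod \<alpha> (S - {i}) ^ n \<in> {q. emb q * f \<in> H}" if i: "i \<in> S" for i
      proof -
        \<comment> \<open>The exponent of \<open>\<alpha> i\<close> is lowered from \<open>k\<close>
          to \<open>-N\<close>, its value in the representation of \<open>f\<close>.\<close>
        obtain b where b: "\<And>p. emb p * A (flat2 i S (int k - int (k + N)) (int b)) \<in> H"
          using lower_exponent[OF S(1,2) i S(3)[OF i] H(1) k] by blast
        have "emb (prod \<alpha> (S - {i}) ^ n) * A (flat S (- int N)) =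
            A (flat2 i S (- int N) (int n - int N))" for n
        proof (induction n)
          case 0
          have "flat2 i S (- int N) (int 0 - int N) = flat S (- int N)" using i by (auto simp: flat2_def flat_def)
          then show ?case by simp
        next
          case (Suc n)
          have "emb (prod \<alpha> (S - {i})) * A (flat2 i S (- int N) (int n - int N)) =
              A (flat2 i S (- int N) (int (Suc n) - int N))"
            by (rule A_shift) (use S(1) i in \<open>auto simp: flat2_def\<close>)
          then show ?case by (simp only: power_Suc emb_simps mult.assoc Suc)
        qed
        from this[of "N + b"] have "emb (prod \<alpha> (S - {i}) ^ (N + b)) * f =
            emb p * A (flat2 i S (int k - int (k + N)) (int b))"
          unfolding p by (simp add: mult.left_commute del: emb_power)
        then have "prod \<alpha> (S - {i}) ^ (N + b) \<in> {q. emb q * f \<in> H}"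
          using b by (simp del: emb_power)
        then show ?thesis by blast
      qed
      from irr_pow_subset_of_products[OF ideal_stable[OF H(1)] S(1) False this] show ?thesis by blast
    qed
    then show "f \<in> H" using in_stable_of_irr_pow[OF H(1) _ c] f by blast
  qed
qed

lemma cov_bottom:
  assumes S: "S \<subseteq> idx" "\<And>l. l \<in> idx \<Longrightarrow> l \<notin> S \<Longrightarrow> \<beta> l = 0" "\<And>l. l \<in> S \<Longrightarrow> \<beta> l \<notin> \<int>"
  shows "cov {0} (cogen (Mloc S) (boundaries (Mloc S)))"
proof -
  let ?M = "Mloc S" and ?W = "boundaries (Mloc S)"
  note M = stable_Mloc[OF S(1,2)]
  have st: "stable (cogen ?M ?W)" by (rule stable_cogen[OF M subspace_boundaries[OF M] order.refl])
  \<comment> \<open>A power of x1 of good degree witnesses that the bottom submodule is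
    nonzero.\<close>
  obtain n where n: "sum \<beta> idx + of_nat n \<notin> bad" using bad_shift by blast
  have one: "A (\<lambda>l. 0) = 1" by (rule A_0)
  have "emb (var C1 ^ n) * A (\<lambda>l. 0) \<in> ?M \<inter> eig (sum \<beta> idx + of_nat n)"
    using MlocI[of S "\<lambda>l. 0"] hom_power[OF hom_var, of C1 n] by (auto simp: eig_A simp del: emb_power)
  then have "emb (var C1 ^ n) \<in> cogen ?M ?W"
    using cogen_eig[OF stable_subspace[OF M] subspace_boundaries[OF M], of "emb (var C1 ^ n)" "sum \<beta> idx + of_nat n"]
      cogen_part_good[OF n] by (simp add: one)
  moreover have "emb (var C1 ^ n) \<noteq> 0" by (simp add: var.simps)
  ultimately have "cogen ?M ?W \<noteq> {0}" by blast
  moreover have "0 \<in> cogen ?M ?W" by (rule subspace_0[OF stable_subspace[OF st]])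
  moreover have "H = cogen ?M ?W" if "stable H" "H \<subseteq> cogen ?M ?W" "H \<noteq> {0}" for H
    using cogen_subset_nonzero[OF S that(1) _ that(3)] that(2) cogen_subset[OF stable_subspace[OF M]] by blast
  ultimately show ?thesis using st stable_zero unfolding cov_def by blast
qed

subsection \<open>Adding a line\<close>

lemma ev_P:
  assumes "i \<in> idx"
  shows "ev (pt i) (P n) = 0 \<longleftrightarrow> 0 < n i"
proof -
  have "ev (pt i) (P n) = ev (pt i) (\<alpha> i) ^ nat (n i) * (\<Prod>l\<in>idx - {i}. ev (pt i) (\<alpha> l) ^ nat (n l))"
    unfolding P_def ev_prod using finite_idx assms by (subst prod.remove[of _ i]) auto
  moreover have "(\<Prod>l\<in>idx - {i}. ev (pt i) (\<alpha> l) ^ nat (n l)) \<noteq> 0"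
    using finite_idx ev_pt_other[OF assms] by auto
  ultimately show ?thesis using ev_pt[OF assms] by (simp add: zero_power_eq when_def)
qed

lemma hom_P: "P n \<in> hom (of_nat (\<Sum>l\<in>idx. nat (n l)))"
  using hom_prod[of idx "\<lambda>l. \<alpha> l ^ nat (n l)" "\<lambda>l. of_nat (nat (n l)) * 1"]
    hom_power[OF hom_linear_form[OF form(1)]] by (simp add: P_def)

text \<open>Over the common exponents \<open>?d\<close> the two numerators would agree, but at the
  point of the line one of them vanishes and the other does not.\<close>

lemma not_Mloc:
  assumes "i \<in> idx" "i \<notin> S" "n i < 0" "ev (pt i) p \<noteq> 0"
  shows "emb p * A n \<notin> Mloc S"
proof
  assume "emb p * A n \<in> Mloc S"
  then obtain q k where q: "emb p * A n = emb q * A k" "\<forall>l\<in>idx. l \<notin> S \<longrightarrow> 0 \<le> k l"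
    by (auto simp: Mloc_def)
  let ?d = "\<lambda>l. min (n l) (k l)"
  have "emb (p * P (\<lambda>l. n l - ?d l)) * A ?d = emb (q * P (\<lambda>l. k l - ?d l)) * A ?d"
    using q(1) A_lower[of ?d n] A_lower[of ?d k] by (simp add: mult.assoc)
  then have "p * P (\<lambda>l. n l - ?d l) = q * P (\<lambda>l. k l - ?d l)"
    by (simp del: emb_simps(1-6))
  then have "ev (pt i) p * ev (pt i) (P (\<lambda>l. n l - ?d l)) = ev (pt i) q * ev (pt i) (P (\<lambda>l. k l - ?d l))"
    by (metis ev_simps(5))
  moreover have "0 \<le> k i" using q(2) assms by blast
  then have "ev (pt i) (P (\<lambda>l. n l - ?d l)) \<noteq> 0" "ev (pt i) (P (\<lambda>l. k l - ?d l)) = 0"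
    using assms(3) by (subst ev_P[OF assms(1)]; simp)+
  ultimately show False using assms(4) by simp
qed

text \<open>As \<beta>_i = 0, a pole of \<open>h\<close> along the line has nonzero total exponent,
  and a transversal derivative increases its order.\<close>

lemma regular_of_derivatives:
  assumes i: "i \<in> idx" "i \<in> T" "\<beta> i = 0" and h: "h \<in> Mloc T" "h \<in> eig c"
    "\<And>j. dD j h \<in> Mloc (T - {i})"
  shows "h \<in> Mloc (T - {i})"
proof (rule ccontr)
  assume "h \<notin> Mloc (T - {i})"
  then obtain p n where p: "h = emb p * A n" "n i < 0" "ev (pt i) p \<noteq> 0"
    using Mloc_pole[OF i(1,2) h(1,2)] by metis
  obtain j k where k: "pd j (\<alpha> i) = const2 k" "k \<noteq> 0"
    using linear_form_transversal[OF form] i(1) by metis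
  have "dD j h = emb (num idx j n p) * A (dec idx n)"
    unfolding p by (rule dD_num) auto
  moreover have "ev (pt i) (num idx j n p) \<noteq> 0"
    using ev_prod_other[OF i(1), of "idx - {i}"] p k i by (simp add: ev_num)
  then have "emb (num idx j n p) * A (dec idx n) \<notin> Mloc (T - {i})"
    using p(2) i(1) by (intro not_Mloc[of i]) (auto simp: dec_def)
  ultimately show False using h(3)[of j] by simp
qed

text \<open>A line of \<open>S\<close> is available as denominator: writing \<open>h\<close> as
  \<open>\<alpha> l\<close> times \<open>g\<close> gives \<open>g\<close> in degree -1 without
  leaving \<open>Mloc S\<close>, and the coefficients of \<open>\<alpha> l\<close> provide the two
  elements to differentiate.\<close>

lemma potential_boundary:
  assumes S: "S \<subseteq> idx" "S \<noteq> {}" "\<And>l. l \<in> idx \<Longrightarrow> l \<notin> S \<Longrightarrow> \<beta> l = 0"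
    and h: "h \<in> Mloc S" "h \<in> eig 0"
  obtains f where "f \<in> boundaries (Mloc S)" "dD C1 h = dX C2 f" "dD C2 h = - dX C1 f"
proof -
  obtain l where l: "l \<in> S" "l \<in> idx" using S by blast
  obtain p n where p: "h = emb p * A n" "\<forall>l\<in>idx. l \<notin> S \<longrightarrow> 0 \<le> n l" using h(1) by (auto simp: Mloc_def)
  let ?k = "dec {l} n"
  define g where "g = emb p * A ?k"
  have hg: "h = emb (\<alpha> l) * g"
    using A_dec[of "{l}" n] l by (simp add: g_def p mult_ac)
  have g: "g \<in> Mloc S" unfolding g_def by (rule MlocI) (use p l in \<open>auto simp: dec_def\<close>)
  have "sum ?k idx = sum n (idx - {l}) + (n l - 1)"
    using l(2) finite_idx by (subst sum.remove[of _ l]) (auto simp: dec_def intro: sum.cong)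
  also have "\<dots> = sum n idx - 1" using l(2) finite_idx by (subst (2) sum.remove[of _ l]) auto
  finally have sum: "sum ?k idx = sum n idx - 1" .
  have "g \<in> eig (- 1)" using h(2) unfolding g_def p eig_A sum by (simp add: algebra_simps)
  obtain a b where ab: "\<alpha> l = const2 a * var C1 + const2 b * var C2"
    using form(1)[OF l(2)] by (auto simp: linear_form_def)
  let ?f = "dD C1 (cscale b g) - dD C2 (cscale a g)"
  have "h = cscale a (dX C1 g) + cscale b (dX C2 g)"
    by (simp add: hg ab cscale_def dX_eq distrib_right mult.assoc)
  then have f1: "dD C1 h = dX C2 ?f" using X2_boundary[OF \<open>g \<in> eig (- 1)\<close>, of b a] by simp
  \<comment> \<open>The second equation follows from the first and \<open>eul h = 0\<close>, since
    multiplication by x2 is injective.\<close>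
  have "dX C2 (dX C1 ?f + dD C2 h) = eul h"
    by (simp add: eul_def X_add f1 X_X[of C2 C1])
  then have "dX C2 (dX C1 ?f + dD C2 h) = 0" using h(2) by (simp add: eig_def)
  then have "dX C1 ?f + dD C2 h = 0" by (simp only: dX_eq mult_eq_0_iff) (simp add: var.simps)
  then have f2: "dD C2 h = - dX C1 ?f" by (simp only: eq_neg_iff_add_eq_0 add.commute)
  note M = stable_Mloc[OF S(1,3)]
  have "cscale b g \<in> Mloc S" "cscale b g \<in> eig (- 1)" "cscale a g \<in> Mloc S" "cscale a g \<in> eig (- 1)"
    using g \<open>g \<in> eig (- 1)\<close> by (auto intro: subspace_scale subspace_Mloc subspace_eig)
  then have "?f \<in> boundaries (Mloc S)"
    using D_boundaries[OF M] by (intro subspace_diff subspace_boundaries M) auto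
  with f1 f2 show ?thesis using that by blast
qed

lemma boundary_of_potential:
  assumes S: "S \<subseteq> idx" "S \<noteq> {}" "\<And>l. l \<in> idx \<Longrightarrow> l \<notin> S \<Longrightarrow> \<beta> l = 0"
    and h: "h \<in> Mloc S" "h \<in> eig 0" and f: "dD C1 h = dX C2 f"
  shows "f \<in> boundaries (Mloc S)"
proof -
  obtain g where g: "g \<in> boundaries (Mloc S)" "dD C1 h = dX C2 g"
    using potential_boundary[OF S h] by blast
  then have "f = g" using f by (simp add: dX_eq var.simps)
  with g show ?thesis by simp
qed

text \<open>Allowing poles along a new line must not turn further elements of the old module into
  boundaries. A potential with a pole there would show it in its derivatives, so the potential
  belongs to the old module.\<close>

lemma boundaries_Int:
  assumes T: "T \<subseteq> idx" "i \<in> T" "\<beta> i = 0" "\<And>l. l \<in> idx \<Longrightarrow> l \<notin> T \<Longrightarrow> \<beta> l = 0"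
  shows "boundaries (Mloc T) \<inter> Mloc (T - {i}) \<subseteq> boundaries (Mloc (T - {i}))"
proof
  let ?S = "T - {i}"
  have S: "?S \<subseteq> idx" "\<And>l. l \<in> idx \<Longrightarrow> l \<notin> ?S \<Longrightarrow> \<beta> l = 0" using T by auto
  note MT = stable_Mloc[OF T(1,4)] and MS = stable_Mloc[OF S]
  fix f assume f: "f \<in> boundaries (Mloc T) \<inter> Mloc ?S"
  show "f \<in> boundaries (Mloc ?S)"
  proof (cases "?S = {}")
    case False
    obtain h where h: "h \<in> Mloc T" "h \<in> eig 0" "dD C1 h = dX C2 f" "dD C2 h = - dX C1 f"
      using boundary_potential[OF MT] f by blast
    have "dD j h \<in> Mloc ?S" for j
      using h(3,4) f stable_X[OF MS] by (cases j) (auto intro: subspace_neg subspace_Mloc)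
    then have "h \<in> Mloc ?S" using regular_of_derivatives[OF _ T(2,3) h(1,2)] T by blast
    then show ?thesis using boundary_of_potential[OF S(1) False S(2) _ h(2,3)] by blast
  next
    \<comment> \<open>With no line left there is nothing to divide by in
      \<open>potential_boundary\<close>; but this module is the polynomial ring, and its degree -2
      part is zero.\<close>
    case True
    obtain p n where p: "f = emb p * A n" "\<forall>l\<in>idx. 0 \<le> n l" using f True by (auto simp: Mloc_def)
    then have "f = emb (p * P n) * A (\<lambda>l. 0)" using A_P[of n] by (simp add: A_0)
    moreover have "f \<in> eig (- 2)" using boundaries_subset[OF MT] f by blast
    moreover have "sum \<beta> idx = 0" using S(2) True by (intro sum.neutral) auto
    ultimately have "p * P n \<in> hom (- 2)" by (simp add: eig_A del: emb_simps)
    moreover have "of_nat e \<noteq> (- 2 :: complex)" for e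
    proof
      assume "of_nat e = (- 2 :: complex)"
      then have "of_nat (e + 2) = (0 :: complex)" by simp
      then show False unfolding of_nat_eq_0_iff by simp
    qed
    ultimately have "p * P n = 0" using hom_nonzero by metis
    then have "f = 0" using P_nonzero[of n] p(1) by simp
    then show ?thesis using subspace_0[OF subspace_boundaries[OF MS]] by simp
  qed
qed

text \<open>The powers of the forms in \<open>P k\<close> reduce the pole along the line to order
  one and clear all other poles; the numerator stays nonzero at \<open>pt i\<close>.\<close>

lemma simple_pole_in_stable:
  assumes T: "T \<subseteq> idx" "i \<in> T" and H: "stable H" and g: "g \<in> H" "g \<in> Mloc T" "g \<in> eig c" "g \<notin> Mloc (T - {i})"
  obtains p e where "emb p * A (flat {i} (- 1)) \<in> H" "p \<in> hom (of_nat e)" "ev (pt i) p \<noteq> 0"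
proof -
  have i: "i \<in> idx" using T by blast
  obtain p n where p: "g = emb p * A n" "\<And>l. l \<in> idx \<Longrightarrow> l \<notin> T \<Longrightarrow> 0 \<le> n l" "n i < 0" "ev (pt i) p \<noteq> 0"
    using Mloc_pole[OF i T(2) g(2,3,4)] by metis
  define k where "k = (\<lambda>l. if l = i then - n i - 1 else \<bar>n l\<bar>)"
  define k' where "k' = (\<lambda>l. if l = i then 0 else n l + \<bar>n l\<bar>)"
  have "emb (P k) * A n = A k * A n" using A_P[of k] p(3) by (simp add: k_def)
  also have "\<dots> = A (\<lambda>l. k' l + flat {i} (- 1) l)"
    unfolding A_add[symmetric] by (rule A_cong) (auto simp: k_def k'_def flat_def)
  also have "\<dots> = emb (P k') * A (flat {i} (- 1))"
    unfolding A_add by (subst A_P[of k']) (auto simp: k'_def)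
  finally have "emb (P k) * g = emb (p * P k') * A (flat {i} (- 1))"
    unfolding p by (simp add: mult.left_commute)
  moreover have "emb (P k) * g \<in> H" by (rule stable_emb[OF H g(1)])
  moreover have "p \<noteq> 0" using p(4) by auto
  then obtain e where "p \<in> hom (of_nat e)" using g(3) hom_nonzero unfolding p eig_A by metis
  then have "p * P k' \<in> hom (of_nat (e + (\<Sum>l\<in>idx. nat (k' l))))"
    using hom_mult[OF _ hom_P] by simp
  moreover have "ev (pt i) (p * P k') \<noteq> 0" using p(4) ev_P[OF i, of k'] by (simp add: k'_def)
  ultimately show ?thesis using that by metis
qed

text \<open>By induction on the pole order along line \<open>i\<close>, each fraction with poles
  along \<open>T\<close> is carried into \<open>H\<close> by a power of the irrelevant ideal. In
  good degrees this suffices for membership.\<close>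

lemma good_subset_of_pole:
  assumes T: "T \<subseteq> idx" "i \<in> T" "\<beta> i = 0" "\<And>l. l \<in> idx \<Longrightarrow> l \<notin> T \<Longrightarrow> \<beta> l = 0"
    and H: "stable H" "\<And>c. c \<notin> bad \<Longrightarrow> Mloc (T - {i}) \<inter> eig c \<subseteq> H"
    and p: "emb p * A (flat {i} (- 1)) \<in> H" "p \<in> hom (of_nat e)" "ev (pt i) p \<noteq> 0"
    and c: "c \<notin> bad"
  shows "Mloc T \<inter> eig c \<subseteq> H"
proof -
  let ?S = "T - {i}"
  have S: "?S \<subseteq> idx" "\<And>l. l \<in> idx \<Longrightarrow> l \<notin> ?S \<Longrightarrow> \<beta> l = 0" using T by auto
  have i: "i \<in> idx" using T by blast
  let ?A = "\<lambda>a b. A (flat2 i ?S (- int a) (- int b))"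
  have claim: "\<exists>d. \<forall>q\<in>irr_pow d. emb q * ?A (Suc a) b \<in> H" for a b
  proof (induction a arbitrary: b)
    case 0
    have "A (flat ?S (- int b)) \<in> Mloc ?S"
    proof -
      have "emb 1 * A (flat ?S (- int b)) \<in> Mloc ?S" by (rule MlocI) (auto simp: flat_def)
      then show ?thesis by simp
    qed
    moreover have "A (flat ?S (- int b)) \<in> eig (sum \<beta> idx + of_int (sum (flat ?S (- int b)) idx))"
      using eig_A[of 1 "flat ?S (- int b)" "sum \<beta> idx + of_int (sum (flat ?S (- int b)) idx)"] hom_one by simp
    ultimately obtain d where d: "\<And>q. q \<in> irr_pow d \<Longrightarrow> emb q * A (flat ?S (- int b)) \<in> H"
      using irr_pow_in_stable[OF stable_Mloc[OF S] H] by metis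
    obtain v where v: "linear_form v" "ev (pt i) v \<noteq> 0" using pt_form[OF i] by blast
    define B where "B = prod \<alpha> ?S"
    have hB: "B \<in> hom (of_nat (card ?S))" unfolding B_def by (rule hom_prod_alpha[OF S(1)])
    have evB: "ev (pt i) B \<noteq> 0" unfolding B_def using ev_prod_other[OF i S(1)] by simp
    have AB: "emb (B ^ k) * ?A 1 k = A (flat {i} (- 1))" for k
    proof (induction k)
      case 0
      have "flat2 i ?S (- int 1) (- int 0) = flat {i} (- 1)" by (auto simp: flat2_def flat_def)
      then show ?case by simp
    next
      case (Suc k)
      have "emb B * ?A 1 (Suc k) = ?A 1 k"
        unfolding B_def by (rule A_shift[OF S(1)]) (auto simp: flat2_def)
      then show ?case using Suc by (simp add: power_Suc2 mult.assoc del: power_Suc)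
    qed
    have Ai: "emb (\<alpha> i) * ?A 1 b = A (flat ?S (- int b))"
      by (rule A_shift1[OF i]) (auto simp: flat2_def flat_def)
    \<comment> \<open>The factor \<open>v ^ Suc d\<close> raises the degree enough for the cofactor
      of \<open>\<alpha> i\<close> to lie in \<open>irr_pow d\<close>, which carries the part
      without pole along \<open>i\<close> into \<open>H\<close>.\<close>
    let ?n = "e + b * card ?S + Suc d"
    have "p * B ^ b * v ^ Suc d \<in> hom (of_nat ?n)"
      using hom_mult[OF hom_mult[OF p(2) hom_power[OF hB, of b]] hom_power[OF hom_linear_form[OF v(1)], of "Suc d"]]
      by (simp add: ac_simps)
    then have mod: "\<exists>r s. s \<in> irr_pow (?n - 1) \<and> q = r * (p * B ^ b * v ^ Suc d) + \<alpha> i * s"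
      if "q \<in> irr_pow ?n" for q
      using pt_mod[OF i _ _ that, of "p * B ^ b * v ^ Suc d"] p(3) v(2) evB by simp
    have "emb q * ?A (Suc 0) b \<in> H" if q: "q \<in> irr_pow ?n" for q
    proof -
      obtain r s where rs: "s \<in> irr_pow (?n - 1)" "q = r * (p * B ^ b * v ^ Suc d) + \<alpha> i * s"
        using mod[OF q] by blast
      have ring: "(r * (p * B * v) + a * s) * A = r * v * (p * (B * A)) + s * (a * A)"
        for r p B v a s A :: ratfun2 by (simp add: algebra_simps)
      have "emb q * ?A 1 b = emb (r * v ^ Suc d) * (emb p * A (flat {i} (- 1))) + emb s * A (flat ?S (- int b))"
        unfolding rs(2) emb_simps AB[of b, symmetric] Ai[symmetric] by (rule ring)
      moreover have "emb (r * v ^ Suc d) * (emb p * A (flat {i} (- 1))) \<in> H" by (rule stable_emb[OF H(1) p(1)])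
      moreover have "s \<in> irr_pow d" using rs(1) irr_pow_antimono[of d "?n - 1"] by auto
      then have "emb s * A (flat ?S (- int b)) \<in> H" by (rule d)
      ultimately show ?thesis using subspace_add[OF stable_subspace[OF H(1)]] by simp
    qed
    then show ?case by blast
  next
    case (Suc a)
    obtain d1 where d1: "\<And>q. q \<in> irr_pow d1 \<Longrightarrow> emb q * ?A (Suc a) b \<in> H" using Suc by blast
    obtain d2 where d2: "\<And>q. q \<in> irr_pow d2 \<Longrightarrow> emb q * ?A (Suc a) (Suc b) \<in> H" using Suc by blast
    obtain j k where k: "pd j (\<alpha> i) = const2 k" "k \<noteq> 0"
      using linear_form_transversal[OF form] i by metis
    let ?n = "flat2 i ?S (- int (Suc a)) (- int b)"
    let ?G = "prod \<alpha> ?S"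
    let ?k = "(\<beta> i + of_int (?n i)) * k"
    obtain s where s: "\<And>q. num T j ?n q = \<alpha> i * (?G * pd j q + q * s) +
      const2 (\<beta> i + of_int (?n i)) * pd j (\<alpha> i) * q * ?G" using num_split[OF T(2,1)] by metis
    \<comment> \<open>\<open>Suc d2\<close> rather than \<open>d2\<close>, because differentiating
      \<open>q\<close> costs one order of vanishing.\<close>
    have "emb q * ?A (Suc (Suc a)) b \<in> H" if q: "q \<in> irr_pow (max d1 (Suc d2))" for q
    proof -
      have q1: "q \<in> irr_pow d1" and q2: "q \<in> irr_pow (Suc d2)"
        using q irr_pow_antimono[of d1 "max d1 (Suc d2)"] irr_pow_antimono[of "Suc d2" "max d1 (Suc d2)"]
        by (auto simp del: irr_pow.simps)
      let ?r = "?G * pd j q + q * s"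
      have r: "?r \<in> irr_pow d2"
        using irr_pow_mult[OF irr_pow_pd[OF q2, of j], of ?G] irr_pow_mult[of q d2 s] q2 irr_pow_Suc_subset[of d2]
        by (auto simp: mult.commute simp del: irr_pow.simps intro!: irr_pow_add)
      have d1': "dD j (emb q * A ?n) = emb (num T j ?n q) * A (dec T ?n)"
        by (rule dD_num[OF T(1)]) (use T in \<open>auto simp: flat2_def\<close>)
      have d3: "emb (\<alpha> i) * A (dec T ?n) = ?A (Suc a) (Suc b)"
        by (rule A_shift1[OF i]) (use T in \<open>auto simp: flat2_def dec_def\<close>)
      have d4: "emb ?G * A (dec T ?n) = ?A (Suc (Suc a)) b"
        by (rule A_shift[OF S(1)]) (use T in \<open>auto simp: flat2_def dec_def\<close>)
      have ring: "(a * r + c * p * q * g) * x = r * (a * x) + c * p * (q * (g * x))" for a r c p q g x :: ratfun2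
        by (simp add: algebra_simps)
      have "dD j (emb q * A ?n) = emb ?r * (emb (\<alpha> i) * A (dec T ?n)) +
          emb (const2 (\<beta> i + of_int (?n i))) * emb (const2 k) * (emb q * (emb ?G * A (dec T ?n)))"
        unfolding d1' s k emb_simps(6)[of "\<alpha> i"] emb_simps(3)[of "\<alpha> i * _"] emb_simps(6)[of _ ?G]
          emb_simps(6)[of _ q] emb_simps(6)[of _ "const2 k"] by (rule ring)
      also have "\<dots> = emb ?r * ?A (Suc a) (Suc b) + emb (const2 ?k) * (emb q * ?A (Suc (Suc a)) b)"
        unfolding d3 d4 const2_mult emb_simps(6) ..
      finally have eq: "dD j (emb q * A ?n) = emb ?r * ?A (Suc a) (Suc b) + emb (const2 ?k) * (emb q * ?A (Suc (Suc a)) b)" .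
      have "dD j (emb q * A ?n) - emb ?r * ?A (Suc a) (Suc b) \<in> H"
        by (intro subspace_diff stable_subspace stable_D H(1) d1[OF q1] d2[OF r])
      then have "emb (const2 ?k) * (emb q * ?A (Suc (Suc a)) b) \<in> H"
        unfolding eq by simp
      moreover have "of_int (?n i) \<noteq> (0 :: complex)" unfolding of_int_eq_0_iff by (simp add: flat2_def)
      then have "?k \<noteq> 0" using k T(3) by simp
      ultimately show ?thesis using stable_smult_cancel[OF H(1)] by blast
    qed
    then show ?case by blast
  qed
  show ?thesis
  proof
    fix f assume f: "f \<in> Mloc T \<inter> eig c"
    then obtain N where N: "\<And>k. k \<ge> N \<Longrightarrow> \<exists>q. f = emb q * A (flat T (- int k))" using Mloc_flat by blast
    obtain q where q: "f = emb q * A (flat T (- int (Suc N)))" using N[of "Suc N"] by auto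
    have "flat T (- int (Suc N)) = flat2 i ?S (- int (Suc N)) (- int (Suc N))"
      using T(2) by (auto simp: flat_def flat2_def)
    then have q': "f = emb q * ?A (Suc N) (Suc N)" using q by simp
    obtain d where d: "\<And>r. r \<in> irr_pow d \<Longrightarrow> emb r * ?A (Suc N) (Suc N) \<in> H" using claim by blast
    have "emb r * f \<in> H" if "r \<in> irr_pow d" for r
    proof -
      have "emb (q * r) * ?A (Suc N) (Suc N) \<in> H" by (rule d[OF irr_pow_mult[OF that]])
      then show ?thesis by (simp add: q' mult_ac)
    qed
    then show "f \<in> H" using in_stable_of_irr_pow[OF H(1) _ c] f by blast
  qed
qed

text \<open>An intermediate \<open>H\<close> without poles along the new line adds nothing, since
  its elements are moved into old boundaries by \<open>boundaries_Int\<close>. One with such a pole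
  contains all good degrees of \<open>Mloc T\<close>.\<close>

lemma cov_add_line:
  assumes T: "T \<subseteq> idx" "i \<in> T" "\<beta> i = 0" "\<And>l. l \<in> idx \<Longrightarrow> l \<notin> T \<Longrightarrow> \<beta> l = 0"
  shows "cov (cogen (Mloc (T - {i})) (boundaries (Mloc (T - {i})))) (cogen (Mloc T) (boundaries (Mloc T)))"
proof -
  let ?S = "T - {i}"
  let ?MS = "Mloc ?S" and ?MT = "Mloc T"
  let ?BS = "boundaries ?MS" and ?BT = "boundaries ?MT"
  have S: "?S \<subseteq> idx" "\<And>l. l \<in> idx \<Longrightarrow> l \<notin> ?S \<Longrightarrow> \<beta> l = 0" using T by auto
  have i: "i \<in> idx" using T by blast
  note MT = stable_Mloc[OF T(1,4)] and MS = stable_Mloc[OF S]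
  note sMT = stable_subspace[OF MT] and sMS = stable_subspace[OF MS]
  have sub: "?MS \<subseteq> ?MT" by (rule Mloc_mono) auto
  have stS: "stable (cogen ?MS ?BS)" by (rule stable_cogen[OF MS subspace_boundaries[OF MS] order.refl])
  have stT: "stable (cogen ?MT ?BT)" by (rule stable_cogen[OF MT subspace_boundaries[OF MT] order.refl])
  have le: "cogen ?MS ?BS \<subseteq> cogen ?MT ?BT" by (intro cogen_mono boundaries_mono sub)
  have goodS: "?MS \<inter> eig c \<subseteq> cogen ?MS ?BS" if "c \<notin> bad" for c
    using cogen_eig[OF sMS subspace_boundaries[OF MS]] cogen_part_good[OF that] by blast
  have goodT: "?MT \<inter> eig c \<subseteq> cogen ?MT ?BT" if "c \<notin> bad" for c
    using cogen_eig[OF sMT subspace_boundaries[OF MT]] cogen_part_good[OF that] by blast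
  have ne: "cogen ?MS ?BS \<noteq> cogen ?MT ?BT"
  proof -
    obtain v where v: "linear_form v" "ev (pt i) v \<noteq> 0" using pt_form[OF i] by blast
    \<comment> \<open>The fraction v^n / \<alpha>_i separates the two submodules once
      \<open>n\<close> makes its degree good.\<close>
    obtain n where n: "sum \<beta> idx + of_int (sum (flat {i} (- 1)) idx) + of_nat n \<notin> bad" using bad_shift by blast
    let ?g = "emb (v ^ n) * A (flat {i} (- 1))"
    have "?g \<in> eig (sum \<beta> idx + of_int (sum (flat {i} (- 1)) idx) + of_nat n)"
      unfolding eig_A using hom_power[OF hom_linear_form[OF v(1)], of n] by simp
    moreover have "?g \<in> ?MT" by (rule MlocI) (use T in \<open>auto simp: flat_def\<close>)
    ultimately have "?g \<in> cogen ?MT ?BT" using goodT[OF n] by blast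
    moreover have "?g \<notin> ?MS" by (rule not_Mloc[OF i]) (use v in \<open>auto simp: flat_def\<close>)
    ultimately show ?thesis using cogen_subset[OF sMS, of ?BS] by blast
  qed
  have "H = cogen ?MS ?BS \<or> H = cogen ?MT ?BT"
    if H: "stable H" "cogen ?MS ?BS \<subseteq> H" "H \<subseteq> cogen ?MT ?BT" for H
  proof (cases "H \<subseteq> ?MS")
    case True
    have "H \<subseteq> cogen ?MS ?BS"
    proof (rule ccontr)
      assume "\<not> H \<subseteq> cogen ?MS ?BS"
      then obtain f where f: "f \<in> H" "f \<notin> cogen ?MS ?BS" by blast
      then obtain c g where g: "g \<in> H" "g \<in> eig c" "g \<notin> cogen ?MS ?BS"
        using graded_component[OF graded_Mloc sMS H(1) f(1) _ f(2) stable_subspace[OF stS]] True by blast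
      have "g \<in> cogen_part ?MT ?BT c"
        using cogen_eig[OF sMT subspace_boundaries[OF MT] g(2)] g(1) H(3) by blast
      then have "mon a b g \<in> ?BS" if "c + of_nat a + of_nat b = - 2" for a b
        using boundaries_Int[OF T] stable_mon[OF H(1) g(1), of a b] True that
        by (auto simp: cogen_part_def)
      then have "g \<in> cogen_part ?MS ?BS c" using g True by (auto simp: cogen_part_def)
      then show False using cogen_eig[OF sMS subspace_boundaries[OF MS] g(2)] g(3) by blast
    qed
    then show ?thesis using H(2) by blast
  next
    case False
    then obtain f where f: "f \<in> H" "f \<notin> ?MS" by blast
    have HM: "H \<subseteq> ?MT" using H(3) cogen_subset[OF sMT] by blast
    obtain c g where g: "g \<in> H" "g \<in> ?MT" "g \<in> eig c" "g \<notin> ?MS"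
      using graded_component[OF graded_Mloc sMT H(1) f(1) _ f(2) sMS] HM f(1) by blast
    obtain p e where p: "emb p * A (flat {i} (- 1)) \<in> H" "p \<in> hom (of_nat e)" "ev (pt i) p \<noteq> 0"
      using simple_pole_in_stable[OF T(1,2) H(1) g] by metis
    have "?MT \<inter> eig c \<subseteq> H" if "c \<notin> bad" for c
    proof (rule good_subset_of_pole[OF T H(1) _ p that])
      show "?MS \<inter> eig c \<subseteq> H" if "c \<notin> bad" for c using goodS[OF that] H(2) by blast
    qed
    from cogen_boundaries_least[OF MT H(1) this] have "cogen ?MT ?BT \<subseteq> H" .
    then show ?thesis using H(3) by blast
  qed
  then show ?thesis using stS stT le ne by (auto simp: cov_def)
qed

end

section \<open>Monomial bases of spaces of homogeneous polynomials\<close>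

lemma monomial_eq: "var C1 ^ a * var C2 ^ b = monom (monom 1 a) b"
proof -
  have "var C1 ^ a = [:monom 1 a:]" by (induction a) (simp_all add: var.simps monom_Suc one_pCons monom_0)
  moreover have "var C2 ^ b = monom 1 b" by (induction b) (simp_all add: var.simps monom_Suc)
  ultimately show ?thesis by (simp add: smult_monom)
qed

lemma coeff_monomial: "coeff (coeff (var C1 ^ a * var C2 ^ b) j) i = (if a = i \<and> b = j then 1 else 0)"
  by (simp add: monomial_eq)

lemma coeff_monomial_sum:
  "coeff (coeff (\<Sum>a\<le>e. const2 (u a) * (var C1 ^ a * var C2 ^ (e - a))) j) i = (if i \<le> e \<and> e - i = j then u i else 0)"
proof -
  have "coeff (coeff (\<Sum>a\<le>e. const2 (u a) * (var C1 ^ a * var C2 ^ (e - a))) j) i =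
      (\<Sum>a\<le>e. if a = i then (if e - i = j then u i else 0) else 0)"
    unfolding coeff_sum coeff_const2_mult coeff_monomial by (rule sum.cong) auto
  then show ?thesis by simp
qed

lemma hom_monomial_sum:
  assumes "p \<in> hom (of_nat e)"
  shows "p = (\<Sum>a\<le>e. const2 (coeff (coeff p (e - a)) a) * (var C1 ^ a * var C2 ^ (e - a)))"
proof (intro poly_eqI)
  fix j i
  show "coeff (coeff p j) i =
    coeff (coeff (\<Sum>a\<le>e. const2 (coeff (coeff p (e - a)) a) * (var C1 ^ a * var C2 ^ (e - a))) j) i"
    unfolding coeff_monomial_sum
  proof (cases "coeff (coeff p j) i = 0")
    case False
    then have "of_nat (i + j) = (of_nat e :: complex)" using assms by (auto simp: hom_iff)
    then have "i + j = e" by (simp only: of_nat_eq_iff)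
    then show "coeff (coeff p j) i = (if i \<le> e \<and> e - i = j then coeff (coeff p (e - i)) i else 0)" by auto
  qed auto
qed

lemma ev_minus: "ev z (- p) = - ev z p"
  by (simp add: ev_def)

lemma var_C2_dvd:
  assumes "var C1 * p = var C2 * q"
  obtains r where "p = var C2 * r"
proof -
  obtain c s where p: "p = pCons c s" by (cases p)
  have "[:0, 1:] * c = 0" using arg_cong[OF assms, of "\<lambda>r. coeff r 0"] by (simp add: p var.simps)
  then have "p = var C2 * s" by (simp add: p var.simps)
  then show ?thesis using that by blast
qed

context line_arrangement
begin

subsection \<open>The part of degree -2\<close>

text \<open>The two equations give a syzygy between the numerators of the derivatives, so these are
  x2 \<open>w\<close> and -x1 \<open>w\<close> for one \<open>w\<close>. The numerator transversal
  to line \<open>i\<close> does not vanish at its point, hence neither does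
  \<open>w\<close>.\<close>

lemma boundary_numerator:
  assumes h: "emb q * A n \<in> eig 0"
    and f: "dD C1 (emb q * A n) = dX C2 f" "dD C2 (emb q * A n) = - dX C1 f"
  obtains w where "f = emb w * A (dec idx n)"
    "\<And>i. i \<in> idx \<Longrightarrow> ev (pt i) q \<noteq> 0 \<Longrightarrow> \<beta> i + of_int (n i) \<noteq> 0 \<Longrightarrow> ev (pt i) w \<noteq> 0"
proof -
  let ?n1 = "num idx C1 n q" and ?n2 = "num idx C2 n q" and ?A = "A (dec idx n)"
  have D: "dD j (emb q * A n) = emb (num idx j n q) * ?A" for j
    by (rule dD_num) auto
  have e1: "emb (var C2) * f = emb ?n1 * ?A" and e2: "emb (var C1) * f = - (emb ?n2 * ?A)"
    using f by (simp_all add: D dX_eq)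
  have "emb (var C1) * (emb ?n1 * ?A) = emb (var C2) * (- (emb ?n2 * ?A))"
    unfolding e1[symmetric] e2[symmetric] by (rule mult.left_commute)
  then have "emb (var C1 * ?n1) * ?A = emb (var C2 * - ?n2) * ?A" by (simp add: mult.assoc)
  then have eq: "var C1 * ?n1 = var C2 * - ?n2" by (simp only: mult_cancel_right A_nonzero emb_simps(7)) simp
  then obtain w where w: "?n1 = var C2 * w" using var_C2_dvd by blast
  then have "emb (var C2) * f = emb (var C2) * (emb w * ?A)" using e1 by (simp add: mult.assoc)
  then have fw: "f = emb w * ?A" by (simp add: var.simps)
  have "var C2 * (var C1 * w) = var C2 * - ?n2" using eq w by (simp add: mult.left_commute)
  moreover have "var C2 \<noteq> 0" by (simp add: var.simps)
  ultimately have "var C1 * w = - ?n2" using mult_left_cancel[of "var C2"] by blast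
  then have n2: "?n2 = - (var C1 * w)" by simp
  have "ev (pt i) w \<noteq> 0" if i: "i \<in> idx" "ev (pt i) q \<noteq> 0" "\<beta> i + of_int (n i) \<noteq> 0" for i
  proof -
    obtain j k where k: "pd j (\<alpha> i) = const2 k" "k \<noteq> 0"
      using linear_form_transversal[OF form] i(1) by metis
    have "ev (pt i) (num idx j n q) \<noteq> 0"
      using ev_prod_other[OF i(1), of "idx - {i}"] k i by (simp add: ev_num)
    then show ?thesis using w n2 by (cases j) (auto simp: ev_minus)
  qed
  with fw show ?thesis using that by blast
qed

end

section \<open>Exponents with sum 0: the factors supported at the origin\<close>

locale integral_arrangement = line_arrangement +
  assumes sum_0: "sum \<beta> idx = 0" and int_0: "\<And>i. i \<in> idx \<Longrightarrow> \<beta> i \<in> \<int> \<Longrightarrow> \<beta> i = 0" and m: "m \<ge> 1"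
begin

abbreviation "M \<equiv> Mloc idx"

lemma idx_nonempty: "idx \<noteq> {}" using m by (auto simp: idx_def)

lemma stable_M: "stable M" by (rule stable_Mloc) auto

lemma exponent_nonzero: "i \<in> idx \<Longrightarrow> n \<noteq> 0 \<Longrightarrow> \<beta> i + of_int n \<noteq> 0"
  using int_0[of i] by (metis Ints_minus Ints_of_int add.left_neutral add_eq_0_iff2 of_int_eq_0_iff)

definition simple_poles :: "ratfun2 set" where
  "simple_poles = {f \<in> eig (- 2). \<exists>p. f = emb p * A (\<lambda>_. - 1)}"

lemma simple_poles_subset: "simple_poles \<subseteq> M \<inter> eig (- 2)"
  using MlocI[of idx "\<lambda>_. - 1"] by (auto simp: simple_poles_def)

lemma subspace_simple_poles: "subspace simple_poles"
proof (rule subspaceI)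
  show "0 \<in> simple_poles"
    using subspace_0[OF subspace_eig] by (auto simp: simple_poles_def intro!: exI[of _ 0])
next
  fix g g' assume gg: "g \<in> simple_poles" "g' \<in> simple_poles"
  then obtain p q where p: "g = emb p * A (\<lambda>_. - 1)" "g \<in> eig (- 2)" "g' = emb q * A (\<lambda>_. - 1)" "g' \<in> eig (- 2)"
    by (auto simp: simple_poles_def)
  have "g + g' = emb (p + q) * A (\<lambda>_. - 1)" by (simp add: p algebra_simps)
  then show "g + g' \<in> simple_poles" using p subspace_add[OF subspace_eig] unfolding simple_poles_def by blast
next
  fix c g assume "g \<in> simple_poles"
  then obtain p where p: "g = emb p * A (\<lambda>_. - 1)" "g \<in> eig (- 2)" by (auto simp: simple_poles_def)
  have "cscale c g = emb (const2 c * p) * A (\<lambda>_. - 1)" by (simp add: p cscale_def)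
  then show "cscale c g \<in> simple_poles" using p(2) subspace_scale[OF subspace_eig] unfolding simple_poles_def by blast
qed

text \<open>If the pole along a line has order at least 2, a boundary with the same pole orders and
  a numerator nonzero at \<open>pt i\<close> is available; subtracting a multiple of it makes the
  numerator divisible by \<open>\<alpha> i\<close>.\<close>

lemma reduce_poles:
  assumes "f \<in> eig (- 2)" "f = emb p * A n" "\<And>l. l \<in> idx \<Longrightarrow> n l \<le> - 1"
  shows "f \<in> span (boundaries M \<union> simple_poles)"
  using assms
proof (induction "\<Sum>l\<in>idx. nat (- 1 - n l)" arbitrary: f p n)
  case 0
  then have "nat (- 1 - n l) = 0" if "l \<in> idx" for l
    using that finite_idx by (metis sum_eq_0_iff)
  then have "A n = A (\<lambda>_. - 1)" using "0.prems"(3) by (intro A_cong) force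
  then have "f \<in> simple_poles" using "0.prems" by (auto simp: simple_poles_def)
  then show ?case by (intro span_base) blast
next
  case (Suc k)
  then obtain i where i: "i \<in> idx" "nat (- 1 - n i) \<noteq> 0"
    by (metis Zero_neq_Suc sum.neutral)
  then have ni: "n i \<le> - 2" by linarith
  obtain v where v: "linear_form v" "ev (pt i) v \<noteq> 0" using pt_form[OF i(1)] by blast
  let ?n = "\<lambda>l. n l + 1"
  \<comment> \<open>Since the \<beta>_i sum to 0, this exponent gives the potential v^e
    \<alpha>^(n+1) degree 0.\<close>
  define e where "e = nat (- sum ?n idx)"
  have "sum ?n idx \<le> 0" 
  proof (rule sum_nonpos)
    show "n l + 1 \<le> 0" if "l \<in> idx" for l using Suc.prems(3)[OF that] by simp
  qed
  then have e: "of_int (sum ?n idx) = (- of_nat e :: complex)" by (simp add: e_def of_nat_nat)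
  have "v ^ e \<in> hom (0 - sum \<beta> idx - of_int (sum ?n idx))"
    unfolding sum_0 e using hom_power[OF hom_linear_form[OF v(1)], of e] by simp
  then have h: "emb (v ^ e) * A ?n \<in> eig 0" unfolding eig_A .
  obtain g where g: "g \<in> boundaries M" "dD C1 (emb (v ^ e) * A ?n) = dX C2 g"
      "dD C2 (emb (v ^ e) * A ?n) = - dX C1 g"
    using potential_boundary[OF order.refl idx_nonempty _ MlocI[of idx ?n "v ^ e"] h] by blast
  obtain w where w1: "g = emb w * A (dec idx ?n)"
    and w2: "\<And>l. l \<in> idx \<Longrightarrow> ev (pt l) (v ^ e) \<noteq> 0 \<Longrightarrow> \<beta> l + of_int (n l + 1) \<noteq> 0 \<Longrightarrow> ev (pt l) w \<noteq> 0"
    using boundary_numerator[OF h g(2,3)] by blast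
  have "\<beta> i + of_int (n i + 1) \<noteq> 0" using ni by (intro exponent_nonzero i) simp
  then have w: "g = emb w * A (dec idx ?n)" "ev (pt i) w \<noteq> 0"
    using w1 w2[OF i(1)] v(2) by simp_all
  have "A (dec idx ?n) = A n" by (rule A_cong) (simp add: dec_def)
  with w have gn: "g = emb w * A n" by simp
  have geig: "g \<in> eig (- 2)" using boundaries_subset[OF stable_M] g(1) by blast
  define c where "c = ev (pt i) p / ev (pt i) w"
  have eq: "f - cscale c g = emb (p - const2 c * w) * A n"
    by (simp add: Suc.prems(2) gn cscale_def algebra_simps)
  have fg: "f - cscale c g \<in> eig (- 2)" by (intro subspace_diff subspace_scale subspace_eig Suc.prems geig)
  moreover have "ev (pt i) (p - const2 c * w) = 0" using w(2) by (simp add: c_def)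
  ultimately have "\<alpha> i dvd p - const2 c * w" using pt_dvd[OF i(1)] unfolding eq eig_A by blast
  then obtain r where r: "p - const2 c * w = \<alpha> i * r" by (auto elim: dvdE)
  let ?n' = "n(i := n i + 1)"
  have "emb (\<alpha> i) * A n = A ?n'" by (rule A_shift1[OF i(1)]) auto
  then have fr: "f - cscale c g = emb r * A ?n'" unfolding eq r by (simp add: mult_ac)
  have le: "\<And>l. l \<in> idx \<Longrightarrow> ?n' l \<le> - 1" using Suc.prems(3) ni by auto
  have "(\<Sum>l\<in>idx. nat (- 1 - n l)) = nat (- 1 - n i) + (\<Sum>l\<in>idx - {i}. nat (- 1 - n l))"
    by (rule sum.remove[OF finite_idx i(1)])
  moreover have "(\<Sum>l\<in>idx. nat (- 1 - ?n' l)) = nat (- 1 - (n i + 1)) + (\<Sum>l\<in>idx - {i}. nat (- 1 - n l))"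
    by (subst sum.remove[OF finite_idx i(1)]) (auto intro: sum.cong)
  ultimately have "k = (\<Sum>l\<in>idx. nat (- 1 - ?n' l))" using Suc.hyps(2) ni by linarith
  then have "f - cscale c g \<in> span (boundaries M \<union> simple_poles)" using Suc.hyps(1) fg fr le by blast
  moreover have "cscale c g \<in> span (boundaries M \<union> simple_poles)" using g(1) by (intro span_scale span_base) blast
  ultimately have "(f - cscale c g) + cscale c g \<in> span (boundaries M \<union> simple_poles)" by (rule span_add)
  then show ?case by simp
qed

lemma span_simple_poles: "M \<inter> eig (- 2) \<subseteq> span (boundaries M \<union> simple_poles)"
proof
  fix f assume f: "f \<in> M \<inter> eig (- 2)"
  then obtain N where N: "\<And>k. k \<ge> N \<Longrightarrow> \<exists>q. f = emb q * A (flat idx (- int k))" using Mloc_flat by blast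
  obtain q where "f = emb q * A (flat idx (- int (Suc N)))" using N[of "Suc N"] by auto
  then show "f \<in> span (boundaries M \<union> simple_poles)"
    using f by (intro reduce_poles[of f q]) (auto simp: flat_def)
qed

lemma one_eig: "emb 1 * A (\<lambda>_. 0) \<in> eig 0"
  unfolding eig_A sum_0 using hom_one by simp

text \<open>A pole of \<open>h\<close> would give a derivative a pole of order at least 2. So
  \<open>h\<close> is a polynomial, and its degree is 0.\<close>

lemma potential_of_simple_poles_const:
  assumes f: "f \<in> simple_poles" and h: "h \<in> M" "h \<in> eig 0" "dD C1 h = dX C2 f" "dD C2 h = - dX C1 f"
  obtains c where "h = cscale c 1"
proof -
  obtain r where r: "f = emb r * A (\<lambda>_. - 1)" using f by (auto simp: simple_poles_def)
  have D: "emb (prod \<alpha> idx) * dD j h \<in> Mloc {}" for j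
  proof -
    have "emb (prod \<alpha> idx) * A (\<lambda>_. - 1) = A (\<lambda>_. 0)" by (rule A_shift) auto
    then have "emb (prod \<alpha> idx) * dX i f = emb (var i * r) * A (\<lambda>_. 0)" for i
      by (simp add: r dX_eq mult.left_commute mult.assoc)
    then have X: "emb (prod \<alpha> idx) * dX i f \<in> Mloc {}" for i using MlocI[of "{}" "\<lambda>_. 0" "var i * r"] by simp
    show ?thesis
      using X h(3,4) subspace_neg[OF subspace_Mloc X[of C1]] by (cases j) auto
  qed
  have "h \<in> Mloc (idx - B)" if "finite B" for B
    using that
  proof (induction B rule: finite_induct)
    case (insert i B)
    show ?case
    proof (cases "i \<in> idx - B")
      case True
      have "h \<in> Mloc (idx - B - {i})"
      proof (rule ccontr)
        assume "h \<notin> Mloc (idx - B - {i})"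
        then obtain p n where p: "h = emb p * A n" "n i < 0" "ev (pt i) p \<noteq> 0"
          using Mloc_pole[of i "idx - B" h 0] insert.IH h(2) True by (metis DiffD1)
        obtain j k where k: "pd j (\<alpha> i) = const2 k" "k \<noteq> 0"
          using linear_form_transversal[OF form] True by blast
        have "dD j h = emb (num idx j n p) * A (dec idx n)"
          unfolding p by (rule dD_num) auto
        then have "emb (prod \<alpha> idx) * dD j h = emb (num idx j n p) * A n"
          using A_dec[of idx n] by (simp add: mult_ac)
        moreover have "ev (pt i) (num idx j n p) \<noteq> 0"
          using ev_prod_other[of i "idx - {i}"] exponent_nonzero[of i "n i"] p k True by (simp add: ev_num)
        then have "emb (num idx j n p) * A n \<notin> Mloc {}"
          using p(2) True by (intro not_Mloc[of i]) auto
        ultimately show False using D[of j] by simp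
      qed
      moreover have "idx - insert i B = idx - B - {i}" by blast
      ultimately show ?thesis by (simp only:)
    next
      case False
      then have "idx - insert i B = idx - B" by blast
      then show ?thesis using insert.IH by (simp only:)
    qed
  qed (simp add: h(1))
  from this[OF finite_idx] obtain p n where p: "h = emb p * A n" "\<forall>l\<in>idx. 0 \<le> n l" by (auto simp: Mloc_def)
  then have hp: "h = emb (p * P n) * A (\<lambda>_. 0)" using A_P[of n] by (simp add: A_0)
  then have "p * P n \<in> hom 0" using h(2) unfolding hp eig_A sum_0 by simp
  then obtain c where "p * P n = const2 c" using hom_0_const by blast
  then have "h = cscale c 1" using hp by (simp add: cscale_def A_0 del: emb_simps(6))
  then show ?thesis using that by blast
qed

text \<open>The generator is the boundary whose potential is the constant 1, that is
  \<alpha>^\<beta> itself. A nonzero \<beta>_i is a residue of its logarithmic derivative and keeps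
  the numerator from vanishing at \<open>pt i\<close>.\<close>

lemma simple_pole_boundaries:
  obtains f where "boundaries M \<inter> simple_poles = span {f}" "f = 0 \<longleftrightarrow> (\<forall>i\<in>idx. \<beta> i = 0)"
proof -
  have one: "emb 1 * A (\<lambda>_. 0) = 1" by (simp add: A_0)
  have "emb 1 * A (\<lambda>_. 0) \<in> M" by (rule MlocI) auto
  then obtain f where f: "f \<in> boundaries M" "dD C1 (emb 1 * A (\<lambda>_. 0)) = dX C2 f" "dD C2 (emb 1 * A (\<lambda>_. 0)) = - dX C1 f"
    using potential_boundary[OF order.refl idx_nonempty _ _ one_eig] by blast
  obtain w where w: "f = emb w * A (dec idx (\<lambda>_. 0))" "\<And>i. i \<in> idx \<Longrightarrow> \<beta> i \<noteq> 0 \<Longrightarrow> ev (pt i) w \<noteq> 0"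
    using boundary_numerator[OF one_eig f(2,3)] by auto
  have "A (dec idx (\<lambda>_. 0)) = A (\<lambda>_. - 1)" by (rule A_cong) (simp add: dec_def)
  then have fK: "f \<in> simple_poles"
    using f(1) w(1) boundaries_subset[OF stable_M] unfolding simple_poles_def by auto
  have "boundaries M \<inter> simple_poles = span {f}"
  proof
    show "span {f} \<subseteq> boundaries M \<inter> simple_poles"
    proof (rule span_minimal)
      show "subspace (boundaries M \<inter> simple_poles)"
        by (intro subspace_inter subspace_boundaries stable_M subspace_simple_poles)
    qed (use f(1) fK in auto)
    show "boundaries M \<inter> simple_poles \<subseteq> span {f}"
    proof
      fix g assume g: "g \<in> boundaries M \<inter> simple_poles"
      then obtain h where h: "h \<in> M" "h \<in> eig 0" "dD C1 h = dX C2 g" "dD C2 h = - dX C1 g"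
        using boundary_potential[OF stable_M] by blast
      obtain c where c: "h = cscale c 1" using potential_of_simple_poles_const[OF _ h] g by blast
      have "dX C2 g = dX C2 (cscale c f)"
        using h(3) f(2) unfolding c one D_scale X_scale by simp
      then have "g = cscale c f" by (simp add: dX_eq var.simps)
      then show "g \<in> span {f}" by (auto simp: span_singleton)
    qed
  qed
  moreover have "f = 0 \<longleftrightarrow> (\<forall>i\<in>idx. \<beta> i = 0)"
  proof
    assume "f = 0"
    then have "w = 0" using w(1) by simp
    then show "\<forall>i\<in>idx. \<beta> i = 0" using w(2) by force
  next
    assume "\<forall>i\<in>idx. \<beta> i = 0"
    then have "dD C1 1 = 0" by (simp add: dD_eq)
    then show "f = 0" using f(2) unfolding one by (simp add: dX_eq var.simps)
  qed
  ultimately show ?thesis using that by blast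
qed

text \<open>Numerators have degree m - 2, which allows m - 1 monomials. For \<open>m = 1\<close>
  this degree is -1, and the space is zero.\<close>

lemma simple_poles_basis:
  obtains E where "independent E" "finite E" "card E = m - 1" "span E = simple_poles"
proof -
  let ?A = "A (\<lambda>_. - 1 :: int)"
  have K: "emb p * ?A \<in> simple_poles \<longleftrightarrow> p \<in> hom (of_nat m - 2)" for p
  proof -
    have "emb p * ?A \<in> simple_poles \<longleftrightarrow> emb p * ?A \<in> eig (- 2)" by (auto simp: simple_poles_def)
    moreover have "card idx = m" by (simp add: idx_def)
    ultimately show ?thesis by (simp add: eig_A sum_0 add.commute)
  qed
  show ?thesis
  proof (cases "m = 1")
    case True
    have notin: "(1 - 2 :: complex) \<noteq> of_nat e" for e
    proof
      assume "(1 - 2 :: complex) = of_nat e"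
      then have "of_nat e = (- 1 :: complex)" by simp
      then have "of_nat (Suc e) = (0 :: complex)" by simp
      then show False by (simp only: of_nat_eq_0_iff)
    qed
    have "f = 0" if f: "f \<in> simple_poles" for f
    proof -
      obtain p where p: "f = emb p * ?A" using f by (auto simp: simple_poles_def)
      then have "p \<in> hom (1 - 2)" using f K True by simp
      then show ?thesis using hom_nonzero[of p "1 - 2"] notin p by auto
    qed
    then have "simple_poles = {0}" using subspace_0[OF subspace_simple_poles] by blast
    then show ?thesis using that[of "{}"] True by (simp add: independent_empty)
  next
    case False
    define e where "e = m - 2"
    have me: "of_nat m - 2 = (of_nat e :: complex)" "m - 1 = Suc e" using False m by (auto simp: e_def)
    define g where "g = (\<lambda>a. emb (var C1 ^ a * var C2 ^ (e - a)) * ?A)"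
    have gsum: "(\<Sum>a\<le>e. cscale (u a) (g a)) =
        emb (\<Sum>a\<le>e. const2 (u a) * (var C1 ^ a * var C2 ^ (e - a))) * ?A" for u
      by (simp add: emb_sum sum_distrib_right g_def cscale_def mult.assoc del: emb_power)
    have zero: "u a = 0" if "(\<Sum>a\<le>e. cscale (u a) (g a)) = 0" "a \<le> e" for u a
    proof -
      have "(\<Sum>a\<le>e. const2 (u a) * (var C1 ^ a * var C2 ^ (e - a))) = 0"
        using that(1) unfolding gsum by simp
      then show ?thesis using coeff_monomial_sum[of u e "e - a" a] that(2) by simp
    qed
    have inj: "inj_on g {..e}"
    proof
      fix a b assume ab: "a \<in> {..e}" "b \<in> {..e}" "g a = g b"
      then have "var C1 ^ a * var C2 ^ (e - a) = var C1 ^ b * var C2 ^ (e - b)"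
        by (simp add: g_def del: emb_simps(6))
      then have "coeff (coeff (var C1 ^ a * var C2 ^ (e - a)) (e - a)) a =
        coeff (coeff (var C1 ^ b * var C2 ^ (e - b)) (e - a)) a" by simp
      then show "a = b" unfolding coeff_monomial by (auto split: if_splits)
    qed
    have "independent (g ` {..e})"
    proof (rule notI)
      assume "dependent (g ` {..e})"
      then obtain u x where u: "(\<Sum>v\<in>g ` {..e}. cscale (u v) v) = 0" "x \<in> g ` {..e}" "u x \<noteq> 0"
        by (auto simp: dependent_finite)
      then have "(\<Sum>a\<le>e. cscale (u (g a)) (g a)) = 0" by (simp add: sum.reindex[OF inj])
      from zero[of "u \<circ> g"] this u(2,3) show False by auto
    qed
    moreover have "card (g ` {..e}) = m - 1" using me by (simp add: card_image[OF inj])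
    moreover have "span (g ` {..e}) = simple_poles"
    proof
      have "var C1 ^ a * var C2 ^ (e - a) \<in> hom (of_nat e)" if "a \<le> e" for a
        using hom_mult[OF hom_power[OF hom_var, of C1 a] hom_power[OF hom_var, of C2 "e - a"]] that
        by (simp flip: of_nat_add)
      then have gK: "g a \<in> simple_poles" if "a \<le> e" for a
        using that unfolding g_def K me(1) by blast
      then show "span (g ` {..e}) \<subseteq> simple_poles"
        by (intro span_minimal subspace_simple_poles) auto
      show "simple_poles \<subseteq> span (g ` {..e})"
      proof
        fix f assume f: "f \<in> simple_poles"
        then obtain p where p: "f = emb p * ?A" by (auto simp: simple_poles_def)
        then have "p \<in> hom (of_nat e)" using f K me by simp
        from hom_monomial_sum[OF this] have "f = (\<Sum>a\<le>e. cscale (coeff (coeff p (e - a)) a) (g a))"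
          unfolding gsum p by simp
        then show "f \<in> span (g ` {..e})" by (simp only:) (intro span_sum span_scale span_base imageI)
      qed
    qed
    ultimately show ?thesis using that by blast
  qed
qed

text \<open>The exponent is the dimension of the space of simple poles minus that of its
  intersection with the boundaries.\<close>

lemma cov_chain_degree_minus2:
  "(cov ^^ (m - 1 - (if \<forall>i\<in>idx. \<beta> i = 0 then 0 else 1))) (cogen M (boundaries M)) M"
proof -
  obtain E where E: "independent E" "finite E" "card E = m - 1" "span E = simple_poles"
    using simple_poles_basis .
  obtain f where f: "boundaries M \<inter> simple_poles = span {f}" "f = 0 \<longleftrightarrow> (\<forall>i\<in>idx. \<beta> i = 0)"
    using simple_pole_boundaries .
  define F where "F = (if f = 0 then {} else {f})"
  have F: "independent F" "boundaries M \<inter> span E = span F" "card F = (if \<forall>i\<in>idx. \<beta> i = 0 then 0 else 1)"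
    using f E(4) by (auto simp: F_def independent_empty)
  note sB = subspace_boundaries[OF stable_M]
  obtain G where G: "finite G" "card G = card E - card F" "G \<subseteq> span E"
    "\<And>g. g \<in> G \<Longrightarrow> g \<notin> span (boundaries M \<union> (G - {g}))" "span E \<subseteq> span (boundaries M \<union> G)"
    using basis_modulo[OF sB E(1,2) F(1,2)] by metis
  have GM: "G \<subseteq> M \<inter> eig (- 2)" using G(3) E(4) simple_poles_subset by blast
  have BM: "boundaries M \<subseteq> M \<inter> eig (- 2)" by (rule boundaries_subset[OF stable_M])
  have "span (boundaries M \<union> G) \<subseteq> M \<inter> eig (- 2)"
    using GM BM by (intro span_minimal subspace_inter subspace_Mloc subspace_eig) auto
  moreover have "M \<inter> eig (- 2) \<subseteq> span (boundaries M \<union> G)"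
  proof -
    have "boundaries M \<union> simple_poles \<subseteq> span (boundaries M \<union> G)"
      using G(5) E(4) span_superset[of "boundaries M \<union> G"] by blast
    then show ?thesis using span_simple_poles span_minimal[OF _ subspace_span] by blast
  qed
  ultimately have "span (boundaries M \<union> G) = M \<inter> eig (- 2)" by blast
  then show ?thesis
    using cov_chain_cogen[OF stable_M graded_Mloc sB order.refl BM G(1) GM G(4)]
      cogen_top[OF stable_M graded_Mloc] G(2) F(3) E(3) by simp
qed

end

section \<open>The length of the module\<close>

context line_arrangement
begin

definition minimal_part :: "nat set \<Rightarrow> ratfun2 set" where
  "minimal_part S = cogen (Mloc S) (boundaries (Mloc S))"

text \<open>\<open>Suc\<close> accounts for the simple bottom, which belongs to the lines of nonzero
  exponent; the hypothesis makes these exponents nonintegral, as \<open>cov_bottom\<close>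
  requires.\<close>

lemma cov_chain_lines:
  assumes nonint: "\<And>i. i \<in> idx \<Longrightarrow> \<beta> i \<in> \<int> \<Longrightarrow> \<beta> i = 0"
  shows "(cov ^^ Suc (card {i \<in> idx. \<beta> i = 0})) {0} (minimal_part idx)"
proof -
  let ?J = "{i \<in> idx. \<beta> i \<noteq> 0}" and ?Z = "{i \<in> idx. \<beta> i = 0}"
  have "(cov ^^ card B) (minimal_part ?J) (minimal_part (?J \<union> B))" if "finite B" "B \<subseteq> ?Z" for B
    using that
  proof (induction B rule: finite_induct)
    case (insert i B)
    have i: "i \<in> idx" "\<beta> i = 0" using insert.prems by auto
    let ?T = "?J \<union> insert i B"
    have "cov (minimal_part (?T - {i})) (minimal_part ?T)"
      unfolding minimal_part_def by (rule cov_add_line) (use insert.prems in auto)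
    moreover have "?T - {i} = ?J \<union> B" using insert.hyps i by auto
    ultimately have "cov (minimal_part (?J \<union> B)) (minimal_part ?T)" by (simp only:)
    with insert have "(cov ^^ Suc (card B)) (minimal_part ?J) (minimal_part ?T)"
      by (intro relpowp_Suc_I) auto
    then show ?case using insert.hyps by simp
  qed simp
  from this[of ?Z] have "(cov ^^ card ?Z) (minimal_part ?J) (minimal_part (?J \<union> ?Z))"
    using finite_idx by simp
  moreover have "?J \<union> ?Z = idx" by auto
  ultimately have "(cov ^^ card ?Z) (minimal_part ?J) (minimal_part idx)" by (simp only:)
  moreover have "cov {0} (minimal_part ?J)"
    unfolding minimal_part_def by (rule cov_bottom) (use nonint in auto)
  ultimately show ?thesis by (intro relpowp_Suc_I2)
qed

text \<open>Every degree that occurs differs from the sum of the exponents by an integer, so degree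
  -2 is absent and nothing lives at the origin.\<close>

lemma minimal_part_top:
  assumes "sum \<beta> idx \<notin> \<int>"
  shows "minimal_part idx = Mloc idx"
proof -
  have st: "stable (Mloc idx)" by (rule stable_Mloc) auto
  have "f = 0" if f: "f \<in> Mloc idx" "f \<in> eig (- 2)" for f
  proof (rule ccontr)
    assume "f \<noteq> 0"
    moreover obtain p n where p: "f = emb p * A n" using f by (auto simp: Mloc_def)
    ultimately have "p \<noteq> 0" by auto
    then obtain e where "- 2 - sum \<beta> idx - of_int (sum n idx) = of_nat e"
      using f(2) hom_nonzero unfolding p eig_A by blast
    then have "sum \<beta> idx = of_int (- 2 - sum n idx - int e)" by (simp add: algebra_simps)
    then show False using assms by (metis Ints_of_int)
  qed
  moreover have "0 \<in> boundaries (Mloc idx)" by (rule subspace_0[OF subspace_boundaries[OF st]])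
  ultimately have "boundaries (Mloc idx) = Mloc idx \<inter> eig (- 2)"
    using boundaries_subset[OF st] by blast
  then show ?thesis using cogen_top[OF st graded_Mloc] by (simp add: minimal_part_def)
qed

text \<open>The shift \<open>f \<mapsto> f \<alpha>\<^sup>\<nu>\<close> identifies the module of \<open>\<beta> + \<nu>\<close> with the one of \<open>\<beta>\<close>.\<close>

lemma dD_shift:
  "dD j (f * A \<nu>) = A \<nu> * gen_act m \<alpha> (\<lambda>i. \<beta> i + of_int (\<nu> i)) (D j) f"
proof -
  have act: "gen_act m \<alpha> (\<lambda>i. \<beta> i + of_int (\<nu> i)) (D j) f = fpd j f +
      f * (\<Sum>l\<in>idx. emb (const2 (\<beta> l + of_int (\<nu> l))) * emb (pd j (\<alpha> l)) / emb (\<alpha> l))"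
    by (simp add: idx_def Fract_emb del: One_nat_def)
  have ring: "f' * a + f * (a * s) + f * a * t = a * (f' + f * (s + t))" for f' f a s t :: ratfun2
    by (simp add: algebra_simps)
  show ?thesis
    unfolding act unfolding log_form_shift dD_eq fpd_mult fpd_A by (rule ring)
qed

lemma stable_shift:
  assumes "weyl_space.stable cscale (\<lambda>i. gen_act m \<alpha> \<beta>' (X i)) (\<lambda>i. gen_act m \<alpha> \<beta>' (D i)) H"
    and \<beta>': "\<beta>' = (\<lambda>i. \<beta> i + of_int (\<nu> i))"
  shows "stable ((\<lambda>f. f * A \<nu>) ` H)"
proof -
  interpret L: line_arrangement m \<alpha> \<beta>' by unfold_locales (use forms indep in auto)
  have X: "L.dX = (\<lambda>i. gen_act m \<alpha> \<beta>' (X i))" and D: "L.dD = (\<lambda>i. gen_act m \<alpha> \<beta>' (D i))"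
    by (auto simp: L.dX_def L.dD_def fun_eq_iff)
  have H: "L.stable H" using assms(1) unfolding X D .
  have "subspace ((\<lambda>f. f * A \<nu>) ` H)"
  proof (rule subspaceI)
    show "0 \<in> (\<lambda>f. f * A \<nu>) ` H" using subspace_0[OF L.stable_subspace[OF H]] by force
    show "f + g \<in> (\<lambda>f. f * A \<nu>) ` H" if "f \<in> (\<lambda>f. f * A \<nu>) ` H" "g \<in> (\<lambda>f. f * A \<nu>) ` H" for f g
      using that subspace_add[OF L.stable_subspace[OF H]] by (auto simp flip: distrib_right)
    show "cscale c f \<in> (\<lambda>f. f * A \<nu>) ` H" if f: "f \<in> (\<lambda>f. f * A \<nu>) ` H" for c f
    proof -
      obtain g where "g \<in> H" "f = g * A \<nu>" using f by auto
      then have "cscale c f = cscale c g * A \<nu>" "cscale c g \<in> H"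
        using subspace_scale[OF L.stable_subspace[OF H]] by (auto simp: cscale_def mult.assoc)
      then show ?thesis by blast
    qed
  qed
  moreover have "dX i (g * A \<nu>) = L.dX i g * A \<nu>" for i g
    by (simp add: dX_eq L.dX_eq mult.assoc)
  moreover have "dD i (g * A \<nu>) = L.dD i g * A \<nu>" for i g
    unfolding dD_shift L.dD_def unfolding \<beta>' by (rule mult.commute)
  ultimately show ?thesis
    using L.stable_X[OF H] L.stable_D[OF H] by (auto simp: stable_def)
qed

text \<open>Multiplication by \<alpha>^(-\<nu>) inverts the shift, so the two lattices of stable
  subspaces are isomorphic.\<close>

lemma cov_shift:
  assumes "line_arrangement.dX m \<alpha> \<beta>' = dX'" "line_arrangement.dD m \<alpha> \<beta>' = dD'"
    and \<beta>': "\<beta>' = (\<lambda>i. \<beta> i + of_int (\<nu> i))"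
    and cov: "weyl_space.cov cscale dX' dD' B C"
  shows "cov ((\<lambda>f. f * A \<nu>) ` B) ((\<lambda>f. f * A \<nu>) ` C)"
proof -
  interpret L: line_arrangement m \<alpha> \<beta>' by unfold_locales (use forms indep in auto)
  let ?\<phi> = "\<lambda>f. f * A \<nu>" and ?\<psi> = "\<lambda>f. f * A (\<lambda>l. - \<nu> l)"
  have inv: "A \<nu> * A (\<lambda>l. - \<nu> l) = 1"
    using A_add[of \<nu> "\<lambda>l. - \<nu> l"] by (simp add: A_0)
  have X: "L.dX = (\<lambda>i. gen_act m \<alpha> \<beta>' (X i))" and D: "L.dD = (\<lambda>i. gen_act m \<alpha> \<beta>' (D i))"
    by (auto simp: L.dX_def L.dD_def fun_eq_iff)
  have X0: "dX = (\<lambda>i. gen_act m \<alpha> \<beta> (X i))" and D0: "dD = (\<lambda>i. gen_act m \<alpha> \<beta> (D i))"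
    by (auto simp: dX_def dD_def fun_eq_iff)
  have cov: "L.cov B C" using cov assms(1,2) by simp
  have phi: "stable (?\<phi> ` H)" if "L.stable H" for H
    using that unfolding X D by (rule stable_shift[OF _ \<beta>'])
  have psi: "L.stable (?\<psi> ` H)" if "stable H" for H
  proof -
    have "\<beta> = (\<lambda>i. \<beta>' i + of_int (- \<nu> i))" by (simp add: \<beta>')
    then show ?thesis
      using that L.stable_shift[of \<beta> H "\<lambda>l. - \<nu> l"] unfolding X0 D0 by simp
  qed
  have "?\<psi> (?\<phi> f) = f" "?\<phi> (?\<psi> f) = f" for f
    using inv by (simp_all add: mult.assoc mult.commute[of "A (\<lambda>l. - \<nu> l)" "A \<nu>"])
  then have inverse: "?\<psi> ` ?\<phi> ` H = H" "?\<phi> ` ?\<psi> ` H = H" for H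
    by (simp_all only: image_image image_ident)
  have between: "H = ?\<phi> ` B \<or> H = ?\<phi> ` C" if H: "stable H" "?\<phi> ` B \<subseteq> H" "H \<subseteq> ?\<phi> ` C" for H
  proof -
    have "B \<subseteq> ?\<psi> ` H" "?\<psi> ` H \<subseteq> C"
      using image_mono[OF H(2), of ?\<psi>] image_mono[OF H(3), of ?\<psi>] unfolding inverse by auto
    then have "?\<psi> ` H = B \<or> ?\<psi> ` H = C" using cov psi[OF H(1)] unfolding L.cov_def by blast
    then show ?thesis using inverse(2)[of H] by auto
  qed
  have BC: "L.stable B" "L.stable C" "B \<subset> C" using cov by (auto simp: L.cov_def)
  have ne: "?\<phi> ` B \<noteq> ?\<phi> ` C"
  proof
    assume "?\<phi> ` B = ?\<phi> ` C"
    then have "?\<psi> ` ?\<phi> ` B = ?\<psi> ` ?\<phi> ` C" by (simp only:)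
    then show False using BC(3) unfolding inverse by blast
  qed
  show ?thesis
    unfolding cov_def psubset_eq
  proof (intro conjI allI impI)
    show "stable (?\<phi> ` B)" "stable (?\<phi> ` C)" by (rule phi[OF BC(1)], rule phi[OF BC(2)])
    show "?\<phi> ` B \<subseteq> ?\<phi> ` C" using BC(3) by (intro image_mono) (rule psubset_imp_subset)
    show "?\<phi> ` B \<noteq> ?\<phi> ` C" by (rule ne)
    show "H = ?\<phi> ` B \<or> H = ?\<phi> ` C" if "stable H \<and> ?\<phi> ` B \<subseteq> H \<and> H \<subseteq> ?\<phi> ` C" for H
      by (rule between) (simp_all only: that)
  qed
qed

text \<open>\<alpha>^\<nu> is a unit of the localization, so the shift maps \<open>Mloc idx\<close>
  onto itself.\<close>

lemma cov_power_shift: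
  assumes \<beta>': "\<beta>' = (\<lambda>i. \<beta> i + of_int (\<nu> i))"
    and chain: "(weyl_space.cov cscale (line_arrangement.dX m \<alpha> \<beta>') (line_arrangement.dD m \<alpha> \<beta>') ^^ r) {0} (Mloc idx)"
  shows "(cov ^^ r) {0} (Mloc idx)"
proof -
  let ?\<phi> = "\<lambda>f. f * A \<nu>"
  have "(cov ^^ r) (?\<phi> ` B) (?\<phi> ` C)"
    if "(weyl_space.cov cscale (line_arrangement.dX m \<alpha> \<beta>') (line_arrangement.dD m \<alpha> \<beta>') ^^ r) B C" for B C
    using that
  proof (induction r arbitrary: C)
    case (Suc r)
    then show ?case using cov_shift[OF refl refl \<beta>'] by (auto elim!: relpowp_Suc_E intro: relpowp_Suc_I)
  qed simp
  from this[OF chain] have "(cov ^^ r) {0} (?\<phi> ` Mloc idx)" by simp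
  moreover have "?\<phi> ` Mloc idx = Mloc idx"
  proof
    have mem: "f * A \<mu> \<in> Mloc idx" if f: "f \<in> Mloc idx" for f \<mu>
    proof -
      obtain p n where "f = emb p * A n" using f by (auto simp: Mloc_def)
      then have "f * A \<mu> = emb p * A (\<lambda>l. n l + \<mu> l)" by (simp add: A_add mult.assoc)
      then show ?thesis using MlocI[of idx "\<lambda>l. n l + \<mu> l" p] by simp
    qed
    then show "?\<phi> ` Mloc idx \<subseteq> Mloc idx" by blast
    show "Mloc idx \<subseteq> ?\<phi> ` Mloc idx"
    proof
      fix f assume "f \<in> Mloc idx"
      then have "f * A (\<lambda>l. - \<nu> l) \<in> Mloc idx" by (rule mem)
      moreover have "f = f * A (\<lambda>l. - \<nu> l) * A \<nu>"
        using A_add[of "\<lambda>l. - \<nu> l" \<nu>] by (simp add: A_0 mult.assoc)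
      ultimately show "f \<in> ?\<phi> ` Mloc idx" by blast
    qed
  qed
  ultimately show ?thesis by simp
qed

section \<open>From chains of stable subspaces to composition series\<close>

lemma stable_free_act: "stable H \<Longrightarrow> f \<in> H \<Longrightarrow> free_act m \<alpha> \<beta> p f \<in> H"
proof -
  assume H: "stable H" "f \<in> H"
  have "foldr (gen_act m \<alpha> \<beta>) ws f \<in> H" for ws
  proof (induction ws)
    case (Cons w ws)
    then show ?case
      using stable_X[OF H(1)] stable_D[OF H(1)] by (cases w) (auto simp: dX_def dD_def simp del: gen_act.simps)
  qed (simp add: H(2))
  then show ?thesis
    using subspace_scale[OF stable_subspace[OF H(1)]]
    by (auto simp: free_act_def cscale_def emb_def intro!: subspace_sum stable_subspace[OF H(1)])
qed

text \<open>Complex scalars act through the empty word and the four operators through words of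
  length one; conversely each element of the free algebra acts as a combination of words in these
  operators.\<close>

lemma submodule_iff_stable:
  "submodule H weyl_algebra (M_module m \<alpha> \<beta>) \<longleftrightarrow> stable H \<and> H \<subseteq> Mloc idx"
proof -
  let ?M = "M_module m \<alpha> \<beta>" and ?I = "Idl\<^bsub>free_algebra\<^esub> weyl_relations"
  interpret Mod: left_module weyl_algebra ?M
    by (rule M_module_left_module) (use forms in blast)
  have car: "carrier weyl_algebra = range (\<lambda>p. ?I +>\<^bsub>free_algebra\<^esub> p)"
    by (auto simp: weyl_algebra_def FactRing_def A_RCOSETS_def')
  have act: "(\<forall>a\<in>carrier weyl_algebra. \<forall>x\<in>H. a \<odot>\<^bsub>?M\<^esub> x \<in> H) \<longleftrightarrow> (\<forall>p. \<forall>x\<in>H. free_act m \<alpha> \<beta> p x \<in> H)"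
    unfolding car by (simp add: M_module_def weyl_act_coset)
  have iff: "submodule H weyl_algebra ?M \<longleftrightarrow> H \<subseteq> Mloc idx \<and> 0 \<in> H \<and> (\<forall>x\<in>H. \<forall>y\<in>H. x + y \<in> H) \<and>
      (\<forall>p. \<forall>x\<in>H. free_act m \<alpha> \<beta> p x \<in> H)"
    unfolding Mod.submodule_iff act by (simp add: M_module_def Mloc_localization del: One_nat_def)
  show ?thesis
  proof
    assume "submodule H weyl_algebra ?M"
    then have H: "H \<subseteq> Mloc idx" "0 \<in> H" "\<forall>x\<in>H. \<forall>y\<in>H. x + y \<in> H" "\<And>p x. x \<in> H \<Longrightarrow> free_act m \<alpha> \<beta> p x \<in> H"
      unfolding iff by auto
    have "cscale c x \<in> H" if "x \<in> H" for c x
      using H(4)[OF that, of "Poly_Mapping.single 0 c"]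
      by (simp only: free_act_single) (simp add: zero_weyl_word_def cscale_def emb_def)
    moreover have "dX i x \<in> H" "dD i x \<in> H" if "x \<in> H" for i x
      using H(4)[OF that, of "gen (X i)"] H(4)[OF that, of "gen (D i)"]
      by (simp_all only: free_act_gen dX_def dD_def)
    ultimately show "stable H \<and> H \<subseteq> Mloc idx"
      using H by (auto simp: stable_def subspace_def)
  next
    assume H: "stable H \<and> H \<subseteq> Mloc idx"
    then show "submodule H weyl_algebra ?M"
      unfolding iff using stable_free_act subspace_0 subspace_add stable_subspace by blast
  qed
qed

lemma module_length_of_chain:
  assumes "(cov ^^ r) {0} (Mloc idx)"
  shows "module_length weyl_algebra (M_module m \<alpha> \<beta>) = enat r"
proof -
  let ?M = "M_module m \<alpha> \<beta>"
  interpret Mod: plain_left_module weyl_algebra ?M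
    by (rule plain_left_module.intro, rule M_module_left_module) (use forms in blast)
  obtain N where N: "N 0 = {0}" "N r = Mloc idx" "\<And>i. i < r \<Longrightarrow> cov (N i) (N (Suc i))"
    using assms unfolding relpowp_fun_conv by blast
  have st: "stable (N i)" if "i \<le> r" for i
    using that N(3)[of "i - 1"] N(1) stable_zero by (cases i) (auto simp: cov_def)
  have "N i \<subseteq> N r" if "i \<le> r" for i
    using that
  proof (induction rule: inc_induct)
    case (step n)
    then show ?case using N(3)[of n] by (auto simp: cov_def)
  qed simp
  then have sub: "submodule (N i) weyl_algebra ?M" if "i \<le> r" for i
    using st that N(2) by (simp add: submodule_iff_stable)
  have "composition_series weyl_algebra ?M r N"
    unfolding Mod.composition_series_iff
  proof (intro conjI allI impI)
    show "N 0 = {\<zero>\<^bsub>?M\<^esub>}" using N(1) by (simp add: M_module_def)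
    show "N r = carrier ?M" using N(2) Mloc_localization by (simp add: M_module_def del: One_nat_def)
    show "submodule (N i) weyl_algebra ?M" if "i \<le> r" for i by (rule sub[OF that])
    show "N i \<subset> N (Suc i)" if "i < r" for i using N(3)[OF that] by (simp add: cov_def)
    show "H = N i \<or> H = N (Suc i)"
      if "i < r" "submodule H weyl_algebra ?M \<and> N i \<subseteq> H \<and> H \<subseteq> N (Suc i)" for i H
      using N(3)[OF that(1)] that(2) unfolding submodule_iff_stable cov_def by blast
  qed
  then show ?thesis by (rule Mod.module_length_eqI)
qed

text \<open>Integral exponents are shifted to 0. If a nonintegral \<beta>_j exists and the sum is
  integral, the integer left over is subtracted at \<open>j\<close>, whose exponent stays
  nonintegral.\<close>

lemma normalizing_shift:
  obtains \<nu> :: "nat \<Rightarrow> int" where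
    "\<And>i. i \<in> idx \<Longrightarrow> \<beta> i + of_int (\<nu> i) = 0 \<longleftrightarrow> \<beta> i \<in> \<int>"
    "\<And>i. i \<in> idx \<Longrightarrow> \<beta> i + of_int (\<nu> i) \<in> \<int> \<Longrightarrow> \<beta> i + of_int (\<nu> i) = 0"
    "sum \<beta> idx \<in> \<int> \<Longrightarrow> (\<Sum>i\<in>idx. \<beta> i + of_int (\<nu> i)) = 0"
proof -
  have "\<exists>n. \<beta> i + of_int n = 0 \<longleftrightarrow> \<beta> i \<in> \<int>" for i
  proof (cases "\<beta> i \<in> \<int>")
    case True
    then obtain k where "\<beta> i = of_int k" by (auto elim: Ints_cases)
    then have "\<beta> i + of_int (- k) = 0" by simp
    with True show ?thesis by blast
  next
    case False
    then show ?thesis by (intro exI[of _ 0]) auto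
  qed
  then obtain \<mu> where \<mu>: "\<And>i. \<beta> i + of_int (\<mu> i) = 0 \<longleftrightarrow> \<beta> i \<in> \<int>" by metis
  have int: "\<beta> i + of_int n \<in> \<int> \<longleftrightarrow> \<beta> i \<in> \<int>" for i n
    by (metis Ints_add Ints_diff Ints_of_int add_diff_cancel_right')
  have mu_int: "\<beta> i + of_int (\<mu> i) = 0" if "\<beta> i + of_int (\<mu> i) \<in> \<int>" for i
    using that \<mu> int by blast
  show ?thesis
  proof (cases "sum \<beta> idx \<in> \<int> \<and> (\<exists>j\<in>idx. \<beta> j \<notin> \<int>)")
    case True
    then obtain j where j: "j \<in> idx" "\<beta> j \<notin> \<int>" by blast
    have "(\<Sum>i\<in>idx. \<beta> i + of_int (\<mu> i)) \<in> \<int>"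
      using True by (auto simp: sum.distrib intro!: Ints_add Ints_sum)
    then obtain N where N: "(\<Sum>i\<in>idx. \<beta> i + of_int (\<mu> i)) = of_int N" by (auto elim: Ints_cases)
    let ?\<nu> = "\<mu>(j := \<mu> j - N)"
    have nj: "\<beta> j + of_int n \<noteq> 0" for n using int[of j n] j(2) Ints_0 by metis
    have eq: "\<beta> i + of_int (?\<nu> i) = 0 \<longleftrightarrow> \<beta> i \<in> \<int>" for i
      using \<mu>[of i] nj[of "\<mu> j - N"] j(2) by (cases "i = j") auto
    have "(\<Sum>i\<in>idx. \<beta> i + of_int (?\<nu> i)) = (\<beta> j + of_int (\<mu> j - N)) + (\<Sum>i\<in>idx - {j}. \<beta> i + of_int (\<mu> i))"
      by (subst sum.remove[OF finite_idx j(1)]) (auto intro!: sum.cong)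
    also have "\<dots> = (\<Sum>i\<in>idx. \<beta> i + of_int (\<mu> i)) - of_int N"
      using sum.remove[OF finite_idx j(1), of "\<lambda>i. \<beta> i + of_int (\<mu> i)"] by (simp add: algebra_simps)
    also have "\<dots> = 0" using N by simp
    finally show ?thesis using that[of ?\<nu>] eq int by blast
  next
    case False
    have "(\<Sum>i\<in>idx. \<beta> i + of_int (\<mu> i)) = 0" if "sum \<beta> idx \<in> \<int>"
      using False \<mu> that by (intro sum.neutral) blast
    then show ?thesis using that[of \<mu>] \<mu> mu_int by blast
  qed
qed

text \<open>\<open>Suc k\<close> counts the bottom and the lines of integral exponent, the other
  summand the factors at the origin. The case \<open>k = m\<close> is the one where the normalized
  exponents all vanish.\<close>

lemma length_by_sum:
  assumes m: "m \<ge> 1" and k: "k = card {i \<in> idx. \<beta> i \<in> \<int>}"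
  shows "module_length weyl_algebra (M_module m \<alpha> \<beta>) =
    enat (Suc k + (if sum \<beta> idx \<in> \<int> then m - 1 - (if k = m then 0 else 1) else 0))"
proof -
  obtain \<nu> :: "nat \<Rightarrow> int" where \<nu>:
    "\<And>i. i \<in> idx \<Longrightarrow> \<beta> i + of_int (\<nu> i) = 0 \<longleftrightarrow> \<beta> i \<in> \<int>"
    "\<And>i. i \<in> idx \<Longrightarrow> \<beta> i + of_int (\<nu> i) \<in> \<int> \<Longrightarrow> \<beta> i + of_int (\<nu> i) = 0"
    "sum \<beta> idx \<in> \<int> \<Longrightarrow> (\<Sum>i\<in>idx. \<beta> i + of_int (\<nu> i)) = 0"
    using normalizing_shift by blast
  define \<beta>' where "\<beta>' = (\<lambda>i. \<beta> i + of_int (\<nu> i))"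
  interpret L: line_arrangement m \<alpha> \<beta>' by unfold_locales (use forms indep in auto)
  have "{i \<in> idx. \<beta>' i = 0} = {i \<in> idx. \<beta> i \<in> \<int>}" using \<nu>(1) by (auto simp: \<beta>'_def)
  then have k': "card {i \<in> idx. \<beta>' i = 0} = k" using k by simp
  have nonint: "\<And>i. i \<in> idx \<Longrightarrow> \<beta>' i \<in> \<int> \<Longrightarrow> \<beta>' i = 0" using \<nu>(2) by (simp add: \<beta>'_def)
  have chain: "(L.cov ^^ Suc k) {0} (L.minimal_part idx)"
    using L.cov_chain_lines[OF nonint] k' by simp
  have card: "card idx = m" by (simp add: idx_def)
  have km: "(\<forall>i\<in>idx. \<beta>' i = 0) \<longleftrightarrow> k = m"
  proof
    assume "\<forall>i\<in>idx. \<beta>' i = 0"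
    then have "{i \<in> idx. \<beta>' i = 0} = idx" by blast
    then show "k = m" using k' card by simp
  next
    assume "k = m"
    then have "{i \<in> idx. \<beta>' i = 0} = idx"
      using k' card finite_idx by (intro card_subset_eq) auto
    then show "\<forall>i\<in>idx. \<beta>' i = 0" by blast
  qed
  have "(L.cov ^^ (Suc k + (if sum \<beta> idx \<in> \<int> then m - 1 - (if k = m then 0 else 1) else 0))) {0} (Mloc idx)"
  proof (cases "sum \<beta> idx \<in> \<int>")
    case True
    then have "sum \<beta>' idx = 0" using \<nu>(3) by (simp add: \<beta>'_def)
    then interpret I: integral_arrangement m \<alpha> \<beta>'
      by unfold_locales (use nonint m in auto)
    have "(L.cov ^^ (m - 1 - (if k = m then 0 else 1))) (L.minimal_part idx) (Mloc idx)"
      using I.cov_chain_degree_minus2 unfolding L.minimal_part_def km .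
    then show ?thesis using True relpowp_trans[OF chain] by simp
  next
    case False
    have "sum \<beta>' idx = sum \<beta> idx + of_int (sum \<nu> idx)" by (simp add: \<beta>'_def sum.distrib)
    then have "sum \<beta>' idx \<notin> \<int>" using False by (metis Ints_diff Ints_of_int add_diff_cancel_right')
    then show ?thesis using chain L.minimal_part_top False by simp
  qed
  then show ?thesis
    by (intro module_length_of_chain cov_power_shift[OF \<beta>'_def])
qed

end

theorem theorem1p3:
  fixes m k :: nat and \<alpha> :: "nat \<Rightarrow> poly2" and \<beta> :: "nat \<Rightarrow> complex"
  assumes "m \<ge> 1"
    and "\<forall>i\<in>{1..m}. linear_form (\<alpha> i) \<and> \<alpha> i \<noteq> 0"
    and "pairwise (\<lambda>i j. lin_indep2 (\<alpha> i) (\<alpha> j)) {1..m}"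
    and "k = card {i \<in> {1..m}. \<beta> i \<in> \<int>}"
  shows "(k = m \<longrightarrow> module_length weyl_algebra (M_module m \<alpha> \<beta>) = enat (2 * m)) \<and>
    (k < m \<longrightarrow>
      ((\<Sum>i=1..m. \<beta> i) \<in> \<int> \<longrightarrow>
        module_length weyl_algebra (M_module m \<alpha> \<beta>) = enat (m + k - 1)) \<and>
      ((\<Sum>i=1..m. \<beta> i) \<notin> \<int> \<longrightarrow>
        module_length weyl_algebra (M_module m \<alpha> \<beta>) = enat (k + 1)))"
proof -
  interpret line_arrangement m \<alpha> \<beta>
    by unfold_locales (use assms in auto)
  have k: "k = card {i \<in> idx. \<beta> i \<in> \<int>}" using assms(4) by (simp add: idx_def del: One_nat_def)
  note len = length_by_sum[OF assms(1) k]
  have sum: "sum \<beta> idx = (\<Sum>i=1..m. \<beta> i)" by (simp add: idx_def)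
  have card: "card idx = m" by (simp add: idx_def)
  show ?thesis
  proof (intro conjI impI)
    assume km: "k = m"
    then have "{i \<in> idx. \<beta> i \<in> \<int>} = idx"
      using k card finite_idx by (intro card_subset_eq) auto
    then have "sum \<beta> idx \<in> \<int>" by (intro Ints_sum) blast
    then show "module_length weyl_algebra (M_module m \<alpha> \<beta>) = enat (2 * m)"
      using len km assms(1) by simp
  next
    assume km: "k < m" and int: "(\<Sum>i=1..m. \<beta> i) \<in> \<int>"
    \<comment> \<open>For a single line an integral sum forces \<open>k = m\<close>. Thus
      \<open>m\<close> is at least 2, and the subtraction \<open>m - 1 - 1\<close> is not
      truncated.\<close>
    have "m \<noteq> 1"
    proof
      assume "m = 1"
      then have "{i \<in> {1..m}. \<beta> i \<in> \<int>} = {1}" using int by auto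
      then show False using km assms(4) \<open>m = 1\<close> by simp
    qed
    then have "Suc k + (m - 1 - 1) = m + k - 1" using assms(1) by simp
    then show "module_length weyl_algebra (M_module m \<alpha> \<beta>) = enat (m + k - 1)"
      using len km int sum by simp
  next
    assume "k < m" "(\<Sum>i=1..m. \<beta> i) \<notin> \<int>"
    then show "module_length weyl_algebra (M_module m \<alpha> \<beta>) = enat (k + 1)"
      using len sum by simp
  qed
qed

end
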